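(* Let $G$ be a finite simple graph such that its toric ideal $I_G$ is geometrically vertex decomposable in $\mathbb{K}[E(G)]$. Let $H$ be the graph obtained from $G$ by gluing a cycle of length $2d$ ($d\ge2$) along an edge of $G$. Then (1) $a(\mathbb{K}[E(H)]/I_H)=a(\mathbb{K}[E(G)]/I_G)-(d-1)$; (2) $e(\mathbb{K}[E(H)]/I_H)=d\cdot e(\mathbb{K}[E(G)]/I_G)$.
   Context: $\mathbb{K}$ is an algebraically closed field of characteristic $0$. For a finite simple graph $G=(V,E)$ with vertices $x_1,\ldots,x_p$ and edges $e_1,\ldots,e_q$ (also used as names of variables of degree $1$), the toric ideal $I_G$ is the kernel of the $\mathbb{K}$-algebra homomorphism $\mathbb{K}[E(G)]=\mathbb{K}[e_1,\ldots,e_q]\to\mathbb{K}[x_1,\ldots,x_p]$ with $e_i\mapsto x_jx_k$ where $e_i=\{x_j,x_k\}$. Gluing: let $C_m$ be the cycle graph on $m$ vertices, fix an edge $e$ of $G$ and an edge $f$ of $C_m$. The graph obtained from $G$ by gluing a cycle of length $m$ along the edge $e$ is obtained from the disjoint union of $G$ and $C_m$ by identifying $e$ with $f$ (and the endpoints of $e$ with those of $f$), with no other identifications. Geometric vertex decomposability: let $S=\mathbb{K}[x_1,\ldots,x_n]$ and let $y=x_j$. A nonzero $f\in S$ is written $f=\sum_{i=0}^d\alpha_iy^i$ with $\alpha_i$ not involving $y$ and $\alpha_d\neq0$; $\mathrm{in}_y(f)=\alpha_dy^d$ and $\mathrm{in}_y(J)=\langle\mathrm{in}_y(f):f\in J\rangle$.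 A monomial order is $y$-compatible if $\mathrm{in}_<(\mathrm{in}_y(f))=\mathrm{in}_<(f)$ for all $f$. For a Gröbner basis $\{g_1,\ldots,g_m\}$ of $I$ with respect to such an order write $g_i=y^{d_i}q_i+r_i$ with $\mathrm{in}_y(g_i)=y^{d_i}q_i$, $q_i$ not involving $y$; put $C_{y,I}=\langle q_1,\ldots,q_m\rangle$, $N_{y,I}=\langle q_i:d_i=0\rangle$. An equality $\mathrm{in}_y(I)=C_{y,I}\cap(N_{y,I}+\langle y\rangle)$ is a geometric vertex decomposition of $I$ with respect to $y$. An ideal is unmixed if all associated primes $P$ of $S/I$ have $\dim(S/P)=\dim(S/I)$. $I$ is geometrically vertex decomposable if it is unmixed and either $I=\langle1\rangle$, or $I$ is generated by a (possibly empty) subset of the variables, or for some variable $y=x_j$ and $y$-compatible order there is a geometric vertex decomposition of $I$ such that the contractions of $C_{y,I}$ and $N_{y,I}$ to $\mathbb{K}[x_1,\ldots,\widehat{x_j},\ldots,x_n]$ are geometrically vertex decomposable. For a finitely generated graded module $M$ of dimension $\delta$ with Hilbert series $h_M(t)/(1-t)^{\delta}$: $a(M)=\deg h_M(t)-\delta$ ($a$-invariant) and $e(M)=h_M(1)$ (multiplicity). *)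

theory Defs
  imports
    "HOL-Algebra.QuotRing"
    "HOL-Algebra.Embedded_Algebras"
    "HOL-Library.Poly_Mapping"
    "HOL-Library.Extended_Nat"
    "HOL-Computational_Algebra.Polynomial_FPS"
begin

section \<open>Polynomial rings in several variables\<close>

text \<open>A monomial is its exponent vector, a finitely supported function from variables to
  exponents; a polynomial is a finitely supported function from monomials to coefficients.\<close>

type_synonym 'x monom = "'x \<Rightarrow>\<^sub>0 nat"
type_synonym ('x, 'k) mpoly = "('x \<Rightarrow>\<^sub>0 nat) \<Rightarrow>\<^sub>0 'k"

definition Const :: "'k \<Rightarrow> ('x, 'k::comm_ring_1) mpoly"
  where "Const c = Poly_Mapping.single 0 c"

definition Var :: "'x \<Rightarrow> ('x, 'k::comm_ring_1) mpoly"
  where "Var x = Poly_Mapping.single (Poly_Mapping.single x 1) 1"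

definition monoms :: "'x set \<Rightarrow> 'x monom set"
  where "monoms A = {m. Poly_Mapping.keys m \<subseteq> A}"

definition mpoly_ring :: "'x set \<Rightarrow> ('x, 'k::comm_ring_1) mpoly ring"
  where "mpoly_ring A =
    \<lparr>carrier = {p. Poly_Mapping.keys p \<subseteq> monoms A},
     monoid.mult = (*), one = 1, zero = 0, add = (+)\<rparr>"

text \<open>The homomorphism of algebras sending each variable \<open>x\<close> to \<open>s x\<close>; see
  \<open>mpoly_subst_ring_hom\<close>, \<open>mpoly_subst_Const\<close> and \<open>mpoly_subst_Var\<close> below.\<close>

definition mpoly_subst ::
    "('x \<Rightarrow> ('y, 'k::comm_ring_1) mpoly) \<Rightarrow> ('x, 'k) mpoly \<Rightarrow> ('y, 'k) mpoly"
  where "mpoly_subst s p =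
    (\<Sum>m\<in>Poly_Mapping.keys p. Const (Poly_Mapping.lookup p m) *
       (\<Prod>x\<in>Poly_Mapping.keys m. s x ^ Poly_Mapping.lookup m x))"

lemma monoms_add: "m \<in> monoms A \<Longrightarrow> n \<in> monoms A \<Longrightarrow> m + n \<in> monoms A"
  using Poly_Mapping.keys_add[of m n] by (auto simp: monoms_def)

lemma mpoly_ring_cring: "cring (mpoly_ring A :: ('x, 'k::comm_ring_1) mpoly ring)"
proof (intro cringI abelian_groupI comm_monoidI)
  fix p q :: "('x, 'k) mpoly"
  assume p: "p \<in> carrier (mpoly_ring A)" and q: "q \<in> carrier (mpoly_ring A)"
  show "p \<oplus>\<^bsub>mpoly_ring A\<^esub> q \<in> carrier (mpoly_ring A)"
    using p q Poly_Mapping.keys_add[of p q] by (auto simp: mpoly_ring_def)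
  show "p \<otimes>\<^bsub>mpoly_ring A\<^esub> q \<in> carrier (mpoly_ring A)"
    using p q keys_mult[of p q] monoms_add by (fastforce simp: mpoly_ring_def)
  show "\<exists>r\<in>carrier (mpoly_ring A). r \<oplus>\<^bsub>mpoly_ring A\<^esub> p = \<zero>\<^bsub>mpoly_ring A\<^esub>"
    using p by (intro bexI[of _ "- p"]) (auto simp: mpoly_ring_def in_keys_iff subset_iff)
qed (auto simp: mpoly_ring_def monoms_def algebra_simps)

lemma mpoly_subst_superset:
  assumes "finite M" "Poly_Mapping.keys p \<subseteq> M"
  shows "mpoly_subst s p = (\<Sum>m\<in>M. Const (Poly_Mapping.lookup p m) *
    (\<Prod>x\<in>Poly_Mapping.keys m. s x ^ Poly_Mapping.lookup m x))"
  unfolding mpoly_subst_def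
  by (rule sum.mono_neutral_left) (use assms in \<open>auto simp: Const_def in_keys_iff\<close>)

lemma mpoly_subst_add: "mpoly_subst s (p + q) = mpoly_subst s p + mpoly_subst s q"
proof -
  let ?M = "Poly_Mapping.keys p \<union> Poly_Mapping.keys q"
  have "Poly_Mapping.keys (p + q) \<subseteq> ?M"
    by (rule Poly_Mapping.keys_add)
  then show ?thesis
    by (simp add: mpoly_subst_superset[of ?M] lookup_add Const_def single_add
        distrib_right sum.distrib)
qed

lemma mpoly_subst_single:
  "mpoly_subst s (Poly_Mapping.single m c) =
    Const c * (\<Prod>x\<in>Poly_Mapping.keys m. s x ^ Poly_Mapping.lookup m x)"
  by (simp add: mpoly_subst_superset[of "{m}"])

lemma mpoly_subst_Const: "mpoly_subst s (Const c) = Const c"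
  using mpoly_subst_single[of s 0 c] by (simp add: Const_def)

lemma mpoly_subst_Var: "mpoly_subst s (Var x) = s x"
  by (simp add: Var_def mpoly_subst_single Const_def)

lemma Const_mult: "Const (a * b) = Const a * Const b"
  by (simp add: Const_def mult_single)

lemma mpoly_subst_mult_single:
  "mpoly_subst s (Poly_Mapping.single m a * Poly_Mapping.single n b) =
    mpoly_subst s (Poly_Mapping.single m a) * mpoly_subst s (Poly_Mapping.single n b)"
proof -
  let ?K = "Poly_Mapping.keys m \<union> Poly_Mapping.keys n"
  have ext: "(\<Prod>x\<in>Poly_Mapping.keys l. s x ^ Poly_Mapping.lookup l x) =
      (\<Prod>x\<in>?K. s x ^ Poly_Mapping.lookup l x)" if "Poly_Mapping.keys l \<subseteq> ?K" for l
    by (rule prod.mono_neutral_left) (use that in \<open>auto simp: in_keys_iff\<close>)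
  have "mpoly_subst s (Poly_Mapping.single (m + n) (a * b)) = Const (a * b) *
      ((\<Prod>x\<in>?K. s x ^ Poly_Mapping.lookup m x) * (\<Prod>x\<in>?K. s x ^ Poly_Mapping.lookup n x))"
    unfolding mpoly_subst_single ext[OF Poly_Mapping.keys_add]
    by (simp add: lookup_add power_add prod.distrib)
  then show ?thesis
    unfolding mult_single Const_mult mpoly_subst_single[of s m] mpoly_subst_single[of s n]
      ext[OF Un_upper1] ext[OF Un_upper2] by (simp only: mult_ac)
qed

lemma mpoly_subst_sum: "mpoly_subst s (sum f M) = (\<Sum>i\<in>M. mpoly_subst s (f i))"
  by (induction M rule: infinite_finite_induct)
     (auto simp: mpoly_subst_add, simp_all add: mpoly_subst_def)

lemma mpoly_eq_sum_single:
  "p = (\<Sum>m\<in>Poly_Mapping.keys p. Poly_Mapping.single m (Poly_Mapping.lookup p m))"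
  by (rule poly_mapping_eqI) (auto simp: lookup_sum lookup_single when_def in_keys_iff)

lemma mpoly_subst_mult: "mpoly_subst s (p * q) = mpoly_subst s p * mpoly_subst s q"
proof -
  let ?t = "\<lambda>p m. Poly_Mapping.single m (Poly_Mapping.lookup p m)"
  let ?P = "Poly_Mapping.keys p" and ?Q = "Poly_Mapping.keys q"
  have "mpoly_subst s (sum (?t p) ?P * sum (?t q) ?Q) =
      mpoly_subst s (sum (?t p) ?P) * mpoly_subst s (sum (?t q) ?Q)"
    by (simp add: sum_product mpoly_subst_sum mpoly_subst_mult_single)
  then show ?thesis
    by (simp flip: mpoly_eq_sum_single)
qed

lemma mpoly_subst_closed:
  assumes s: "\<And>x. x \<in> A \<Longrightarrow> s x \<in> carrier (mpoly_ring B)"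
    and p: "p \<in> carrier (mpoly_ring A)"
  shows "mpoly_subst s p \<in> carrier (mpoly_ring B)"
proof -
  have add: "a + b \<in> carrier (mpoly_ring B)" and mult: "a * b \<in> carrier (mpoly_ring B)"
    if "a \<in> carrier (mpoly_ring B)" "b \<in> carrier (mpoly_ring B)" for a b :: "('b, 'c) mpoly"
    using cring.cring_simprules(1,5)[OF mpoly_ring_cring that] by (auto simp: mpoly_ring_def)
  have const: "Const c \<in> carrier (mpoly_ring B)" for c :: 'c
    by (auto simp: mpoly_ring_def Const_def monoms_def)
  have zero: "0 \<in> carrier (mpoly_ring B :: ('b, 'c) mpoly ring)"
    and one: "1 \<in> carrier (mpoly_ring B :: ('b, 'c) mpoly ring)"
    by (auto simp: mpoly_ring_def monoms_def)
  have pow: "a ^ n \<in> carrier (mpoly_ring B)" if "a \<in> carrier (mpoly_ring B)"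
    for a :: "('b, 'c) mpoly" and n
    by (induction n) (auto intro: one mult that)
  have prod: "prod f M \<in> carrier (mpoly_ring B)"
    if "\<And>x. x \<in> M \<Longrightarrow> f x \<in> carrier (mpoly_ring B)" for f :: "'a \<Rightarrow> ('b, 'c) mpoly" and M
    using that by (induction M rule: infinite_finite_induct) (auto intro: one mult)
  have sum: "sum f M \<in> carrier (mpoly_ring B)"
    if "\<And>x. x \<in> M \<Longrightarrow> f x \<in> carrier (mpoly_ring B)" for f :: "'a monom \<Rightarrow> ('b, 'c) mpoly" and M
    using that by (induction M rule: infinite_finite_induct) (auto intro: zero add)
  show ?thesis
    unfolding mpoly_subst_def
    by (intro sum mult const prod pow s) (use p in \<open>auto simp: mpoly_ring_def monoms_def\<close>)
qed

lemma mpoly_subst_ring_hom: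
  fixes s :: "'x \<Rightarrow> ('y, 'k::comm_ring_1) mpoly"
  assumes "\<And>x. x \<in> A \<Longrightarrow> s x \<in> carrier (mpoly_ring B)"
  shows "mpoly_subst s \<in> ring_hom (mpoly_ring A) (mpoly_ring B)"
proof (rule ring_hom_memI)
  fix p :: "('x, 'k) mpoly"
  assume "p \<in> carrier (mpoly_ring A)"
  with assms show "mpoly_subst s p \<in> carrier (mpoly_ring B)"
    by (rule mpoly_subst_closed)
next
  have "mpoly_subst s 1 = 1"
    using mpoly_subst_Const[of s 1] by (simp add: Const_def)
  then show "mpoly_subst s \<one>\<^bsub>mpoly_ring A\<^esub> = \<one>\<^bsub>mpoly_ring B\<^esub>"
    by (simp add: mpoly_ring_def)
qed (simp_all add: mpoly_ring_def mpoly_subst_add mpoly_subst_mult)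

section \<open>Simple graphs, toric ideals and gluing\<close>

definition simple_graph :: "'v set \<Rightarrow> 'v set set \<Rightarrow> bool"
  where "simple_graph V E \<longleftrightarrow> finite V \<and> (\<forall>e\<in>E. e \<subseteq> V \<and> card e = 2)"

text \<open>The edges themselves serve as the variables of the ring containing the toric ideal.\<close>

definition toric_ideal :: "'v set \<Rightarrow> 'v set set \<Rightarrow> ('v set, 'k::comm_ring_1) mpoly set"
  where "toric_ideal V E =
    a_kernel (mpoly_ring E) (mpoly_ring V) (mpoly_subst (\<lambda>e. \<Prod>v\<in>e. Var v))"

definition cycle_verts :: "nat \<Rightarrow> nat set"
  where "cycle_verts m = {..<m}"

definition cycle_edges :: "nat \<Rightarrow> nat set set"
  where "cycle_edges m = {{i, (i + 1) mod m} | i. i < m}"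

text \<open>\<open>(W, F)\<close> is, up to isomorphism, the quotient of the disjoint union of \<open>(V, E)\<close> and
  \<open>(V', E')\<close> that identifies \<open>e = {a, b}\<close> with \<open>f = {c, d}\<close>: the maps \<open>i\<close> and \<open>j\<close> are the
  restrictions of the quotient map to the two parts. Only \<open>a\<close> with \<open>c\<close> and \<open>b\<close> with \<open>d\<close> are
  identified.\<close>

definition edge_gluing ::
    "'v set \<Rightarrow> 'v set set \<Rightarrow> 'v set \<Rightarrow> 'u set \<Rightarrow> 'u set set \<Rightarrow> 'u set \<Rightarrow>
     'w set \<Rightarrow> 'w set set \<Rightarrow> bool"
  where "edge_gluing V E e V' E' f W F \<longleftrightarrow>
    (\<exists>i j a b c d. e = {a, b} \<and> a \<noteq> b \<and> f = {c, d} \<and> c \<noteq> d \<and>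
       inj_on i V \<and> inj_on j V' \<and>
       (\<forall>u\<in>V. \<forall>w\<in>V'. i u = j w \<longleftrightarrow> (u = a \<and> w = c) \<or> (u = b \<and> w = d)) \<and>
       W = i ` V \<union> j ` V' \<and> F = (`) i ` E \<union> (`) j ` E')"

definition cycle_gluing ::
    "'v set \<Rightarrow> 'v set set \<Rightarrow> 'v set \<Rightarrow> nat \<Rightarrow> 'w set \<Rightarrow> 'w set set \<Rightarrow> bool"
  where "cycle_gluing V E e m W F \<longleftrightarrow>
    (\<exists>f\<in>cycle_edges m. edge_gluing V E e (cycle_verts m) (cycle_edges m) f W F)"

section \<open>Krull dimension, associated primes and unmixed ideals\<close>

text \<open>The zero ring gets dimension 0 here. This has no effect on \<open>unmixed\<close>, since the unit
  ideal has no associated primes.\<close>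

definition krull_dim :: "('a, 'b) ring_scheme \<Rightarrow> enat"
  where "krull_dim R =
    Sup {enat n | n. \<exists>P. (\<forall>i\<le>n. primeideal (P i) R) \<and> (\<forall>i<n. P i \<subset> P (Suc i))}"

text \<open>The associated primes of the module \<open>R/I\<close>: the primes that are the annihilator of the
  class of some \<open>f\<close>.\<close>

definition assoc_primes :: "('a, 'b) ring_scheme \<Rightarrow> 'a set \<Rightarrow> 'a set set"
  where "assoc_primes R I =
    {P. primeideal P R \<and> (\<exists>f\<in>carrier R. P = {g \<in> carrier R. g \<otimes>\<^bsub>R\<^esub> f \<in> I})}"

definition unmixed :: "('a, 'b) ring_scheme \<Rightarrow> 'a set \<Rightarrow> bool"
  where "unmixed R I \<longleftrightarrow> (\<forall>P\<in>assoc_primes R I. krull_dim (R Quot P) = krull_dim (R Quot I))"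

section \<open>Monomial orders and Groebner bases\<close>

definition monomial_order :: "'x set \<Rightarrow> ('x monom \<times> 'x monom) set \<Rightarrow> bool"
  where "monomial_order A r \<longleftrightarrow> well_order_on (monoms A) r \<and>
    (\<forall>m n. (m, n) \<in> r \<longrightarrow> (\<forall>t\<in>monoms A. (m + t, n + t) \<in> r))"

definition lead_monom :: "('x monom \<times> 'x monom) set \<Rightarrow> ('x, 'k::comm_ring_1) mpoly \<Rightarrow> 'x monom"
  where "lead_monom r p =
    (THE m. m \<in> Poly_Mapping.keys p \<and> (\<forall>n\<in>Poly_Mapping.keys p. (n, m) \<in> r))"

definition initial ::
    "('x monom \<times> 'x monom) set \<Rightarrow> ('x, 'k::comm_ring_1) mpoly \<Rightarrow> ('x, 'k) mpoly"
  where "initial r p =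
    (if p = 0 then 0
     else Poly_Mapping.single (lead_monom r p) (Poly_Mapping.lookup p (lead_monom r p)))"

definition groebner_basis ::
    "'x set \<Rightarrow> ('x monom \<times> 'x monom) set \<Rightarrow> ('x, 'k::comm_ring_1) mpoly set \<Rightarrow>
     ('x, 'k) mpoly set \<Rightarrow> bool"
  where "groebner_basis A r I Gs \<longleftrightarrow> finite Gs \<and> Gs \<subseteq> I \<and> 0 \<notin> Gs \<and>
    genideal (mpoly_ring A) (initial r ` Gs) = genideal (mpoly_ring A) (initial r ` I)"

section \<open>Geometric vertex decomposition\<close>

definition deg_in :: "'x \<Rightarrow> ('x, 'k::comm_ring_1) mpoly \<Rightarrow> nat"
  where "deg_in y p =
    (if p = 0 then 0 else Max ((\<lambda>m. Poly_Mapping.lookup m y) ` Poly_Mapping.keys p))"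

text \<open>\<open>coeff_in y i p\<close> is the coefficient of \<open>y\<^sup>i\<close> in \<open>p\<close>, viewed as a polynomial in \<open>y\<close>.\<close>

definition coeff_in :: "'x \<Rightarrow> nat \<Rightarrow> ('x, 'k::comm_ring_1) mpoly \<Rightarrow> ('x, 'k) mpoly"
  where "coeff_in y i p =
    (\<Sum>m | m \<in> Poly_Mapping.keys p \<and> Poly_Mapping.lookup m y = i.
       Poly_Mapping.single (m - Poly_Mapping.single y i) (Poly_Mapping.lookup p m))"

definition lead_coeff_in :: "'x \<Rightarrow> ('x, 'k::comm_ring_1) mpoly \<Rightarrow> ('x, 'k) mpoly"
  where "lead_coeff_in y p = coeff_in y (deg_in y p) p"

definition initial_in :: "'x \<Rightarrow> ('x, 'k::comm_ring_1) mpoly \<Rightarrow> ('x, 'k) mpoly"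
  where "initial_in y p = lead_coeff_in y p * Var y ^ deg_in y p"

definition compatible_order ::
    "'k::comm_ring_1 itself \<Rightarrow> 'x set \<Rightarrow> 'x \<Rightarrow> ('x monom \<times> 'x monom) set \<Rightarrow> bool"
  where "compatible_order _ A y r \<longleftrightarrow>
    (\<forall>p \<in> carrier (mpoly_ring A :: ('x, 'k) mpoly ring). initial r (initial_in y p) = initial r p)"

definition C_ideal :: "'x set \<Rightarrow> 'x \<Rightarrow> ('x, 'k::comm_ring_1) mpoly set \<Rightarrow> ('x, 'k) mpoly set"
  where "C_ideal A y Gs = genideal (mpoly_ring A) (lead_coeff_in y ` Gs)"

definition N_ideal :: "'x set \<Rightarrow> 'x \<Rightarrow> ('x, 'k::comm_ring_1) mpoly set \<Rightarrow> ('x, 'k) mpoly set"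
  where "N_ideal A y Gs =
    genideal (mpoly_ring A) (lead_coeff_in y ` {g \<in> Gs. deg_in y g = 0})"

definition geom_vertex_decomposition ::
    "'x set \<Rightarrow> 'x \<Rightarrow> ('x, 'k::comm_ring_1) mpoly set \<Rightarrow> ('x, 'k) mpoly set \<Rightarrow> bool"
  where "geom_vertex_decomposition A y I Gs \<longleftrightarrow>
    genideal (mpoly_ring A) (initial_in y ` I) =
      C_ideal A y Gs \<inter>
      (N_ideal A y Gs <+>\<^bsub>mpoly_ring A\<^esub> genideal (mpoly_ring A) {Var y})"

text \<open>The finite set of variables is a parameter, as it shrinks along the recursion; contracting
  an ideal to the smaller polynomial ring is intersecting with its carrier.\<close>

inductive gvd :: "'x set \<Rightarrow> ('x, 'k::comm_ring_1) mpoly set \<Rightarrow> bool"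
  where
    gvd_unit: "\<lbrakk>ideal I (mpoly_ring A); unmixed (mpoly_ring A) I;
       I = genideal (mpoly_ring A) {1}\<rbrakk> \<Longrightarrow> gvd A I"
  | gvd_vars: "\<lbrakk>ideal I (mpoly_ring A); unmixed (mpoly_ring A) I;
       Y \<subseteq> A; I = genideal (mpoly_ring A) (Var ` Y)\<rbrakk> \<Longrightarrow> gvd A I"
  | gvd_step: "\<lbrakk>ideal I (mpoly_ring A); unmixed (mpoly_ring A) I;
       y \<in> A; monomial_order A r; compatible_order TYPE('k) A y r;
       groebner_basis A r I Gs; geom_vertex_decomposition A y I Gs;
       gvd (A - {y}) (C_ideal A y Gs \<inter> carrier (mpoly_ring (A - {y})));
       gvd (A - {y}) (N_ideal A y Gs \<inter> carrier (mpoly_ring (A - {y})))\<rbrakk> \<Longrightarrow> gvd A I"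

section \<open>Hilbert series, a-invariant and multiplicity\<close>

definition homogeneous_part :: "'x set \<Rightarrow> nat \<Rightarrow> ('x, 'k::comm_ring_1) mpoly set"
  where "homogeneous_part A n =
    {p \<in> carrier (mpoly_ring A). \<forall>m\<in>Poly_Mapping.keys p.
       (\<Sum>x\<in>Poly_Mapping.keys m. Poly_Mapping.lookup m x) = n}"

text \<open>All invariants below are those of the standard graded algebra \<open>K[A]/I\<close>, for a homogeneous
  ideal \<open>I\<close>. The degree \<open>n\<close> component is the image of the forms of degree \<open>n\<close>; its dimension is
  taken over the image of the constants.\<close>

definition hilbert_fun :: "'x set \<Rightarrow> ('x, 'k::field) mpoly set \<Rightarrow> nat \<Rightarrow> nat"
  where "hilbert_fun A I n =
    (THE k. ring.dimension (mpoly_ring A Quot I) k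
       ((\<lambda>c. I +>\<^bsub>mpoly_ring A\<^esub> Const c) ` UNIV)
       ((\<lambda>p. I +>\<^bsub>mpoly_ring A\<^esub> p) ` homogeneous_part A n))"

definition hilbert_series :: "'x set \<Rightarrow> ('x, 'k::field) mpoly set \<Rightarrow> int fps"
  where "hilbert_series A I = Abs_fps (\<lambda>n. int (hilbert_fun A I n))"

definition quot_dim :: "'x set \<Rightarrow> ('x, 'k::field) mpoly set \<Rightarrow> nat"
  where "quot_dim A I = the_enat (krull_dim (mpoly_ring A Quot I))"

text \<open>The polynomial \<open>h\<close> with Hilbert series \<open>h(t)/(1-t)\<^sup>\<delta>\<close>, where \<open>\<delta>\<close> is the dimension.\<close>

definition h_poly :: "'x set \<Rightarrow> ('x, 'k::field) mpoly set \<Rightarrow> int poly"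
  where "h_poly A I =
    (THE h. fps_of_poly h = hilbert_series A I * (1 - fps_X) ^ quot_dim A I)"

definition a_invariant :: "'x set \<Rightarrow> ('x, 'k::field) mpoly set \<Rightarrow> int"
  where "a_invariant A I = int (Polynomial.degree (h_poly A I)) - int (quot_dim A I)"

definition hilbert_multiplicity :: "'x set \<Rightarrow> ('x, 'k::field) mpoly set \<Rightarrow> int"
  where "hilbert_multiplicity A I = poly (h_poly A I) 1"

end

theory Submission
  imports Defs
begin

text \<open>For an edge \<open>e = ab\<close> of \<open>G\<close>, gluing a cycle of length \<open>2d\<close> adds a path of edges
  \<open>p\<^sub>0, \<dots>, p\<^sub>2\<^sub>d\<^sub>-\<^sub>2\<close> from \<open>a\<close> to \<open>b\<close> and one new toric relation, of degree \<open>d\<close>: the product of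
  the \<open>p\<^sub>k\<close> with \<open>k\<close> even is \<open>e\<close> times the product of those with \<open>k\<close> odd. Rewriting with it until some
  \<open>p\<^sub>k\<close> with \<open>k\<close> even is absent gives normal forms, which show that the Hilbert series of \<open>H\<close> is that
  of \<open>G\<close> times \<open>(1 - t\<^sup>d) / (1 - t)\<^sup>2\<^sup>d\<^sup>-\<^sup>1\<close>. So the numerator is multiplied by
  \<open>1 + t + \<dots> + t\<^sup>d\<^sup>-\<^sup>1\<close>, provided the dimension grows by \<open>2d - 2\<close>.

  The dimension is found from a set \<open>B\<close> of edges whose monomials have distinct images. Modulo the
  toric ideal there is a chain of primes of length \<open>card B\<close>, given by maps to group algebras of ordered
  groups. If moreover \<open>(1 - t)\<^sup>r\<close> with \<open>r = card B\<close> clears the denominator of the Hilbert series, then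
  by counting any \<open>r + 1\<close> elements are algebraically dependent, and no chain is longer. For \<open>G\<close> such a
  \<open>B\<close> comes from a Stanley decomposition of the standard monomials, for \<open>H\<close> one adds all path edges
  but the last.\<close>

section \<open>Quotients by kernels of monomial maps\<close>

text \<open>The invariants refer to a dimension defined by chains of primes, while combinatorics
  only yields the Hilbert series. Since a toric ideal is the kernel of a map sending monomials to
  monomials, the Hilbert function counts the distinct images in each degree; the link to primes is a
  set \<open>B\<close> of largest size among those whose monomials have distinct images. Being
  independent, it yields a chain; being largest, it bounds the pole order, because the free
  directions of every block of standard monomials form such a set too. Rational exponents enter
  because distinct images amount to linear independence of exponent vectors, and the dual
  functionals need denominators; the group algebra remains a domain. Even length of the cycle
  matters because the path then has an odd number of edges: its first and last edge both stand at
  even positions, so the edge \<open>ab\<close> balances the alternating relation at both ends. The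
  degree of the numerator grows by \<open>d - 1\<close> and the dimension by
  \<open>2 * d - 2\<close>, which explains (1); the new factor has value \<open>d\<close> at 1,
  which explains (2).\<close>

abbreviation (input) lookup where "lookup \<equiv> Poly_Mapping.lookup"
abbreviation (input) keys where "keys \<equiv> Poly_Mapping.keys"

lemma mpoly_ring_simps [simp]:
  "monoid.mult (mpoly_ring A) = (*)" "monoid.one (mpoly_ring A) = 1"
  "ring.zero (mpoly_ring A) = 0" "ring.add (mpoly_ring A) = (+)"
  by (simp_all add: mpoly_ring_def)

lemma carrier_mpoly_ring: "p \<in> carrier (mpoly_ring A) \<longleftrightarrow> keys p \<subseteq> monoms A"
  by (simp add: mpoly_ring_def)

lemma carrier_mpoly_ring_closed:
  fixes p q :: "('x, 'k::comm_ring_1) mpoly"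
  shows "0 \<in> carrier (mpoly_ring A :: ('x, 'k) mpoly ring)"
    "1 \<in> carrier (mpoly_ring A :: ('x, 'k) mpoly ring)"
    "Const c \<in> carrier (mpoly_ring A :: ('x, 'k) mpoly ring)"
    "p \<in> carrier (mpoly_ring A) \<Longrightarrow> - p \<in> carrier (mpoly_ring A)"
    "p \<in> carrier (mpoly_ring A) \<Longrightarrow> q \<in> carrier (mpoly_ring A) \<Longrightarrow> p + q \<in> carrier (mpoly_ring A)"
    "p \<in> carrier (mpoly_ring A) \<Longrightarrow> q \<in> carrier (mpoly_ring A) \<Longrightarrow> p - q \<in> carrier (mpoly_ring A)"
    "p \<in> carrier (mpoly_ring A) \<Longrightarrow> q \<in> carrier (mpoly_ring A) \<Longrightarrow> p * q \<in> carrier (mpoly_ring A)"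
    "p \<in> carrier (mpoly_ring A) \<Longrightarrow> p ^ n \<in> carrier (mpoly_ring A)"
proof -
  interpret cring "mpoly_ring A :: ('x, 'k) mpoly ring"
    by (rule mpoly_ring_cring)
  show "0 \<in> carrier (mpoly_ring A :: ('x, 'k) mpoly ring)"
    using zero_closed by (simp only: mpoly_ring_simps)
  show one: "1 \<in> carrier (mpoly_ring A :: ('x, 'k) mpoly ring)"
    using one_closed by (simp only: mpoly_ring_simps)
  show "Const c \<in> carrier (mpoly_ring A :: ('x, 'k) mpoly ring)"
    by (auto simp: carrier_mpoly_ring Const_def monoms_def)
  show um: "q \<in> carrier (mpoly_ring A) \<Longrightarrow> - q \<in> carrier (mpoly_ring A)" for q :: "('x, 'k) mpoly"
    by (simp add: carrier_mpoly_ring)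
  show add: "p \<in> carrier (mpoly_ring A) \<Longrightarrow> q \<in> carrier (mpoly_ring A) \<Longrightarrow> p + q \<in> carrier (mpoly_ring A)"
    for q :: "('x, 'k) mpoly" using a_closed[of p q] by (simp only: mpoly_ring_simps)
  show "p \<in> carrier (mpoly_ring A) \<Longrightarrow> q \<in> carrier (mpoly_ring A) \<Longrightarrow> p - q \<in> carrier (mpoly_ring A)"
    using add[of "- q"] um by simp
  show mult: "p \<in> carrier (mpoly_ring A) \<Longrightarrow> q \<in> carrier (mpoly_ring A) \<Longrightarrow> p * q \<in> carrier (mpoly_ring A)"
    for q :: "('x, 'k) mpoly" using m_closed[of p q] by (simp only: mpoly_ring_simps)
  show "p \<in> carrier (mpoly_ring A) \<Longrightarrow> p ^ n \<in> carrier (mpoly_ring A)"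
    by (induction n) (auto intro: one mult)
qed

lemma carrier_mpoly_ring_sum:
  "(\<And>i. i \<in> M \<Longrightarrow> f i \<in> carrier (mpoly_ring A)) \<Longrightarrow> sum f M \<in> carrier (mpoly_ring A)"
  by (induction M rule: infinite_finite_induct) (auto intro: carrier_mpoly_ring_closed)

section \<open>Monoid homomorphisms and the monomial maps they induce\<close>

definition additive_weight :: "('m::comm_monoid_add \<Rightarrow> 'g::comm_monoid_add) \<Rightarrow> bool"
  where "additive_weight N \<longleftrightarrow> N 0 = 0 \<and> (\<forall>m n. N (m + n) = N m + N n)"

text \<open>The linear extension of \<open>N\<close> to monoid algebras. Only multiplicativity asks
  for \<open>additive_weight\<close>, so the same notion covers the choice of representatives of
  monomials. The target is general because it is instantiated with vertex monomials and with
  \<open>nat \<Rightarrow>\<^sub>0 rat\<close>.\<close>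

definition mono_map :: "('m \<Rightarrow> 'g) \<Rightarrow> ('m \<Rightarrow>\<^sub>0 'k::comm_ring_1) \<Rightarrow> ('g \<Rightarrow>\<^sub>0 'k)"
  where "mono_map N p = (\<Sum>m\<in>keys p. Poly_Mapping.single (N m) (lookup p m))"

lemma mono_map_superset:
  assumes "finite M" "keys p \<subseteq> M"
  shows "mono_map N p = (\<Sum>m\<in>M. Poly_Mapping.single (N m) (lookup p m))"
  unfolding mono_map_def
  by (rule sum.mono_neutral_left) (use assms in \<open>auto simp: in_keys_iff\<close>)

lemma mono_map_add: "mono_map N (p + q) = mono_map N p + mono_map N q"
proof -
  let ?M = "keys p \<union> keys q"
  have "keys (p + q) \<subseteq> ?M"
    by (rule Poly_Mapping.keys_add)
  then show ?thesis
    by (simp add: mono_map_superset[of ?M] lookup_add single_add sum.distrib)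
qed

lemma mono_map_zero [simp]: "mono_map N 0 = 0"
  by (simp add: mono_map_def)

lemma mono_map_uminus: "mono_map N (- p) = - mono_map N p"
  using mono_map_add[of N p "- p"] by (simp add: eq_neg_iff_add_eq_0 add.commute)

lemma mono_map_diff: "mono_map N (p - q) = mono_map N p - mono_map N q"
  using mono_map_add[of N p "- q"] by (simp add: mono_map_uminus)

lemma mono_map_sum: "mono_map N (sum f M) = (\<Sum>i\<in>M. mono_map N (f i))"
  by (induction M rule: infinite_finite_induct) (auto simp: mono_map_add)

lemma mono_map_single [simp]:
  "mono_map N (Poly_Mapping.single m c) = Poly_Mapping.single (N m) c"
  by (simp add: mono_map_superset[of "{m}"])

lemma mono_map_mult:
  assumes "additive_weight N"
  shows "mono_map N (p * q) = mono_map N p * mono_map N q"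
proof -
  let ?t = "\<lambda>p m. Poly_Mapping.single m (lookup p m)"
  have "mono_map N (sum (?t p) (keys p) * sum (?t q) (keys q)) =
      mono_map N (sum (?t p) (keys p)) * mono_map N (sum (?t q) (keys q))"
    using assms by (simp add: sum_product mono_map_sum mult_single additive_weight_def)
  then show ?thesis
    by (simp flip: mpoly_eq_sum_single)
qed

lemma mono_map_one: "additive_weight N \<Longrightarrow> mono_map N 1 = 1"
  using mono_map_single[of N 0 1] by (simp add: additive_weight_def)

lemma mono_map_Const_mult:
  assumes "additive_weight N"
  shows "mono_map N (Const c * p) = Poly_Mapping.single 0 c * mono_map N p"
  using assms by (simp add: mono_map_mult Const_def additive_weight_def)

lemma lookup_mono_map:
  "lookup (mono_map N p) g = (\<Sum>m | m \<in> keys p \<and> N m = g. lookup p m)"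
  by (auto simp: mono_map_def lookup_sum lookup_single when_def sum.If_cases Int_def)

text \<open>Injectivity leaves at most one monomial of \<open>p\<close> over each weight, so nothing
  can cancel.\<close>

lemma mono_map_inj_zero:
  assumes "inj_on N M" "keys p \<subseteq> M" "mono_map N p = 0"
  shows "p = 0"
proof (rule poly_mapping_eqI)
  fix m
  show "lookup p m = lookup 0 m"
  proof (cases "m \<in> keys p")
    case True
    then have "{n \<in> keys p. N n = N m} = {m}"
      using assms(1,2) by (auto simp: inj_on_def)
    then show ?thesis
      using lookup_mono_map[of N p "N m"] assms(3) by simp
  qed (simp add: in_keys_iff)
qed

definition kernel_ideal :: "'x set \<Rightarrow> ('x monom \<Rightarrow> 'g) \<Rightarrow> ('x, 'k::comm_ring_1) mpoly set"
  where "kernel_ideal A N = {p \<in> carrier (mpoly_ring A). mono_map N p = 0}"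

lemma ideal_kernel_ideal:
  fixes N :: "'x monom \<Rightarrow> 'g::comm_monoid_add"
  assumes "additive_weight N"
  shows "ideal (kernel_ideal A N :: ('x, 'k::comm_ring_1) mpoly set) (mpoly_ring A)"
proof -
  interpret cring "mpoly_ring A :: ('x, 'k) mpoly ring"
    by (rule mpoly_ring_cring)
  have "subgroup (kernel_ideal A N :: ('x, 'k) mpoly set) (add_monoid (mpoly_ring A))"
  proof (rule add.subgroupI)
    show "(kernel_ideal A N :: ('x, 'k) mpoly set) \<noteq> {}"
      by (auto simp: kernel_ideal_def intro!: exI[of _ 0] carrier_mpoly_ring_closed)
    fix a :: "('x, 'k) mpoly" assume a: "a \<in> kernel_ideal A N"
    then have "\<ominus>\<^bsub>mpoly_ring A\<^esub> a = - a"
      by (intro minus_equality) (auto simp: kernel_ideal_def carrier_mpoly_ring_closed)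
    then show "\<ominus>\<^bsub>mpoly_ring A\<^esub> a \<in> kernel_ideal A N"
      using a by (auto simp: kernel_ideal_def mono_map_uminus carrier_mpoly_ring_closed)
  qed (auto simp: kernel_ideal_def mono_map_add carrier_mpoly_ring_closed)
  then show ?thesis
    by (rule idealI[OF ring_axioms])
      (use assms in \<open>auto simp: kernel_ideal_def mono_map_mult carrier_mpoly_ring_closed\<close>)
qed

text \<open>The order on \<open>'g\<close> makes the monoid algebra a domain, since leading terms
  multiply to a leading term; the kernel of a homomorphism into a domain is prime.\<close>

lemma primeideal_kernel_ideal:
  fixes N :: "'x monom \<Rightarrow> 'g::{ordered_cancel_comm_monoid_add, linorder}"
  assumes "additive_weight N"
  shows "primeideal (kernel_ideal A N :: ('x, 'k::idom) mpoly set) (mpoly_ring A)"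
proof (rule primeidealI[OF ideal_kernel_ideal[OF assms] mpoly_ring_cring])
  have "1 \<notin> (kernel_ideal A N :: ('x, 'k) mpoly set)"
    using assms by (simp add: kernel_ideal_def mono_map_one)
  then show "carrier (mpoly_ring A) \<noteq> (kernel_ideal A N :: ('x, 'k) mpoly set)"
    using carrier_mpoly_ring_closed(2) by blast
qed (use assms in \<open>auto simp: kernel_ideal_def mono_map_mult\<close>)

lemma coset_eq_iff:
  fixes p q :: "('x, 'k::comm_ring_1) mpoly"
  assumes "ideal I (mpoly_ring A)" "p \<in> carrier (mpoly_ring A)" "q \<in> carrier (mpoly_ring A)"
  shows "I +>\<^bsub>mpoly_ring A\<^esub> p = I +>\<^bsub>mpoly_ring A\<^esub> q \<longleftrightarrow> p - q \<in> I"
proof -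
  interpret ideal I "mpoly_ring A" by fact
  have *: "p \<in> I +>\<^bsub>mpoly_ring A\<^esub> q \<longleftrightarrow> p - q \<in> I"
    unfolding a_r_coset_def' by (auto simp: algebra_simps intro: bexI[of _ "p - q"])
  show ?thesis
    unfolding *[symmetric]
    using a_repr_independence'[of p q] a_repr_independenceD[of p q] assms by auto
qed

text \<open>Needed for the uniqueness of \<open>ring.dimension\<close>, which is measured over a
  subfield; this makes the description in \<open>hilbert_fun\<close> definite.\<close>

lemma subfield_range_Const: "subfield (range Const) (mpoly_ring A :: ('x, 'k::field) mpoly ring)"
proof -
  interpret cring "mpoly_ring A :: ('x, 'k) mpoly ring"
    by (rule mpoly_ring_cring)
  have um: "\<ominus>\<^bsub>mpoly_ring A\<^esub> (Const c) = Const (- c)" for c :: 'k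
    by (rule minus_equality) (auto simp: carrier_mpoly_ring_closed, simp add: Const_def flip: single_add)
  have "subring (range Const) (mpoly_ring A :: ('x, 'k) mpoly ring)"
  proof (rule subringI)
    show "\<one>\<^bsub>mpoly_ring A\<^esub> \<in> range Const"
      by (auto simp: Const_def intro: image_eqI[of _ _ 1])
  qed (auto simp: carrier_mpoly_ring_closed um, auto simp: Const_def mult_single simp flip: single_add)
  then have sc: "subcring (range Const) (mpoly_ring A :: ('x, 'k) mpoly ring)"
    by (rule subcringI) (simp add: mult.commute)
  have inv: "Const c * Const (inverse c) = 1" if "c \<noteq> 0" for c :: 'k
    using that by (simp add: Const_def mult_single)
  have nz: "Const c = 0 \<longleftrightarrow> c = 0" for c :: 'k
    unfolding Const_def by (metis single_zero inj_single injD lookup_single_eq lookup_zero)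
  have "c \<noteq> 0" if "Const c * Const d = (1 :: ('x, 'k) mpoly)" for c d :: 'k
    using that nz[of 0] by (metis mult_zero_left zero_neq_one)
  moreover have "Const (inverse c) * Const c = 1" if "c \<noteq> 0" for c :: 'k
    using inv[OF that] by (simp only: mult.commute)
  ultimately have "Units (mpoly_ring A\<lparr>carrier := range Const\<rparr>) =
      range Const - {\<zero>\<^bsub>mpoly_ring A\<^esub> :: ('x, 'k) mpoly}"
    using inv by (fastforce simp: Units_def nz)
  then show ?thesis
    by (rule subfieldI[OF sc])
qed

section \<open>Total degree and the Hilbert function\<close>

definition mdeg :: "'x monom \<Rightarrow> nat"
  where "mdeg m = (\<Sum>x\<in>keys m. lookup m x)"

lemma mdeg_superset: "finite X \<Longrightarrow> keys m \<subseteq> X \<Longrightarrow> mdeg m = (\<Sum>x\<in>X. lookup m x)"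
  unfolding mdeg_def by (rule sum.mono_neutral_left) (auto simp: in_keys_iff)

lemma mdeg_zero [simp]: "mdeg 0 = 0"
  by (simp add: mdeg_def)

lemma mdeg_single [simp]: "mdeg (Poly_Mapping.single x n) = n"
  by (simp add: mdeg_superset[of "{x}"])

lemma mdeg_add: "mdeg (m + n) = mdeg m + mdeg n"
proof -
  have "keys (m + n) \<subseteq> keys m \<union> keys n"
    by (rule Poly_Mapping.keys_add)
  then show ?thesis
    by (simp add: mdeg_superset[of "keys m \<union> keys n"] lookup_add sum.distrib)
qed

lemma lookup_le_mdeg: "lookup m x \<le> mdeg m"
proof (cases "x \<in> keys m")
  case True
  then show ?thesis unfolding mdeg_def by (intro member_le_sum) auto
qed (simp add: in_keys_iff)

lemma finite_monoms_mdeg_le: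
  assumes "finite A"
  shows "finite {m \<in> monoms A. mdeg m \<le> n}"
proof -
  have 1: "inj_on lookup {m \<in> monoms A. mdeg m \<le> n}"
    by (rule inj_onI) (simp only: lookup_inject)
  have 2: "lookup ` {m \<in> monoms A. mdeg m \<le> n} \<subseteq>
      {f. \<forall>x. (x \<in> A \<longrightarrow> f x \<in> {..n}) \<and> (x \<notin> A \<longrightarrow> f x = 0)}" (is "_ \<subseteq> ?F")
  proof clarify
    fix m x assume "m \<in> monoms A" "mdeg m \<le> n"
    then show "(x \<in> A \<longrightarrow> lookup m x \<in> {..n}) \<and> (x \<notin> A \<longrightarrow> lookup m x = 0)"
      using lookup_le_mdeg[of m x] by (auto simp: monoms_def in_keys_iff)
  qed
  have "finite ?F"
    by (rule finite_set_of_finite_funs[OF assms]) simp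
  then show ?thesis
    using finite_imageD[OF finite_subset[OF 2] 1] by blast
qed

lemma finite_monoms_mdeg: "finite A \<Longrightarrow> finite {m \<in> monoms A. mdeg m = n}"
  by (rule finite_subset[OF _ finite_monoms_mdeg_le[of A n]]) auto

lemma homogeneous_part_eq:
  "homogeneous_part A n = {p. keys p \<subseteq> {m \<in> monoms A. mdeg m = n}}"
  by (auto simp: homogeneous_part_def carrier_mpoly_ring mdeg_def)

text \<open>A combination of monomials with distinct weights that lies in the kernel is zero, by
  \<open>mono_map_inj_zero\<close>. So each new monomial enlarges the span by one line, which is the
  rule by which \<open>dimension\<close> grows.\<close>

lemma dimension_kernel_ideal_image:
  fixes N :: "'x monom \<Rightarrow> 'g::comm_monoid_add"
  assumes N: "additive_weight N" and T: "finite T" "T \<subseteq> monoms A" "inj_on N T"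
  defines "I \<equiv> kernel_ideal A N :: ('x, 'k::field) mpoly set"
  shows "ring.dimension (mpoly_ring A Quot I) (card T)
    ((\<lambda>c. I +>\<^bsub>mpoly_ring A\<^esub> Const c) ` UNIV)
    ((\<lambda>p. I +>\<^bsub>mpoly_ring A\<^esub> p) ` {p. keys p \<subseteq> T})"
proof -
  have idl: "ideal I (mpoly_ring A)"
    unfolding I_def by (rule ideal_kernel_ideal[OF N])
  interpret I: ideal I "mpoly_ring A" by fact
  interpret Q: ring "mpoly_ring A Quot I" by (rule I.quotient_is_ring)
  interpret H: ring_hom_ring "mpoly_ring A" "mpoly_ring A Quot I" "(+>\<^bsub>mpoly_ring A\<^esub>) I"
    by (rule I.rcos_ring_hom_ring)
  let ?K = "(\<lambda>c. I +>\<^bsub>mpoly_ring A\<^esub> Const c) ` UNIV"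
  let ?h = "\<lambda>p. I +>\<^bsub>mpoly_ring A\<^esub> p"
  show ?thesis
    using T
  proof (induction T rule: finite_induct)
    case empty
    have "?h ` {p. keys p \<subseteq> {}} = {\<zero>\<^bsub>mpoly_ring A Quot I\<^esub>}"
      using H.hom_zero by simp
    then show ?case
      using Q.zero_dim by (simp only: card.empty)
  next
    case (insert m T)
    let ?v = "Poly_Mapping.single m 1 :: ('x, 'k) mpoly"
    have v: "?v \<in> carrier (mpoly_ring A)"
      using insert.prems by (simp add: carrier_mpoly_ring)
    have "?h ?v \<notin> ?h ` {p. keys p \<subseteq> T}"
    proof
      assume "?h ?v \<in> ?h ` {p. keys p \<subseteq> T}"
      then obtain p where p: "keys p \<subseteq> T" and eq: "?h ?v = ?h p" by auto
      then have "p \<in> carrier (mpoly_ring A)"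
        using insert.prems by (auto simp: carrier_mpoly_ring)
      then have "?v - p \<in> I"
        using eq coset_eq_iff[OF idl v, of p] by blast
      then have "mono_map N (?v - p) = 0"
        unfolding I_def kernel_ideal_def by blast
      moreover have "keys (?v - p) \<subseteq> insert m T"
        using p by (auto simp: in_keys_iff lookup_minus lookup_single when_def split: if_splits)
      ultimately have "?v = p"
        using mono_map_inj_zero[OF insert.prems(2), of "?v - p"] by simp
      then show False
        using p insert.hyps by auto
    qed
    moreover have "Q.dimension (card T) ?K (?h ` {p. keys p \<subseteq> T})"
      using insert by auto
    ultimately have "Q.dimension (Suc (card T)) ?K (Q.line_extension ?K (?h ?v) (?h ` {p. keys p \<subseteq> T}))"
      using v H.hom_closed by (intro Q.Suc_dim) auto
    moreover have "Q.line_extension ?K (?h ?v) (?h ` {p. keys p \<subseteq> T}) = ?h ` {p. keys p \<subseteq> insert m T}"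
    proof -
      have T: "keys p \<subseteq> T \<Longrightarrow> p \<in> carrier (mpoly_ring A)" for p :: "('x, 'k) mpoly"
        using insert.prems by (auto simp: carrier_mpoly_ring)
      have h: "?h (Const c) \<otimes>\<^bsub>mpoly_ring A Quot I\<^esub> ?h ?v \<oplus>\<^bsub>mpoly_ring A Quot I\<^esub> ?h p
          = ?h (Poly_Mapping.single m c + p)" if "keys p \<subseteq> T" for c p
      proof -
        have "Const c * ?v = Poly_Mapping.single m c"
          by (simp add: Const_def mult_single)
        then show ?thesis
          using v T[OF that] carrier_mpoly_ring_closed(3)[of c A]
            carrier_mpoly_ring_closed(7)[of "Const c" A ?v] H.hom_mult[of "Const c" ?v] H.hom_add[of "Const c * ?v" p]
          by simp
      qed
      have "Q.line_extension ?K (?h ?v) (?h ` {p. keys p \<subseteq> T}) =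
         ?h ` {Poly_Mapping.single m c + p | c p. keys p \<subseteq> T}"
        (is "?L = ?R")
      proof
        show "?L \<subseteq> ?R"
          unfolding Q.line_extension_def set_add_def' r_coset_def
          using h by (auto intro!: imageI)
        show "?R \<subseteq> ?L"
          unfolding Q.line_extension_def set_add_def' r_coset_def
          by (auto simp flip: h) blast
      qed
      also have "{Poly_Mapping.single m c + p | c p. keys p \<subseteq> T} = {p :: ('x, 'k) mpoly. keys p \<subseteq> insert m T}"
      proof (intro equalityI subsetI)
        fix q :: "('x, 'k) mpoly" assume "q \<in> {Poly_Mapping.single m c + p | c p. keys p \<subseteq> T}"
        then obtain c p where "q = Poly_Mapping.single m c + p" "keys p \<subseteq> T"
          by auto
        then show "q \<in> {p. keys p \<subseteq> insert m T}"
          using Poly_Mapping.keys_add[of "Poly_Mapping.single m c" p] by (auto split: if_splits)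
      next
        fix p :: "('x, 'k) mpoly" assume p: "p \<in> {p. keys p \<subseteq> insert m T}"
        define q where "q = p - Poly_Mapping.single m (lookup p m)"
        have "keys q \<subseteq> T"
          using p by (auto simp: q_def in_keys_iff lookup_minus lookup_single when_def split: if_splits)
        moreover have "p = Poly_Mapping.single m (lookup p m) + q"
          by (simp add: q_def)
        ultimately show "p \<in> {Poly_Mapping.single m c + p | c p. keys p \<subseteq> T}"
          by blast
      qed
      finally show ?thesis .
    qed
    ultimately show ?case
      using insert.hyps by simp
  qed
qed

text \<open>Monomials of equal weight have the same class and monomials of different weights are
  independent, so only the number of weights matters.\<close>

lemma hilbert_fun_kernel_ideal:
  fixes N :: "'x monom \<Rightarrow> 'g::comm_monoid_add"
  assumes N: "additive_weight N" and "finite A"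
  shows "hilbert_fun A (kernel_ideal A N :: ('x, 'k::field) mpoly set) n =
    card (N ` {m \<in> monoms A. mdeg m = n})"
proof -
  define M where "M = {m \<in> monoms A. mdeg m = n}"
  define I where "I = (kernel_ideal A N :: ('x, 'k) mpoly set)"
  have idl: "ideal I (mpoly_ring A)"
    unfolding I_def by (rule ideal_kernel_ideal[OF N])
  interpret I: ideal I "mpoly_ring A" by fact
  interpret Q: ring "mpoly_ring A Quot I" by (rule I.quotient_is_ring)
  interpret H: ring_hom_ring "mpoly_ring A" "mpoly_ring A Quot I" "(+>\<^bsub>mpoly_ring A\<^esub>) I"
    by (rule I.rcos_ring_hom_ring)
  let ?K = "(\<lambda>c. I +>\<^bsub>mpoly_ring A\<^esub> Const c) ` UNIV"
  let ?h = "\<lambda>p. I +>\<^bsub>mpoly_ring A\<^esub> p"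
  \<comment> \<open>\<open>T\<close> is a transversal: one monomial from each fibre of
    \<open>N\<close> in degree \<open>n\<close>.\<close>
  obtain T where T: "T \<subseteq> M" "inj_on N T" "N ` M = N ` T"
    using subset_image_inj[of "N ` M" N M] by auto
  have MA: "M \<subseteq> monoms A" by (auto simp: M_def)
  have hM: "homogeneous_part A n = {p :: ('x, 'k) mpoly. keys p \<subseteq> M}"
    unfolding M_def by (rule homogeneous_part_eq)
  have fM: "finite M" unfolding M_def by (rule finite_monoms_mdeg[OF \<open>finite A\<close>])
  have fT: "finite T" using T(1) fM finite_subset by blast
  have "?h ` homogeneous_part A n = ?h ` {p. keys p \<subseteq> T}"
  proof (intro equalityI subsetI)
    fix z assume "z \<in> ?h ` homogeneous_part A n"
    then obtain p :: "('x, 'k) mpoly" where p: "keys p \<subseteq> M" "z = ?h p"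
      unfolding hM by blast
    have "\<exists>t. t \<in> T \<and> N t = N m" if "m \<in> M" for m
    proof -
      have "N m \<in> N ` T"
        using that unfolding T(3)[symmetric] by (rule imageI)
      then show ?thesis by fastforce
    qed
    then obtain t where t: "\<And>m. m \<in> M \<Longrightarrow> t m \<in> T \<and> N (t m) = N m"
      by metis
    \<comment> \<open>Replacing every monomial by its representative keeps the weights, hence the
      class modulo \<open>I\<close>.\<close>
    define q where "q = mono_map t p"
    have q: "keys q \<subseteq> T"
      unfolding q_def mono_map_def using p t
      by (intro order_trans[OF keys_sum] UN_least) (auto split: if_splits)
    have "mono_map N q = mono_map N p"
      unfolding q_def mono_map_def[of t] mono_map_sum unfolding mono_map_def[of N]
      using p t by (intro sum.cong) auto
    moreover have carr: "p \<in> carrier (mpoly_ring A)" "q \<in> carrier (mpoly_ring A)"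
      using p(1) q T(1) MA by (auto simp only: carrier_mpoly_ring)
    ultimately have "p - q \<in> I"
      unfolding I_def kernel_ideal_def using carrier_mpoly_ring_closed(6)[of p A q]
      by (simp add: mono_map_diff)
    then have "?h p = ?h q"
      using coset_eq_iff[OF idl, of p q] carr by blast
    then show "z \<in> ?h ` {p. keys p \<subseteq> T}" using p q by blast
  next
    fix z assume "z \<in> ?h ` {p. keys p \<subseteq> T}"
    then show "z \<in> ?h ` homogeneous_part A n"
      unfolding hM using T(1) by blast
  qed
  then have dim: "Q.dimension (card T) ?K (?h ` homogeneous_part A n)"
    using dimension_kernel_ideal_image[OF N fT order_trans[OF T(1) MA] T(2), where 'k = 'k]
    unfolding I_def by simp
  \<comment> \<open>The quotient is not the zero ring, so the constants embed as a subfield and the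
    dimension over them is unique; this settles the \<open>THE\<close> in
    \<open>hilbert_fun\<close>.\<close>
  have "1 \<notin> I"
    unfolding I_def kernel_ideal_def using N by (simp add: mono_map_one)
  then have "\<one>\<^bsub>mpoly_ring A Quot I\<^esub> \<noteq> \<zero>\<^bsub>mpoly_ring A Quot I\<^esub>"
    using coset_eq_iff[OF idl, of 1 0] H.hom_zero H.hom_one by (simp add: carrier_mpoly_ring_closed)
  then have "subfield (?h ` range Const) (mpoly_ring A Quot I)"
    by (rule H.img_is_subfield(2)[OF subfield_range_Const])
  then have "subfield ?K (mpoly_ring A Quot I)"
    by (simp add: image_image)
  then have "hilbert_fun A I n = card T"
    unfolding hilbert_fun_def
    using dim Q.dimension_is_inj by (intro the_equality) auto
  then show ?thesis
    unfolding I_def using T by (simp add: card_image M_def)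
qed

section \<open>Stanley decompositions and Hilbert series\<close>

lemma zero_in_monoms [simp]: "0 \<in> monoms A"
  by (simp add: monoms_def)

lemma single_in_monoms: "x \<in> A \<Longrightarrow> Poly_Mapping.single x n \<in> monoms A"
  by (simp add: monoms_def)

lemma monoms_mono: "A \<subseteq> B \<Longrightarrow> monoms A \<subseteq> monoms B"
  by (auto simp: monoms_def)

lemma monoms_addD: "m + n \<in> monoms A \<Longrightarrow> m \<in> monoms A" "m + n \<in> monoms A \<Longrightarrow> n \<in> monoms A"
  for m n :: "'x monom"
  by (auto simp: monoms_def subset_iff in_keys_iff lookup_add)

lemma monoms_empty [simp]: "monoms {} = {0}"
  by (auto simp: monoms_def)

text \<open>The witness is \<open>m\<close> with \<open>x\<close> deleted, so the difference in the
  statement is just the exponent of \<open>x\<close> in \<open>m\<close>.\<close>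

lemma monoms_insert_cases:
  assumes "m \<in> monoms (insert x A)"
  obtains n where "n \<in> monoms A" "lookup n x = 0 \<or> x \<in> A" "m = Poly_Mapping.single x (lookup m x - lookup n x) + n" "lookup m x \<ge> lookup n x"
proof
  let ?n = "m - Poly_Mapping.single x (lookup m x)"
  show "?n \<in> monoms A"
    using assms by (auto simp: monoms_def subset_iff in_keys_iff lookup_minus lookup_single when_def split: if_splits)
  show "lookup ?n x = 0 \<or> x \<in> A"
    by (simp add: lookup_minus)
  show "m = Poly_Mapping.single x (lookup m x - lookup ?n x) + ?n"
    by (rule poly_mapping_eqI) (simp add: lookup_add lookup_minus lookup_single when_def)
qed (simp add: lookup_minus)

definition count_series :: "'x monom set \<Rightarrow> int fps"
  where "count_series D = Abs_fps (\<lambda>n. int (card {m \<in> D. mdeg m = n}))"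

lemma finite_mdeg_subset: "finite A \<Longrightarrow> D \<subseteq> monoms A \<Longrightarrow> finite {m \<in> D. mdeg m = n}"
  by (rule finite_subset[OF _ finite_monoms_mdeg[of A n]]) auto

lemma count_series_Un:
  assumes "finite A" "D \<subseteq> monoms A" "D' \<subseteq> monoms A" "D \<inter> D' = {}"
  shows "count_series (D \<union> D') = count_series D + count_series D'"
proof (rule fps_ext)
  fix n
  have "{m \<in> D \<union> D'. mdeg m = n} = {m \<in> D. mdeg m = n} \<union> {m \<in> D'. mdeg m = n}"
    by auto
  moreover have "{m \<in> D. mdeg m = n} \<inter> {m \<in> D'. mdeg m = n} = {}"
    using assms(4) by auto
  ultimately show "fps_nth (count_series (D \<union> D')) n = fps_nth (count_series D + count_series D') n"
    using finite_mdeg_subset[OF assms(1,2)] finite_mdeg_subset[OF assms(1,3)]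
    by (simp add: count_series_def card_Un_disjoint)
qed

lemma count_series_shift: "count_series ((+) u ` D) = fps_X ^ mdeg u * count_series D"
proof (rule fps_ext)
  fix n
  show "fps_nth (count_series ((+) u ` D)) n = fps_nth (fps_X ^ mdeg u * count_series D) n"
  proof (cases "n < mdeg u")
    case True
    then have "{m \<in> (+) u ` D. mdeg m = n} = {}"
      by (auto simp: mdeg_add)
    with True show ?thesis
      by (simp only: count_series_def fps_nth_Abs_fps fps_X_power_mult_nth) simp
  next
    case False
    then have "{m \<in> (+) u ` D. mdeg m = n} = (+) u ` {m \<in> D. mdeg m = n - mdeg u}"
      by (auto simp: mdeg_add)
    moreover have "card ((+) u ` {m \<in> D. mdeg m = n - mdeg u}) = card {m \<in> D. mdeg m = n - mdeg u}"
      by (intro card_image) (auto simp: inj_on_def)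
    ultimately show ?thesis
      using False by (simp add: count_series_def fps_X_power_mult_nth)
  qed
qed

text \<open>A monomial either avoids \<open>x\<close> or is \<open>x\<close> times another one,
  which gives the recursion. The product form avoids inverting power series.\<close>

lemma count_series_monoms:
  "finite B \<Longrightarrow> count_series (monoms B) * (1 - fps_X) ^ card B = 1"
proof (induction B rule: finite_induct)
  case empty
  have "{m \<in> {0 :: 'a monom}. mdeg m = n} = (if n = 0 then {0} else {})" for n
    by auto
  then show ?case
    by (intro fps_ext) (simp add: count_series_def)
next
  case (insert x B)
  let ?s = "Poly_Mapping.single x 1 :: 'a monom"
  have "monoms (insert x B) = monoms B \<union> (+) ?s ` monoms (insert x B)"
  proof (intro equalityI subsetI)
    fix m assume m: "m \<in> monoms (insert x B)"
    show "m \<in> monoms B \<union> (+) ?s ` monoms (insert x B)"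
    proof (cases "lookup m x = 0")
      case True
      with m show ?thesis by (auto simp: monoms_def in_keys_iff)
    next
      case False
      then have "m = ?s + (m - ?s)"
        by (intro poly_mapping_eqI) (auto simp: lookup_add lookup_minus lookup_single when_def)
      with m show ?thesis
        by (metis UnI2 imageI monoms_addD(2))
    qed
  next
    fix m assume "m \<in> monoms B \<union> (+) ?s ` monoms (insert x B)"
    then show "m \<in> monoms (insert x B)"
      using monoms_mono[of B "insert x B"]
      by (auto intro: monoms_add single_in_monoms)
  qed
  moreover have "monoms B \<inter> (+) ?s ` monoms (insert x B) = {}"
    using insert.hyps(2) by (auto simp: monoms_def in_keys_iff lookup_add lookup_single subset_iff)
  moreover have "(+) ?s ` monoms (insert x B) \<subseteq> monoms (insert x B)"
    by (auto intro: monoms_add single_in_monoms)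
  ultimately have "count_series (monoms (insert x B)) =
      count_series (monoms B) + count_series ((+) ?s ` monoms (insert x B))"
    using insert.hyps(1) monoms_mono[of B "insert x B"]
    by (metis count_series_Un finite.insertI subset_insertI)
  also have "count_series ((+) ?s ` monoms (insert x B)) = fps_X * count_series (monoms (insert x B))"
    by (simp only: count_series_shift mdeg_single power_one_right)
  finally have "count_series (monoms (insert x B)) * (1 - fps_X) = count_series (monoms B)"
    by (simp add: algebra_simps)
  then show ?case
    using insert by (simp add: mult.assoc[symmetric])
qed

text \<open>Stanley decompositions into blocks \<open>u + monoms B\<close>. Blocks are added one at
  a time, disjointly, so that counting series add; which blocks were used is not recorded.\<close>

inductive stanley :: "'x set \<Rightarrow> 'x monom set \<Rightarrow> bool" for A
  where
    stanley_empty: "stanley A {}"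
  | stanley_Un: "\<lbrakk>stanley A D; B \<subseteq> A; u \<in> monoms A; D \<inter> (+) u ` monoms B = {}\<rbrakk> \<Longrightarrow>
      stanley A (D \<union> (+) u ` monoms B)"

lemma stanley_subset: "stanley A D \<Longrightarrow> D \<subseteq> monoms A"
proof (induction rule: stanley.induct)
  case (stanley_Un D B u)
  then show ?case
    using monoms_mono[of B A] by (auto intro!: monoms_add)
qed simp

text \<open>A block contributes a power of t over \<open>card B\<close> factors 1 - t. The bound on
  \<open>card B\<close> is required for every translate inside \<open>D\<close>, since
  \<open>stanley\<close> does not record the blocks.\<close>

lemma count_series_stanley:
  assumes "stanley A D" "finite A"
    and "\<And>u B. B \<subseteq> A \<Longrightarrow> (+) u ` monoms B \<subseteq> D \<Longrightarrow> card B \<le> r"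
  shows "\<exists>h. fps_of_poly h = count_series D * (1 - fps_X) ^ r"
  using assms
proof (induction rule: stanley.induct)
  case stanley_empty
  show ?case
    by (intro exI[of _ 0]) (simp add: count_series_def fps_zero_def)
next
  case (stanley_Un D B u)
  have "card B' \<le> r" if "B' \<subseteq> A" "(+) v ` monoms B' \<subseteq> D" for v B'
    by (rule stanley_Un.prems(2)[OF that(1) le_supI1[OF that(2)]])
  then have "\<exists>h. fps_of_poly h = count_series D * (1 - fps_X) ^ r"
    using \<open>finite A\<close> by (intro stanley_Un.IH)
  then obtain h where h: "fps_of_poly h = count_series D * (1 - fps_X) ^ r" ..
  have le: "card B \<le> r"
    by (rule stanley_Un.prems(2)[OF \<open>B \<subseteq> A\<close>, of u]) simp
  have fB: "finite B"
    using stanley_Un.hyps(2) \<open>finite A\<close> by (rule finite_subset)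
  have "count_series (monoms B) * (1 - fps_X) ^ r =
      count_series (monoms B) * (1 - fps_X) ^ card B * (1 - fps_X) ^ (r - card B)"
    using le by (simp add: mult.assoc flip: power_add)
  also have "\<dots> = (1 - fps_X) ^ (r - card B)"
    using count_series_monoms[OF fB] by simp
  finally have B: "count_series (monoms B) * (1 - fps_X) ^ r = (1 - fps_X) ^ (r - card B)" .
  have "D \<subseteq> monoms A" using stanley_Un.hyps(1) by (rule stanley_subset)
  moreover have "(+) u ` monoms B \<subseteq> monoms A"
    using stanley_Un.hyps(2,3) monoms_mono[of B A] by (auto intro!: monoms_add)
  ultimately have "count_series (D \<union> (+) u ` monoms B) * (1 - fps_X) ^ r =
      fps_of_poly h + fps_X ^ mdeg u * (1 - fps_X) ^ (r - card B)"
    using count_series_Un[OF \<open>finite A\<close>, of D "(+) u ` monoms B"] stanley_Un.hyps(4) B h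
    by (simp add: count_series_shift distrib_right mult.assoc)
  also have "\<dots> = fps_of_poly (h + monom 1 (mdeg u) * (1 - monom 1 1) ^ (r - card B))"
    by (simp add: fps_of_poly_simps fps_of_poly_monom fps_of_poly_power fps_of_poly_mult fps_of_poly_diff fps_of_poly_add)
  finally show ?case by metis
qed

lemma stanley_mono: "stanley A D \<Longrightarrow> A \<subseteq> A' \<Longrightarrow> stanley A' D"
proof (induction rule: stanley.induct)
  case (stanley_Un D B u)
  then show ?case
    using monoms_mono[of A A'] by (intro stanley.stanley_Un) auto
qed (simp add: stanley_empty)

lemma stanley_disjoint_Un:
  assumes "stanley A D'" "stanley A D" "D \<inter> D' = {}"
  shows "stanley A (D \<union> D')"
  using assms
proof (induction rule: stanley.induct)
  case (stanley_Un D' B u)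
  then have "stanley A ((D \<union> D') \<union> (+) u ` monoms B)"
    by (intro stanley.stanley_Un) auto
  then show ?case by (simp only: Un_assoc)
qed simp

lemma stanley_shift:
  assumes "stanley A D" "v \<in> monoms A"
  shows "stanley A ((+) v ` D)"
  using assms
proof (induction rule: stanley.induct)
  case (stanley_Un D B u)
  have *: "(+) v ` (+) u ` monoms B = (+) (v + u) ` monoms B"
    by (simp add: image_image add.assoc)
  have "stanley A ((+) v ` D \<union> (+) (v + u) ` monoms B)"
  proof (rule stanley.stanley_Un)
    show "(+) v ` D \<inter> (+) (v + u) ` monoms B = {}"
      using stanley_Un.hyps(4) by (auto simp: add.assoc)
  qed (use stanley_Un in \<open>auto intro: monoms_add\<close>)
  then show ?case by (simp only: image_Un *)
qed (simp add: stanley.stanley_empty)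

text \<open>Allowing all powers of \<open>x\<close> turns a block over \<open>B\<close> into one
  over \<open>insert x B\<close>. No monomial of \<open>D\<close> contains \<open>x\<close>, so that
  power can be read off and disjointness survives.\<close>

lemma stanley_cylinder:
  assumes "stanley A D" "x \<notin> A"
  shows "stanley (insert x A) {Poly_Mapping.single x i + m | i m. m \<in> D}"
  using assms
proof (induction rule: stanley.induct)
  case (stanley_Un D B u)
  let ?c = "\<lambda>D. {Poly_Mapping.single x i + m | i m. m \<in> D}"
  have xu: "lookup u x = 0"
    using stanley_Un by (auto simp: monoms_def in_keys_iff)
  have B: "?c ((+) u ` monoms B) = (+) u ` monoms (insert x B)"
  proof (intro equalityI subsetI)
    fix m assume "m \<in> ?c ((+) u ` monoms B)"
    then obtain i n where "m = Poly_Mapping.single x i + (u + n)" and nB: "n \<in> monoms B"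
      by blast
    then have n: "m = u + (Poly_Mapping.single x i + n)"
      by (simp only: add.left_commute)
    then have "Poly_Mapping.single x i + n \<in> monoms (insert x B)"
      using nB monoms_mono[of B "insert x B"] by (auto intro!: monoms_add single_in_monoms)
    then show "m \<in> (+) u ` monoms (insert x B)"
      using n by blast
  next
    fix m assume "m \<in> (+) u ` monoms (insert x B)"
    then obtain n where n: "m = u + n" "n \<in> monoms (insert x B)" by auto
    obtain k where "k \<in> monoms B" "n = Poly_Mapping.single x (lookup n x - lookup k x) + k"
      by (rule monoms_insert_cases[OF n(2)])
    then have "m = Poly_Mapping.single x (lookup n x - lookup k x) + (u + k)" "k \<in> monoms B"
      using n by (metis add.left_commute)+
    then show "m \<in> ?c ((+) u ` monoms B)" by blast
  qed
  have "?c D \<inter> ?c ((+) u ` monoms B) = {}"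
  proof (rule ccontr)
    assume "?c D \<inter> ?c ((+) u ` monoms B) \<noteq> {}"
    then obtain z where z: "z \<in> ?c D" "z \<in> ?c ((+) u ` monoms B)" by blast
    from z(1) obtain i m where m: "z = Poly_Mapping.single x i + m" "m \<in> D" by blast
    from z(2) obtain j n where n: "z = Poly_Mapping.single x j + n" "n \<in> (+) u ` monoms B" by blast
    have eq: "Poly_Mapping.single x i + m = Poly_Mapping.single x j + n"
      using m(1) n(1) by simp
    have "m \<in> monoms A"
      using m(2) stanley_Un.hyps(1) stanley_subset by blast
    moreover have "n \<in> monoms A"
      using n(2) stanley_Un.hyps(2,3) monoms_mono[of B A] by (auto intro!: monoms_add)
    ultimately have "lookup m x = 0" "lookup n x = 0"
      using stanley_Un.prems by (auto simp: monoms_def in_keys_iff)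
    then have "i = j"
      using arg_cong[OF eq, of "\<lambda>p. lookup p x"] by (simp add: lookup_add)
    then have "m = n" using eq by simp
    then show False using m(2) n(2) stanley_Un.hyps(4) by blast
  qed
  then have "stanley (insert x A) (?c D \<union> (+) u ` monoms (insert x B))"
    using stanley_Un monoms_mono[of A "insert x A"] unfolding B
    by (intro stanley.stanley_Un) auto
  moreover have "?c (D \<union> (+) u ` monoms B) = ?c D \<union> ?c ((+) u ` monoms B)"
    by blast
  ultimately show ?case by (simp only: B)
qed (simp add: stanley.stanley_empty)

section \<open>Dickson's lemma and down sets of monomials\<close>

lemma nat_seq_mono_subseq:
  fixes s :: "nat \<Rightarrow> nat"
  shows "\<exists>g :: nat \<Rightarrow> nat. strict_mono g \<and> mono (s \<circ> g)"
proof -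
  obtain g where g: "strict_mono g" "monoseq (\<lambda>n. s (g n))"
    using seq_monosub[of s] by blast
  show ?thesis
  proof (cases "incseq (\<lambda>n. s (g n))")
    case True
    then show ?thesis using g by (auto simp: o_def)
  next
    case False
    then have dec: "decseq (\<lambda>n. s (g n))"
      using g(2) by (simp add: monoseq_iff)
    \<comment> \<open>A decreasing sequence of naturals is constant from the place where its minimum
      is attained.\<close>
    define k where "k = arg_min (\<lambda>n. s (g n)) (\<lambda>_. True)"
    have k: "s (g k) \<le> s (g n)" for n
      unfolding k_def by (rule arg_min_nat_le) simp
    have "s (g (k + n)) = s (g k)" for n
      using k[of "k + n"] decseqD[OF dec, of k "k + n"] by simp
    then have "mono (s \<circ> (\<lambda>n. g (k + n)))"
      by (simp add: mono_def)
    moreover have "strict_mono (\<lambda>n. g (k + n))"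
      using g(1) by (simp add: strict_mono_def)
    ultimately show ?thesis by blast
  qed
qed

text \<open>Dickson's lemma in sequence form: pass to a monotone subsequence for one variable after
  another.\<close>

lemma dickson_subseq:
  fixes f :: "nat \<Rightarrow> 'x \<Rightarrow> nat"
  assumes "finite A"
  shows "\<exists>g :: nat \<Rightarrow> nat. strict_mono g \<and> (\<forall>x\<in>A. mono (\<lambda>n. f (g n) x))"
  using assms
proof (induction A rule: finite_induct)
  case empty
  show ?case by (intro exI[of _ id]) (simp add: strict_mono_def)
next
  case (insert x A)
  then obtain g :: "nat \<Rightarrow> nat" where g: "strict_mono g" "\<forall>x\<in>A. mono (\<lambda>n. f (g n) x)" by blast
  obtain k :: "nat \<Rightarrow> nat" where k: "strict_mono k" "mono ((\<lambda>n. f (g n) x) \<circ> k)"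
    using nat_seq_mono_subseq by blast
  have "strict_mono (\<lambda>n. g (k n))"
    using g(1) k(1) by (simp add: strict_mono_def)
  moreover have "\<forall>z\<in>insert x A. mono (\<lambda>n. f (g (k n)) z)"
    using g(2) k by (auto simp: mono_def strict_mono_less_eq)
  ultimately show ?case by blast
qed

text \<open>The complements of monomial ideals.\<close>

definition down_set :: "'x monom set \<Rightarrow> bool"
  where "down_set D \<longleftrightarrow> (\<forall>m n. m + n \<in> D \<longrightarrow> m \<in> D)"

text \<open>The ascending chain condition for monomial ideals, seen on complements. Otherwise each
  \<open>D k\<close> has an element \<open>f k\<close> that is gone at a later stage
  \<open>J k\<close>; Dickson's lemma finds \<open>f a\<close> dividing some \<open>f b\<close> with
  \<open>b \<ge> J a\<close>, so \<open>f a\<close> would still lie in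
  \<open>D (J a)\<close>.\<close>

lemma down_sets_stabilize:
  fixes D :: "nat \<Rightarrow> 'x monom set"
  assumes "finite A" "\<And>j. D j \<subseteq> monoms A" "\<And>j. down_set (D j)" "\<And>j. D (Suc j) \<subseteq> D j"
  shows "\<exists>k. \<forall>j\<ge>k. D j = D k"
proof (rule ccontr)
  assume not: "\<not> ?thesis"
  have anti: "D j \<subseteq> D i" if "i \<le> j" for i j
    using lift_Suc_antimono_le[of D] assms(4) that by blast
  have "\<exists>j m. j \<ge> k \<and> m \<in> D k \<and> m \<notin> D j" for k
  proof -
    obtain j where "j \<ge> k" "D j \<noteq> D k" using not by blast
    then show ?thesis using anti[of k j] by blast
  qed
  then obtain J f where J: "\<And>k. J k \<ge> k \<and> f k \<in> D k \<and> f k \<notin> D (J k)" by metis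
  obtain g :: "nat \<Rightarrow> nat" where g: "strict_mono g" "\<forall>x\<in>A. mono (\<lambda>n. lookup (f (g n)) x)"
    using dickson_subseq[OF assms(1), of "\<lambda>n. lookup (f n)"] by blast
  define a where "a = g 0"
  \<comment> \<open>A strictly increasing \<open>g\<close> satisfies \<open>g n \<ge> n\<close>, so
    the index \<open>J a\<close> ensures \<open>b \<ge> J a\<close>.\<close>
  define b where "b = g (J a)"
  have b: "J a \<le> b"
    unfolding b_def by (rule strict_mono_imp_increasing[OF g(1)])
  have le: "lookup (f a) x \<le> lookup (f b) x" for x
  proof (cases "x \<in> A")
    case True
    then show ?thesis using g(2) monoD[of "\<lambda>n. lookup (f (g n)) x" 0 "J a"] by (simp add: a_def b_def)
  next
    case False
    have "f a \<in> monoms A" using J assms(2) by blast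
    then have "lookup (f a) x = 0" using False by (auto simp: monoms_def subset_iff in_keys_iff)
    then show ?thesis by simp
  qed
  have "f b = f a + (f b - f a)"
    by (rule poly_mapping_eqI) (simp add: lookup_add lookup_minus le)
  moreover have "f b \<in> D (J a)" using J[of b] anti[OF b] by blast
  ultimately have "f a \<in> D (J a)" using assms(3)[of "J a"] unfolding down_set_def by metis
  then show False using J by blast
qed

text \<open>Slice by the exponent of \<open>x\<close>. The slices are a decreasing chain of down
  sets in the other variables, constant from some \<open>k\<close> on: the slices below
  \<open>k\<close> are decomposed separately, and the rest is a shifted cylinder over
  \<open>S k\<close>.\<close>

lemma stanley_down_set:
  assumes "finite A" "D \<subseteq> monoms A" "down_set D"
  shows "stanley A D"
  using assms
proof (induction A arbitrary: D rule: finite_induct)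
  case empty
  then have "D = {} \<or> D = {0}" by auto
  then show ?case
  proof
    assume "D = {0}"
    then show ?case
      using stanley_Un[OF stanley_empty, of "{}" "{}" 0] by simp
  qed (simp add: stanley_empty)
next
  case (insert x A)
  define S where "S j = {m \<in> monoms A. Poly_Mapping.single x j + m \<in> D}" for j
  have down: "down_set (S j)" for j
    using insert.prems(2) unfolding down_set_def S_def
    by (auto dest: monoms_addD simp flip: add.assoc)
  have dec: "S (Suc j) \<subseteq> S j" for j
  proof
    fix m assume m: "m \<in> S (Suc j)"
    have "Poly_Mapping.single x (Suc j) + m = Poly_Mapping.single x j + m + Poly_Mapping.single x 1"
      by (simp add: add.assoc add.left_commute flip: single_add) (simp add: add.commute)
    then show "m \<in> S j"
      using m insert.prems(2) unfolding S_def down_set_def by (metis (no_types, lifting) mem_Collect_eq)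
  qed
  have S: "stanley A (S j)" for j
    using insert.IH[of "S j"] down by (auto simp: S_def)
  obtain k where k: "\<And>j. j \<ge> k \<Longrightarrow> S j = S k"
    using down_sets_stabilize[of A S] insert.hyps down dec by (auto simp: S_def)
  have x: "Poly_Mapping.single x j \<in> monoms (insert x A)" for j
    by (simp add: single_in_monoms)
  have lx: "lookup m x = 0" if "m \<in> S j" for m j
    using that insert.hyps(2) by (auto simp: S_def monoms_def in_keys_iff)
  define low where "low i = (\<Union>j<i. (+) (Poly_Mapping.single x j) ` S j)" for i
  have low_lt: "lookup m x < i" if "m \<in> low i" for m i
    using that lx by (auto simp: low_def lookup_add)
  have low: "stanley (insert x A) (low i)" for i
  proof (induction i)
    case 0
    show ?case by (simp add: low_def stanley_empty)
  next
    case (Suc i)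
    have "low i \<inter> (+) (Poly_Mapping.single x i) ` S i = {}"
      using low_lt[of _ i] lx[of _ i] by (fastforce simp: lookup_add)
    moreover have "stanley (insert x A) ((+) (Poly_Mapping.single x i) ` S i)"
      by (intro stanley_shift x stanley_mono[OF S]) auto
    moreover have "low (Suc i) = low i \<union> (+) (Poly_Mapping.single x i) ` S i"
      by (auto simp: low_def lessThan_Suc)
    ultimately show ?case
      using stanley_disjoint_Un Suc by metis
  qed
  define high where "high = (+) (Poly_Mapping.single x k) ` {Poly_Mapping.single x i + m | i m. m \<in> S k}"
  have high: "stanley (insert x A) high"
    unfolding high_def by (intro stanley_shift x stanley_cylinder S insert.hyps)
  have "low k \<inter> high = {}"
    using low_lt[of _ k] by (fastforce simp: high_def lookup_add)
  moreover have "D = low k \<union> high"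
  proof (intro equalityI subsetI)
    fix m assume m: "m \<in> D"
    then have "m \<in> monoms (insert x A)" using insert.prems by blast
    then obtain n where n: "n \<in> monoms A" "m = Poly_Mapping.single x (lookup m x - lookup n x) + n"
      by (rule monoms_insert_cases)
    define j where "j = lookup m x - lookup n x"
    have mj: "m = Poly_Mapping.single x j + n" using n(2) by (simp only: j_def)
    then have nS: "n \<in> S j" using m n(1) by (simp add: S_def)
    show "m \<in> low k \<union> high"
    proof (cases "j < k")
      case True
      then show ?thesis using mj nS by (auto simp: low_def)
    next
      case False
      then have "m = Poly_Mapping.single x k + (Poly_Mapping.single x (j - k) + n)" "n \<in> S k"
        using mj nS k[of j] by (simp_all flip: add.assoc single_add)
      then show ?thesis unfolding high_def by blast
    qed
  next
    fix m assume "m \<in> low k \<union> high"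
    then show "m \<in> D"
    proof
      assume "m \<in> high"
      then obtain i n where "n \<in> S k" "m = Poly_Mapping.single x (k + i) + n"
        by (auto simp: high_def single_add add.assoc)
      then show "m \<in> D" using k[of "k + i"] by (auto simp: S_def)
    qed (auto simp: low_def S_def)
  qed
  ultimately show ?case
    using stanley_disjoint_Un[OF high low] by simp
qed

section \<open>Standard monomials and the denominator of the Hilbert series\<close>

lemma additive_weight_add: "additive_weight N \<Longrightarrow> N (m + n) = N m + N n"
  by (simp add: additive_weight_def)

text \<open>In each fibre of the weight, keep the least monomial for an order compatible with addition.
  What remains is closed under division.\<close>

lemma standard_monomials:
  fixes N :: "'x monom \<Rightarrow> 'g::cancel_comm_monoid_add"
  assumes N: "additive_weight N" and "finite A"
    and graded: "\<And>m n. m \<in> monoms A \<Longrightarrow> n \<in> monoms A \<Longrightarrow> N m = N n \<Longrightarrow> mdeg m = mdeg n"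
  obtains D where "D \<subseteq> monoms A" "down_set D" "inj_on N D"
    "\<And>n. N ` {m \<in> monoms A. mdeg m = n} = N ` {m \<in> D. mdeg m = n}"
proof -
  \<comment> \<open>The variables carry no order; numbering them lets monomials be compared through
    the linear order of \<open>nat \<Rightarrow>\<^sub>0 nat\<close>, which is compatible with
    addition.\<close>
  obtain idx :: "'x \<Rightarrow> nat" where idx: "inj_on idx A"
    using finite_imp_inj_to_nat_seg[OF \<open>finite A\<close>] by blast
  define key where "key m = (\<Sum>x\<in>A. Poly_Mapping.single (idx x) (lookup m x))" for m :: "'x monom"
  have key_add: "key (m + n) = key m + key n" for m n
    by (simp add: key_def lookup_add single_add sum.distrib)
  have lookup_key: "lookup (key m) (idx x) = lookup m x" if "x \<in> A" for m x
  proof -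
    have "lookup (key m) (idx x) = (\<Sum>z\<in>A. if z = x then lookup m x else 0)"
      unfolding key_def lookup_sum
      using idx that by (intro sum.cong) (auto simp: lookup_single when_def inj_on_def)
    then show ?thesis
      using that \<open>finite A\<close> by simp
  qed
  have key_inj: "m = n" if "m \<in> monoms A" "n \<in> monoms A" "key m = key n" for m n
  proof (rule poly_mapping_eqI)
    fix x
    show "lookup m x = lookup n x"
    proof (cases "x \<in> A")
      case True
      then show ?thesis using lookup_key[of x m] lookup_key[of x n] that(3) by simp
    next
      case False
      then have "x \<notin> keys m" "x \<notin> keys n" using that(1,2) by (auto simp: monoms_def)
      then show ?thesis by (simp add: in_keys_iff)
    qed
  qed
  define D where "D = {m \<in> monoms A. \<forall>n\<in>monoms A. N n = N m \<longrightarrow> key m \<le> key n}"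
  show thesis
  proof
    show "D \<subseteq> monoms A" by (auto simp: D_def)
    show "down_set D"
      unfolding down_set_def
    proof (intro allI impI)
      fix m t assume mt: "m + t \<in> D"
      then have mem: "m \<in> monoms A" "t \<in> monoms A"
        by (auto simp: D_def dest: monoms_addD)
      have "key m \<le> key n" if "n \<in> monoms A" "N n = N m" for n
      proof -
        have "n + t \<in> monoms A" "N (n + t) = N (m + t)"
          using that mem(2) by (auto simp: additive_weight_add[OF N] intro: monoms_add)
        then have "key (m + t) \<le> key (n + t)"
          using mt unfolding D_def by blast
        then show ?thesis by (simp add: key_add)
      qed
      with mem show "m \<in> D" by (auto simp: D_def)
    qed
    show "inj_on N D"
    proof (rule inj_onI)
      fix m n assume mn: "m \<in> D" "n \<in> D" "N m = N n"
      then have "key m \<le> key n" "key n \<le> key m"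
        by (auto simp: D_def)
      then show "m = n"
        using mn key_inj by (auto simp: D_def)
    qed
    show "N ` {m \<in> monoms A. mdeg m = k} = N ` {m \<in> D. mdeg m = k}" for k
    proof (intro equalityI subsetI)
      fix z assume "z \<in> N ` {m \<in> monoms A. mdeg m = k}"
      then obtain m where m: "m \<in> monoms A" "mdeg m = k" "z = N m" by blast
      \<comment> \<open>By \<open>graded\<close> the fibre of \<open>m\<close> lies in a single
        degree; so it is finite and has a least key.\<close>
      define X where "X = {n \<in> monoms A. N n = N m}"
      have sub: "X \<subseteq> {n \<in> monoms A. mdeg n = k}"
      proof
        fix n assume "n \<in> X"
        then have n: "n \<in> monoms A" "N n = N m" by (simp_all add: X_def)
        then have "mdeg n = mdeg m" using m(1) by (intro graded)
        then show "n \<in> {n \<in> monoms A. mdeg n = k}" using n(1) m(2) by simp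
      qed
      have "finite X"
        by (rule finite_subset[OF sub finite_monoms_mdeg[OF \<open>finite A\<close>]])
      moreover have "m \<in> X" unfolding X_def using m(1) by simp
      ultimately have "Min (key ` X) \<in> key ` X" and min: "\<And>l. l \<in> X \<Longrightarrow> Min (key ` X) \<le> key l"
        by (auto intro!: Min_in)
      then obtain n where "n \<in> X" "Min (key ` X) = key n" by blast
      with min have n: "n \<in> X" "\<And>l. l \<in> X \<Longrightarrow> key n \<le> key l" by auto
      then have "n \<in> D" by (auto simp: D_def X_def)
      moreover have "mdeg n = k" "N n = z" using n(1) sub m(3) by (auto simp: X_def)
      ultimately show "z \<in> N ` {m \<in> D. mdeg m = k}" by blast
    next
      fix z assume "z \<in> N ` {m \<in> D. mdeg m = k}"
      then show "z \<in> N ` {m \<in> monoms A. mdeg m = k}"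
        unfolding D_def by blast
    qed
  qed
qed

text \<open>On a Stanley block \<open>u + monoms B\<close> of standard monomials the weight is injective, hence so
  it is on \<open>monoms B\<close>; this bounds the pole orders of the summands of the Hilbert series.\<close>

lemma hilbert_series_kernel_ideal:
  fixes N :: "'x monom \<Rightarrow> 'g::cancel_comm_monoid_add"
  assumes N: "additive_weight N" and "finite A"
    and graded: "\<And>m n. m \<in> monoms A \<Longrightarrow> n \<in> monoms A \<Longrightarrow> N m = N n \<Longrightarrow> mdeg m = mdeg n"
  obtains B h where "B \<subseteq> A" "inj_on N (monoms B)"
    "fps_of_poly h = hilbert_series A (kernel_ideal A N :: ('x, 'k::field) mpoly set) * (1 - fps_X) ^ card B"
proof -
  obtain D where D: "D \<subseteq> monoms A" "down_set D" "inj_on N D"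
    "\<And>n. N ` {m \<in> monoms A. mdeg m = n} = N ` {m \<in> D. mdeg m = n}"
    by (rule standard_monomials[OF N \<open>finite A\<close> graded], (assumption+)?, rule that)
  have series: "hilbert_series A (kernel_ideal A N :: ('x, 'k) mpoly set) = count_series D"
  proof (rule fps_ext)
    fix n
    have "card (N ` {m \<in> D. mdeg m = n}) = card {m \<in> D. mdeg m = n}"
      by (rule card_image[OF inj_on_subset[OF D(3)]]) blast
    then show "fps_nth (hilbert_series A (kernel_ideal A N :: ('x, 'k) mpoly set)) n = fps_nth (count_series D) n"
      by (simp add: hilbert_series_def count_series_def hilbert_fun_kernel_ideal[OF N \<open>finite A\<close>] D(4))
  qed
  \<comment> \<open>A largest such set is chosen: it has to bound every block, and its own
    injectivity is passed on for the lower bound on the dimension.\<close>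
  define ind where "ind B \<longleftrightarrow> B \<subseteq> A \<and> inj_on N (monoms B)" for B
  have "ind {}" by (simp add: ind_def)
  moreover have "\<forall>B. ind B \<longrightarrow> card B < Suc (card A)"
    using card_mono[OF \<open>finite A\<close>] by (simp add: ind_def less_Suc_eq_le)
  ultimately have "\<exists>B. ind B \<and> (\<forall>B'. ind B' \<longrightarrow> card B' \<le> card B)"
    by (rule ex_has_greatest_nat)
  then obtain B where B: "ind B" "\<And>B'. ind B' \<Longrightarrow> card B' \<le> card B"
    by blast
  have "\<exists>h. fps_of_poly h = count_series D * (1 - fps_X) ^ card B"
  proof (rule count_series_stanley[OF stanley_down_set[OF \<open>finite A\<close> D(1,2)] \<open>finite A\<close>])
    fix u B' assume B': "B' \<subseteq> A" "(+) u ` monoms B' \<subseteq> D"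
    have "inj_on N (monoms B')"
    proof (rule inj_onI)
      fix m n assume mn: "m \<in> monoms B'" "n \<in> monoms B'" "N m = N n"
      then have "N (u + m) = N (u + n)" by (simp add: additive_weight_add[OF N])
      moreover have "u + m \<in> D" "u + n \<in> D" using mn B'(2) by blast+
      ultimately have "u + m = u + n" by (rule inj_onD[OF D(3)])
      then show "m = n" by simp
    qed
    with B'(1) show "card B' \<le> card B" by (intro B(2)) (simp add: ind_def)
  qed
  then obtain h where "fps_of_poly h = count_series D * (1 - fps_X) ^ card B" ..
  with B(1) show thesis
    by (intro that[of B h]) (simp_all add: series ind_def)
qed

section \<open>Krull dimension: the upper bound\<close>

lemma fps_mult_one_minus_X_nth_Suc:
  "fps_nth (f * (1 - fps_X)) (Suc n) = fps_nth f (Suc n) - fps_nth f n" for f :: "int fps"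
  by (simp add: right_diff_distrib)

text \<open>Multiplication by \<open>1 - fps_X\<close> takes differences, so a coefficient of
  \<open>f\<close> is a partial sum of coefficients of \<open>f * (1 - fps_X)\<close>; every factor
  beyond the first costs one power of \<open>n + 1\<close>.\<close>

lemma fps_growth:
  fixes f :: "int fps"
  assumes "f * (1 - fps_X) ^ Suc r = fps_of_poly h"
  shows "\<exists>C. \<forall>n. \<bar>fps_nth f n\<bar> \<le> C * (int n + 1) ^ r"
proof -
  have partial: "\<bar>fps_nth f n\<bar> \<le> (\<Sum>k\<le>n. \<bar>fps_nth (f * (1 - fps_X)) k\<bar>)" for f :: "int fps" and n
  proof (induction n)
    case (Suc n)
    then show ?case
      by (simp only: fps_mult_one_minus_X_nth_Suc sum.atMost_Suc)
  qed simp
  show ?thesis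
    using assms
  proof (induction r arbitrary: f)
    case 0
    \<comment> \<open>With one factor, the coefficients of \<open>f\<close> are partial sums of
      those of the polynomial \<open>h\<close>, hence bounded.\<close>
    have "\<bar>fps_nth f n\<bar> \<le> (\<Sum>k\<le>degree h. \<bar>coeff h k\<bar>)" for n
    proof -
      have "\<bar>fps_nth f n\<bar> \<le> (\<Sum>k\<le>n. \<bar>coeff h k\<bar>)"
        using partial[of f n] 0 by simp
      also have "\<dots> = (\<Sum>k | k \<le> n \<and> k \<le> degree h. \<bar>coeff h k\<bar>)"
        by (rule sum.mono_neutral_right) (auto intro: le_degree)
      also have "\<dots> \<le> (\<Sum>k\<le>degree h. \<bar>coeff h k\<bar>)"
        by (rule sum_mono2) auto
      finally show ?thesis .
    qed
    then show ?case by (intro exI[of _ "\<Sum>k\<le>degree h. \<bar>coeff h k\<bar>"]) simp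
  next
    case (Suc r)
    have "f * (1 - fps_X) * (1 - fps_X) ^ Suc r = fps_of_poly h"
      using Suc.prems by (simp add: mult.assoc)
    then obtain C where C: "\<And>n. \<bar>fps_nth (f * (1 - fps_X)) n\<bar> \<le> C * (int n + 1) ^ r"
      using Suc.IH by blast
    have C0: "C \<ge> 0"
      using C[of 0] by simp
    have "\<bar>fps_nth f n\<bar> \<le> C * (int n + 1) ^ Suc r" for n
    proof -
      have "\<bar>fps_nth f n\<bar> \<le> (\<Sum>k\<le>n. \<bar>fps_nth (f * (1 - fps_X)) k\<bar>)"
        by (rule partial)
      also have "\<dots> \<le> (\<Sum>k\<le>n. C * (int n + 1) ^ r)"
      proof (rule sum_mono)
        fix k assume "k \<in> {..n}"
        then have "C * (int k + 1) ^ r \<le> C * (int n + 1) ^ r"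
          using C0 by (intro mult_left_mono power_mono) auto
        then show "\<bar>fps_nth (f * (1 - fps_X)) k\<bar> \<le> C * (int n + 1) ^ r"
          using C[of k] by linarith
      qed
      also have "\<dots> = C * (int n + 1) ^ Suc r"
        by (simp add: algebra_simps)
      finally show ?thesis .
    qed
    then show ?case by blast
  qed
qed

text \<open>Gaussian elimination, one coordinate at a time: there are \<open>card L\<close> unknowns
  and only \<open>card T\<close> equations.\<close>

lemma linear_dependence:
  fixes f :: "'a \<Rightarrow> 'b \<Rightarrow> 'k::field"
  assumes "finite T" "finite L" "card T < card L"
  shows "\<exists>c. (\<exists>a\<in>L. c a \<noteq> 0) \<and> (\<forall>t\<in>T. (\<Sum>a\<in>L. c a * f a t) = 0)"
  using assms
proof (induction T arbitrary: f L rule: finite_induct)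
  case empty
  then obtain a where "a \<in> L" by fastforce
  then show ?case by (intro exI[of _ "\<lambda>_. 1"]) auto
next
  case (insert t T)
  show ?case
  proof (cases "\<exists>b\<in>L. f b t \<noteq> 0")
    case False
    then show ?thesis
      using insert.IH[of L f] insert.prems insert.hyps by auto
  next
    case True
    then obtain b where b: "b \<in> L" "f b t \<noteq> 0" by blast
    \<comment> \<open>Subtracting a multiple of the pivot row \<open>b\<close> clears coordinate
      \<open>t\<close>.\<close>
    define g where "g a s = f a s - f a t / f b t * f b s" for a s
    have "card T < card (L - {b})"
      using insert.prems insert.hyps b(1) by simp
    then obtain c where c: "\<exists>a\<in>L - {b}. c a \<noteq> 0" "\<And>s. s \<in> T \<Longrightarrow> (\<Sum>a\<in>L - {b}. c a * g a s) = 0"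
      using insert.IH[of "L - {b}" g] insert.prems(1) by blast
    \<comment> \<open>The coefficient of the pivot row, collected from all these
      subtractions.\<close>
    define w where "w = - (\<Sum>a\<in>L - {b}. c a * (f a t / f b t))"
    define d where "d a = (if a = b then w else c a)" for a
    have sum: "(\<Sum>a\<in>L. d a * f a s) = (\<Sum>a\<in>L - {b}. c a * g a s)" for s
    proof -
      have "(\<Sum>a\<in>L. d a * f a s) = w * f b s + (\<Sum>a\<in>L - {b}. c a * f a s)"
        using insert.prems(1) b(1) by (simp add: sum.remove[of L b] d_def)
      also have "\<dots> = (\<Sum>a\<in>L - {b}. c a * g a s)"
        unfolding w_def g_def
        by (simp add: right_diff_distrib sum_subtractf sum_distrib_right mult.assoc)
      finally show ?thesis .
    qed
    have "(\<Sum>a\<in>L. d a * f a t) = 0"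
      unfolding sum g_def using b(2) by simp
    moreover have "\<exists>a\<in>L. d a \<noteq> 0"
      using c(1) by (auto simp: d_def)
    ultimately show ?thesis
      using c(2) sum by (intro exI[of _ d]) auto
  qed
qed

section \<open>Prime chains and algebraic relations\<close>

lemma ideal_mpoly_ring_closed:
  fixes I :: "('x, 'k::comm_ring_1) mpoly set"
  assumes "ideal I (mpoly_ring A)"
  shows "I \<subseteq> carrier (mpoly_ring A)" "0 \<in> I"
    "p \<in> I \<Longrightarrow> q \<in> I \<Longrightarrow> p + q \<in> I" "p \<in> I \<Longrightarrow> q \<in> I \<Longrightarrow> p - q \<in> I"
    "p \<in> carrier (mpoly_ring A) \<Longrightarrow> q \<in> I \<Longrightarrow> p * q \<in> I"
proof -
  interpret ideal I "mpoly_ring A" by fact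
  show sub: "I \<subseteq> carrier (mpoly_ring A)" by (rule a_subset)
  show "0 \<in> I" using additive_subgroup.zero_closed[OF is_additive_subgroup] by (simp only: mpoly_ring_simps)
  show add: "p \<in> I \<Longrightarrow> q \<in> I \<Longrightarrow> p + q \<in> I" for p q
    using additive_subgroup.a_closed[OF is_additive_subgroup, of p q] by (simp only: mpoly_ring_simps)
  show mult: "p \<in> carrier (mpoly_ring A) \<Longrightarrow> q \<in> I \<Longrightarrow> p * q \<in> I" for p q
    using I_l_closed[of q p] by (simp only: mpoly_ring_simps)
  assume pq: "p \<in> I" "q \<in> I"
  have "- 1 \<in> carrier (mpoly_ring A :: ('x, 'k) mpoly ring)"
    by (intro carrier_mpoly_ring_closed)
  then show "p - q \<in> I"
    using add[OF pq(1) mult[OF _ pq(2)], of "- 1"] by simp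
qed

lemma ideal_mpoly_ring_sum:
  assumes "ideal I (mpoly_ring A)" "\<And>i. i \<in> M \<Longrightarrow> f i \<in> I"
  shows "sum f M \<in> I"
  using assms(2)
  by (induction M rule: infinite_finite_induct) (auto intro: ideal_mpoly_ring_closed[OF assms(1)])

text \<open>The list starts with the exponent of \<open>x k\<close>, so an induction along a chain
  of primes can peel off its head and go on at \<open>Suc k\<close>.\<close>

fun list_monomial :: "(nat \<Rightarrow> 'a::comm_monoid_mult) \<Rightarrow> nat \<Rightarrow> nat list \<Rightarrow> 'a"
  where
    "list_monomial x k [] = 1"
  | "list_monomial x k (a # as) = x k ^ a * list_monomial x (Suc k) as"

lemma list_monomial_closed:
  "(\<And>i. i < k + length as \<Longrightarrow> x i \<in> carrier (mpoly_ring A)) \<Longrightarrow>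
    list_monomial x k as \<in> carrier (mpoly_ring A)"
  by (induction as arbitrary: k) (auto intro!: carrier_mpoly_ring_closed)

lemma prime_mpoly_ring_power:
  fixes P :: "('x, 'k::comm_ring_1) mpoly set"
  assumes P: "primeideal P (mpoly_ring A)" and x: "x \<in> carrier (mpoly_ring A)" "x \<notin> P"
    and q: "q \<in> carrier (mpoly_ring A)" "x ^ n * q \<in> P"
  shows "q \<in> P"
  using q
proof (induction n)
  case (Suc n)
  have "x ^ n * q \<in> carrier (mpoly_ring A)"
    using x q by (intro carrier_mpoly_ring_closed)
  then have "x ^ n * q \<in> P"
    using primeideal.I_prime[OF P x(1), of "x ^ n * q"] Suc.prems x(2) by (simp add: mult.assoc)
  then show ?case using Suc by blast
qed simp

text \<open>The argument of Coquand and Lombardi: in a relation between the \<open>x i\<close>, cancel the lowest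
  power of \<open>x k\<close>, which is possible modulo \<open>P k\<close>, and then put \<open>x k = 0\<close>, that is, pass to
  \<open>P (Suc k)\<close>.\<close>

lemma prime_chain_no_relation:
  fixes P :: "nat \<Rightarrow> ('x, 'k::field) mpoly set" and x :: "nat \<Rightarrow> ('x, 'k) mpoly"
  assumes P: "\<And>i. i \<le> n \<Longrightarrow> primeideal (P i) (mpoly_ring A)"
    and sub: "\<And>i. i < n \<Longrightarrow> P i \<subseteq> P (Suc i)"
    and x: "\<And>i. i < n \<Longrightarrow> x i \<in> P (Suc i) - P i"
  shows "k \<le> n \<Longrightarrow> finite L \<Longrightarrow> (\<And>a. a \<in> L \<Longrightarrow> length a = n - k) \<Longrightarrow>
    (\<Sum>a\<in>L. Const (c a) * list_monomial x k a) \<in> P k \<Longrightarrow> a \<in> L \<Longrightarrow> c a = 0"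
proof (induction "n - k" arbitrary: k L c a)
  case 0
  then have "k = n" "L \<subseteq> {[]}" by auto
  with 0 have L: "L = {[]}" "a = []" by auto
  \<comment> \<open>At the top of the chain the relation is a constant, and a proper ideal contains
    no nonzero constant.\<close>
  then have "Const (c []) \<in> P n"
    using 0 \<open>k = n\<close> by simp
  have idl: "ideal (P n) (mpoly_ring A)"
    using P[of n] by (simp add: primeideal_def)
  show ?case
  proof (rule ccontr)
    assume "c a \<noteq> 0"
    then have "Const (inverse (c [])) * Const (c []) = (1 :: ('x, 'k) mpoly)"
      using L by (simp add: Const_def mult_single)
    then have one: "1 \<in> P n"
      using ideal_mpoly_ring_closed(5)[OF idl carrier_mpoly_ring_closed(3) \<open>Const (c []) \<in> P n\<close>] by metis
    have "p \<in> P n" if "p \<in> carrier (mpoly_ring A)" for p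
      using ideal_mpoly_ring_closed(5)[OF idl that one] by simp
    then have "carrier (mpoly_ring A) = P n"
      using ideal_mpoly_ring_closed(1)[OF idl] by blast
    then show False
      using primeideal.I_notcarr[OF P[of n]] by simp
  qed
next
  case (Suc m)
  have kn: "k < n" using Suc.hyps(2) by simp
  have Pk: "primeideal (P k) (mpoly_ring A)" and PS: "primeideal (P (Suc k)) (mpoly_ring A)"
    using kn by (intro P; simp)+
  then have Ik: "ideal (P k) (mpoly_ring A)" and IS: "ideal (P (Suc k)) (mpoly_ring A)"
    by (simp_all add: primeideal_def)
  have xc: "x i \<in> carrier (mpoly_ring A)" if "i < n" for i
  proof -
    have "ideal (P (Suc i)) (mpoly_ring A)"
      using P[of "Suc i"] that by (simp add: primeideal_def)
    then show ?thesis
      using x[OF that] ideal_mpoly_ring_closed(1) by blast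
  qed
  have xk: "x k \<in> P (Suc k)" "x k \<notin> P k" using x[OF kn] by auto
  show ?case
  proof (rule ccontr)
    assume "c a \<noteq> 0"
    \<comment> \<open>Zero coefficients are dropped so that the minimal exponent \<open>l\<close> of
      \<open>x k\<close> belongs to a genuine term.\<close>
    define L' where "L' = {a \<in> L. c a \<noteq> 0}"
    have L': "finite L'" "a \<in> L'"
      using Suc.prems \<open>c a \<noteq> 0\<close> by (auto simp: L'_def)
    have len: "length b = Suc m" if "b \<in> L'" for b
      using that Suc.prems(3)[of b] Suc.hyps(2) by (simp add: L'_def)
    define l where "l = Min (hd ` L')"
    have "l \<in> hd ` L'"
      unfolding l_def using L' by (intro Min_in) auto
    then obtain b where b: "b \<in> L'" "hd b = l" by blast
    have le: "l \<le> hd b" if "b \<in> L'" for b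
      unfolding l_def using L' that by (intro Min_le) auto
    define t where "t b = Const (c b) * (x k ^ (hd b - l) * list_monomial x (Suc k) (tl b))" for b
    have lm: "list_monomial x (Suc k) (tl b) \<in> carrier (mpoly_ring A)" if "b \<in> L'" for b
      using len[OF that] Suc.hyps(2) by (intro list_monomial_closed xc) simp
    have tc: "t b \<in> carrier (mpoly_ring A)" if "b \<in> L'" for b
      unfolding t_def using kn that by (intro carrier_mpoly_ring_closed lm xc)
    have split: "Const (c b) * list_monomial x k b = x k ^ l * t b" if "b \<in> L'" for b
    proof -
      have "length b = Suc m" using that by (rule len)
      then obtain h bs where b: "b = h # bs" by (cases b) auto
      moreover have "x k ^ h = x k ^ l * x k ^ (h - l)"
        using le[OF that] b by (simp flip: power_add)
      ultimately show ?thesis by (simp add: t_def mult_ac)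
    qed
    have "(\<Sum>a\<in>L. Const (c a) * list_monomial x k a) = (\<Sum>a\<in>L'. Const (c a) * list_monomial x k a)"
      by (rule sum.mono_neutral_right) (use Suc.prems in \<open>auto simp: L'_def Const_def\<close>)
    also have "\<dots> = x k ^ l * sum t L'"
      by (simp add: split sum_distrib_left)
    finally have "x k ^ l * sum t L' \<in> P k"
      using Suc.prems(4) by simp
    from prime_mpoly_ring_power[OF Pk xc[OF kn] xk(2) carrier_mpoly_ring_sum[OF tc] this]
    have "sum t L' \<in> P k" by simp
    then have tS: "sum t L' \<in> P (Suc k)"
      using sub[OF kn] by blast
    \<comment> \<open>The terms from which \<open>x k\<close> disappears after cancelling. All
      others keep a factor \<open>x k\<close>, which lies in \<open>P (Suc k)\<close>.\<close>
    define M where "M = {b \<in> L'. hd b = l}"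
    have M: "M \<subseteq> L'" by (auto simp: M_def)
    have "t b \<in> P (Suc k)" if "b \<in> L' - M" for b
    proof -
      have "hd b - l = Suc (hd b - l - 1)"
        using that le[of b] by (auto simp: M_def)
      then have "x k ^ (hd b - l) = x k * x k ^ (hd b - l - 1)"
        by (metis power_Suc)
      then have "t b = (Const (c b) * (x k ^ (hd b - l - 1) * list_monomial x (Suc k) (tl b))) * x k"
        unfolding t_def by (simp only: mult_ac)
      moreover have "Const (c b) * (x k ^ (hd b - l - 1) * list_monomial x (Suc k) (tl b)) \<in> carrier (mpoly_ring A)"
        using that by (intro carrier_mpoly_ring_closed lm xc kn) simp
      ultimately show ?thesis
        using ideal_mpoly_ring_closed(5)[OF IS _ xk(1)] by simp
    qed
    then have "sum t (L' - M) \<in> P (Suc k)"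
      by (intro ideal_mpoly_ring_sum[OF IS])
    moreover have "sum t L' = sum t M + sum t (L' - M)"
      using sum.subset_diff[OF M L'(1)] by (simp add: add.commute)
    ultimately have "sum t M \<in> P (Suc k)"
      using ideal_mpoly_ring_closed(4)[OF IS tS, of "sum t (L' - M)"] by simp
    moreover have "sum t M = (\<Sum>bs\<in>tl ` M. Const (c (l # bs)) * list_monomial x (Suc k) bs)"
    proof -
      have cons: "b = l # tl b" if "b \<in> M" for b
        using that len[of b] by (cases b) (auto simp: M_def)
      have "inj_on tl M"
        by (rule inj_onI) (metis cons)
      then show ?thesis
        using cons by (auto simp: sum.reindex t_def M_def intro!: sum.cong)
    qed
    ultimately have "(\<Sum>bs\<in>tl ` M. Const (c (l # bs)) * list_monomial x (Suc k) bs) \<in> P (Suc k)"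
      by simp
    moreover have "length bs = n - Suc k" if "bs \<in> tl ` M" for bs
      using that len M Suc.hyps(2) by auto
    moreover have "finite (tl ` M)"
      using L'(1) M finite_subset by blast
    moreover have "tl b \<in> tl ` M" using b by (auto simp: M_def)
    ultimately have "c (l # tl b) = 0"
      using kn Suc.hyps(2) by (intro Suc.hyps(1)[of "Suc k" "tl ` M" "\<lambda>bs. c (l # bs)"]) auto
    moreover have "l # tl b = b"
      using b len[OF b(1)] by (cases b) auto
    ultimately show False using b(1) by (simp add: L'_def)
  qed
qed

lemma mdeg_mult_bound:
  fixes p q :: "('x, 'k::comm_ring_1) mpoly"
  assumes "\<And>m. m \<in> keys p \<Longrightarrow> mdeg m \<le> a" "\<And>m. m \<in> keys q \<Longrightarrow> mdeg m \<le> b" "m \<in> keys (p * q)"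
  shows "mdeg m \<le> a + b"
proof -
  obtain s t where "s \<in> keys p" "t \<in> keys q" "m = s + t"
    using keys_mult[of p q] assms(3) by blast
  then show ?thesis
    using assms(1)[of s] assms(2)[of t] by (simp add: mdeg_add)
qed

lemma mdeg_power_bound:
  fixes p :: "('x, 'k::comm_ring_1) mpoly"
  assumes "\<And>m. m \<in> keys p \<Longrightarrow> mdeg m \<le> d"
  shows "m \<in> keys (p ^ n) \<Longrightarrow> mdeg m \<le> n * d"
proof (induction n arbitrary: m)
  case (Suc n)
  then show ?case
    using mdeg_mult_bound[of p d "p ^ n" "n * d" m] assms by simp
qed (simp split: if_splits)

lemma mdeg_list_monomial_bound:
  fixes x :: "nat \<Rightarrow> ('x, 'k::comm_ring_1) mpoly"
  assumes "\<And>i m. i < k + length as \<Longrightarrow> m \<in> keys (x i) \<Longrightarrow> mdeg m \<le> d"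
  shows "m \<in> keys (list_monomial x k as) \<Longrightarrow> mdeg m \<le> sum_list as * d"
  using assms
proof (induction as arbitrary: k m)
  case (Cons a as)
  have "mdeg m \<le> a * d" if "m \<in> keys (x k ^ a)" for m
    by (rule mdeg_power_bound[OF _ that]) (use Cons.prems(2)[of k] in auto)
  moreover have "mdeg m \<le> sum_list as * d" if "m \<in> keys (list_monomial x (Suc k) as)" for m
    by (rule Cons.IH[OF that]) (use Cons.prems(2) in auto)
  ultimately show ?case
    using mdeg_mult_bound[of "x k ^ a" "a * d" "list_monomial x (Suc k) as" "sum_list as * d" m] Cons.prems(1)
    by (simp add: distrib_right)
qed (simp split: if_splits)

lemma lookup_single_zero_mult:
  "lookup (Poly_Mapping.single 0 c * p) t = c * lookup p t"
  for p :: "'g::comm_monoid_add \<Rightarrow>\<^sub>0 'k::comm_ring_1"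
  by (simp add: Poly_Mapping.map.rep_eq when_def flip: mult_map_scale_conv_mult)

text \<open>A dimension count: exponent lists with entries up to \<open>M\<close> give
  \<open>(M + 1) ^ Suc r\<close> products of degree at most \<open>Suc r * M * d\<close>, and by
  \<open>growth\<close> fewer weights than that occur up to this degree. So the images of the
  products are linearly dependent.\<close>

lemma algebraic_relation_of_growth:
  fixes N :: "'x monom \<Rightarrow> 'g::comm_monoid_add" and x :: "nat \<Rightarrow> ('x, 'k::field) mpoly"
  assumes N: "additive_weight N" and "finite A"
    and growth: "\<And>n. card (N ` {m \<in> monoms A. mdeg m \<le> n}) \<le> C * (n + 1) ^ r"
    and x: "\<And>i. i < Suc r \<Longrightarrow> x i \<in> carrier (mpoly_ring A)"
  obtains L c where "finite L" "\<And>a. a \<in> L \<Longrightarrow> length a = Suc r" "\<exists>a\<in>L. c a \<noteq> 0"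
    "(\<Sum>a\<in>L. Const (c a) * list_monomial x 0 a) \<in> kernel_ideal A N"
proof -
  \<comment> \<open>A common degree bound for the \<open>x i\<close>; the inserted \<open>0\<close>
    keeps \<open>Max\<close> meaningful if all of them vanish.\<close>
  define d where "d = Max (insert 0 (mdeg ` (\<Union>i<Suc r. keys (x i))))"
  have d: "mdeg m \<le> d" if "i < Suc r" "m \<in> keys (x i)" for i m
    unfolding d_def using that by (intro Max_ge) auto
  \<comment> \<open>Chosen so that \<open>C * ((Suc r * d + 1) * (M + 1)) ^ r\<close> equals
    \<open>M * (M + 1) ^ r\<close>, which is below \<open>(M + 1) ^ Suc r\<close>.\<close>
  define M where "M = C * (Suc r * d + 1) ^ r"
  define L where "L = {a :: nat list. set a \<subseteq> {..M} \<and> length a = Suc r}"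
  have L: "finite L" "card L = (M + 1) ^ Suc r"
    unfolding L_def using finite_lists_length_eq[of "{..M}" "Suc r"] card_lists_length_eq[of "{..M}" "Suc r"]
    by simp_all
  define T where "T = N ` {m \<in> monoms A. mdeg m \<le> Suc r * M * d}"
  have "finite T"
    unfolding T_def by (intro finite_imageI finite_monoms_mdeg_le[OF \<open>finite A\<close>])
  have "Suc r * M * d + 1 \<le> (Suc r * d + 1) * (M + 1)"
    by (simp add: algebra_simps)
  then have "C * (Suc r * M * d + 1) ^ r \<le> C * ((Suc r * d + 1) * (M + 1)) ^ r"
    by (intro mult_le_mono2 power_mono) auto
  also have "\<dots> = M * (M + 1) ^ r"
    by (simp only: M_def power_mult_distrib mult_ac)
  also have "\<dots> < (M + 1) ^ Suc r"
    by simp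
  finally have "card T < card L"
    using growth[of "Suc r * M * d"] unfolding T_def L(2) by linarith
  then obtain c where c: "\<exists>a\<in>L. c a \<noteq> 0"
    "\<forall>t\<in>T. (\<Sum>a\<in>L. c a * lookup (mono_map N (list_monomial x 0 a)) t) = 0"
    using linear_dependence[OF \<open>finite T\<close> L(1), of "\<lambda>a t. lookup (mono_map N (list_monomial x 0 a)) t"]
    by blast
  have carr: "list_monomial x 0 a \<in> carrier (mpoly_ring A)" if "a \<in> L" for a
    using that x by (intro list_monomial_closed) (simp add: L_def)
  define g where "g = (\<Sum>a\<in>L. Const (c a) * list_monomial x 0 a)"
  have "mono_map N g = 0"
  proof (rule poly_mapping_eqI)
    fix t
    have lookup_g: "lookup (mono_map N g) t = (\<Sum>a\<in>L. c a * lookup (mono_map N (list_monomial x 0 a)) t)"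
      unfolding g_def mono_map_sum lookup_sum mono_map_Const_mult[OF N]
      by (simp only: lookup_single_zero_mult)
    show "lookup (mono_map N g) t = lookup 0 t"
    proof (cases "t \<in> T")
      case True
      then show ?thesis using lookup_g c(2) by simp
    next
      case False
      \<comment> \<open>No monomial within the degree bound has a weight outside \<open>T\<close>,
        so these coordinates vanish in every product.\<close>
      have "lookup (mono_map N (list_monomial x 0 a)) t = 0" if a: "a \<in> L" for a
      proof -
        have "sum_list b \<le> length b * M" if "set b \<subseteq> {..M}" for b
          using that by (induction b) auto
        from this[of a] have "sum_list a \<le> Suc r * M"
          using a by (simp add: L_def)
        then have le: "sum_list a * d \<le> Suc r * M * d" by (rule mult_le_mono1)
        have "mdeg m \<le> sum_list a * d" if "m \<in> keys (list_monomial x 0 a)" for m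
          by (rule mdeg_list_monomial_bound[OF _ that]) (use a d in \<open>auto simp: L_def\<close>)
        moreover have "keys (list_monomial x 0 a) \<subseteq> monoms A"
          using carr[OF a] by (simp add: carrier_mpoly_ring)
        ultimately have "N m \<in> T" if "m \<in> keys (list_monomial x 0 a)" for m
          unfolding T_def using that order_trans[OF _ le, of "mdeg m"] by (intro imageI) blast
        then have "{m \<in> keys (list_monomial x 0 a). N m = t} = {}"
          using False by blast
        then show ?thesis by (simp only: lookup_mono_map sum.empty)
      qed
      then show ?thesis using lookup_g by simp
    qed
  qed
  moreover have "g \<in> carrier (mpoly_ring A)"
    unfolding g_def by (intro carrier_mpoly_ring_sum carrier_mpoly_ring_closed carr)
  ultimately show thesis
    using that[OF L(1) _ c(1)] unfolding g_def kernel_ideal_def L_def by blast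
qed

text \<open>Counting up to degree \<open>n\<close> sums the Hilbert function, so the denominator
  gains one factor 1 - t, and \<open>Suc r\<close> factors allow growth of order
  \<open>r\<close>.\<close>

lemma growth_of_rational_series:
  fixes N :: "'x monom \<Rightarrow> 'g::comm_monoid_add"
  assumes N: "additive_weight N" and "finite A"
    and h: "fps_of_poly h = hilbert_series A (kernel_ideal A N :: ('x, 'k::field) mpoly set) * (1 - fps_X) ^ r"
  obtains C where "\<And>n. card (N ` {m \<in> monoms A. mdeg m \<le> n}) \<le> C * (n + 1) ^ r"
proof -
  let ?c = "\<lambda>k. card (N ` {m \<in> monoms A. mdeg m = k})"
  define f :: "int fps" where "f = Abs_fps (\<lambda>n. \<Sum>k\<le>n. int (?c k))"
  have "f * (1 - fps_X) = hilbert_series A (kernel_ideal A N :: ('x, 'k) mpoly set)"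
  proof (rule fps_ext)
    fix n
    show "fps_nth (f * (1 - fps_X)) n = fps_nth (hilbert_series A (kernel_ideal A N :: ('x, 'k) mpoly set)) n"
    proof (cases n)
      case 0
      then show ?thesis
        by (simp add: f_def hilbert_series_def hilbert_fun_kernel_ideal[OF N \<open>finite A\<close>])
    next
      case (Suc k)
      show ?thesis
        unfolding Suc fps_mult_one_minus_X_nth_Suc
        by (simp add: f_def hilbert_series_def hilbert_fun_kernel_ideal[OF N \<open>finite A\<close>])
    qed
  qed
  then have "f * (1 - fps_X) ^ Suc r = fps_of_poly h"
    using h by (simp add: mult.assoc[symmetric])
  then obtain C where C: "\<And>n. \<bar>fps_nth f n\<bar> \<le> C * (int n + 1) ^ r"
    using fps_growth by blast
  have "card (N ` {m \<in> monoms A. mdeg m \<le> n}) \<le> nat C * (n + 1) ^ r" for n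
  proof -
    have eq: "N ` {m \<in> monoms A. mdeg m \<le> n} = (\<Union>k\<in>{..n}. N ` {m \<in> monoms A. mdeg m = k})"
      by blast
    have "card (N ` {m \<in> monoms A. mdeg m \<le> n}) \<le> (\<Sum>k\<le>n. ?c k)"
      unfolding eq by (rule card_UN_le) simp
    then have "int (card (N ` {m \<in> monoms A. mdeg m \<le> n})) \<le> fps_nth f n"
      by (simp add: f_def flip: of_nat_sum)
    also have "\<dots> \<le> C * (int n + 1) ^ r"
      using C[of n] by linarith
    finally have le: "int (card (N ` {m \<in> monoms A. mdeg m \<le> n})) \<le> C * (int n + 1) ^ r" .
    have "C \<ge> 0" using C[of 0] by simp
    then have "C * (int n + 1) ^ r = int (nat C * (n + 1) ^ r)"
      by (simp add: add.commute)
    then show ?thesis using le by linarith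
  qed
  then show thesis by (rule that)
qed

text \<open>Elements chosen in \<open>P (Suc i) - P i\<close> satisfy no nontrivial relation in
  \<open>P 0\<close>, whereas the growth bound gives any \<open>Suc r\<close> elements one in the
  kernel ideal.\<close>

lemma prime_chain_length_le:
  fixes N :: "'x monom \<Rightarrow> 'g::comm_monoid_add" and P :: "nat \<Rightarrow> ('x, 'k::field) mpoly set"
  assumes N: "additive_weight N" and "finite A"
    and h: "fps_of_poly h = hilbert_series A (kernel_ideal A N :: ('x, 'k) mpoly set) * (1 - fps_X) ^ r"
    and P: "\<And>i. i \<le> n \<Longrightarrow> primeideal (P i) (mpoly_ring A)" "kernel_ideal A N \<subseteq> P 0"
    and chain: "\<And>i. i < n \<Longrightarrow> P i \<subset> P (Suc i)"
  shows "n \<le> r"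
proof (rule ccontr)
  assume "\<not> n \<le> r"
  then have n: "Suc r \<le> n" by simp
  obtain C where C: "\<And>n. card (N ` {m \<in> monoms A. mdeg m \<le> n}) \<le> C * (n + 1) ^ r"
    using growth_of_rational_series[OF N \<open>finite A\<close> h] by blast
  have "\<exists>x. x \<in> P (Suc i) - P i" if "i < Suc r" for i
    using chain[of i] that n by auto
  then obtain x where x: "\<And>i. i < Suc r \<Longrightarrow> x i \<in> P (Suc i) - P i" by metis
  have xc: "x i \<in> carrier (mpoly_ring A)" if "i < Suc r" for i
    using x[OF that] P(1)[of "Suc i"] ideal_mpoly_ring_closed(1)[of "P (Suc i)" A] that n
    by (auto simp: primeideal_def)
  obtain L c where L: "finite L" "\<And>a. a \<in> L \<Longrightarrow> length a = Suc r" "\<exists>a\<in>L. c a \<noteq> 0"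
    "(\<Sum>a\<in>L. Const (c a) * list_monomial x 0 a) \<in> kernel_ideal A N"
    by (rule algebraic_relation_of_growth[OF N \<open>finite A\<close> C xc], assumption, rule that)
  obtain a where a: "a \<in> L" "c a \<noteq> 0" using L(3) by blast
  have "c a = 0"
  proof (rule prime_chain_no_relation[of "Suc r" P A x 0 L c a])
    show "(\<Sum>a\<in>L. Const (c a) * list_monomial x 0 a) \<in> P 0" using L(4) P(2) by blast
    show "P i \<subseteq> P (Suc i)" if "i < Suc r" for i using chain[of i] that n by auto
  qed (use L a x P(1) n in auto)
  with a show False by simp
qed

section \<open>Primes of the quotient ring\<close>

lemma coset_mem_image_iff:
  fixes P :: "('x, 'k::comm_ring_1) mpoly set"
  assumes I: "ideal I (mpoly_ring A)" and P: "ideal P (mpoly_ring A)" "I \<subseteq> P" and p: "p \<in> carrier (mpoly_ring A)"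
  shows "I +>\<^bsub>mpoly_ring A\<^esub> p \<in> (+>\<^bsub>mpoly_ring A\<^esub>) I ` P \<longleftrightarrow> p \<in> P"
proof
  assume "I +>\<^bsub>mpoly_ring A\<^esub> p \<in> (+>\<^bsub>mpoly_ring A\<^esub>) I ` P"
  then obtain q where q: "q \<in> P" "I +>\<^bsub>mpoly_ring A\<^esub> p = I +>\<^bsub>mpoly_ring A\<^esub> q" by blast
  then have "p - q \<in> I"
    using coset_eq_iff[OF I p, of q] ideal_mpoly_ring_closed(1)[OF P(1)] by blast
  then have "p - q + q \<in> P"
    using q(1) P(2) by (intro ideal_mpoly_ring_closed(3)[OF P(1)]) auto
  then show "p \<in> P" by simp
qed simp

lemma primeideal_quot_image:
  fixes P :: "('x, 'k::comm_ring_1) mpoly set"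
  assumes I: "ideal I (mpoly_ring A)" and P: "primeideal P (mpoly_ring A)" "I \<subseteq> P"
  shows "primeideal ((+>\<^bsub>mpoly_ring A\<^esub>) I ` P) (mpoly_ring A Quot I)"
proof -
  interpret I: ideal I "mpoly_ring A" by fact
  interpret H: ring_hom_ring "mpoly_ring A" "mpoly_ring A Quot I" "(+>\<^bsub>mpoly_ring A\<^esub>) I"
    by (rule I.rcos_ring_hom_ring)
  have Pi: "ideal P (mpoly_ring A)" using P(1) by (simp add: primeideal_def)
  note mem = coset_mem_image_iff[OF I Pi P(2)]
  have surj: "\<exists>p\<in>carrier (mpoly_ring A). a = I +>\<^bsub>mpoly_ring A\<^esub> p"
    if "a \<in> carrier (mpoly_ring A Quot I)" for a
    using that by (auto simp: FactRing_def A_RCOSETS_def')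
  show ?thesis
  proof (rule primeidealI)
    show "ideal ((+>\<^bsub>mpoly_ring A\<^esub>) I ` P) (mpoly_ring A Quot I)"
      by (rule I.ring_ideal_imp_quot_ideal[OF I Pi])
    show "cring (mpoly_ring A Quot I)"
      by (rule I.quotient_is_cring[OF mpoly_ring_cring])
    show "carrier (mpoly_ring A Quot I) \<noteq> (+>\<^bsub>mpoly_ring A\<^esub>) I ` P"
    proof
      assume eq: "carrier (mpoly_ring A Quot I) = (+>\<^bsub>mpoly_ring A\<^esub>) I ` P"
      have "p \<in> P" if "p \<in> carrier (mpoly_ring A)" for p
        using H.hom_closed[OF that] mem[OF that] unfolding eq by blast
      then show False
        using primeideal.I_notcarr[OF P(1)] ideal_mpoly_ring_closed(1)[OF Pi] by blast
    qed
    fix a b assume a: "a \<in> carrier (mpoly_ring A Quot I)" and b: "b \<in> carrier (mpoly_ring A Quot I)"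
      and ab: "a \<otimes>\<^bsub>mpoly_ring A Quot I\<^esub> b \<in> (+>\<^bsub>mpoly_ring A\<^esub>) I ` P"
    obtain p where p: "p \<in> carrier (mpoly_ring A)" "a = I +>\<^bsub>mpoly_ring A\<^esub> p" using surj[OF a] by blast
    obtain q where q: "q \<in> carrier (mpoly_ring A)" "b = I +>\<^bsub>mpoly_ring A\<^esub> q" using surj[OF b] by blast
    have "a \<otimes>\<^bsub>mpoly_ring A Quot I\<^esub> b = I +>\<^bsub>mpoly_ring A\<^esub> (p * q)"
      using H.hom_mult[OF p(1) q(1)] p(2) q(2) by simp
    then have "p * q \<in> P"
      using ab mem[of "p * q"] carrier_mpoly_ring_closed(7)[OF p(1) q(1)] by simp
    then have "p \<in> P \<or> q \<in> P"
      using primeideal.I_prime[OF P(1) p(1) q(1)] by simp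
    then show "a \<in> (+>\<^bsub>mpoly_ring A\<^esub>) I ` P \<or> b \<in> (+>\<^bsub>mpoly_ring A\<^esub>) I ` P"
      unfolding p(2) q(2) by blast
  qed
qed

text \<open>Primes of the quotient correspond to primes above \<open>I\<close>: images of the
  \<open>P i\<close> give the lower bound, preimages of an arbitrary chain the upper one.\<close>

lemma krull_dim_quot_eq:
  fixes P :: "nat \<Rightarrow> ('x, 'k::comm_ring_1) mpoly set"
  assumes I: "ideal I (mpoly_ring A)"
    and P: "\<And>i. i \<le> r \<Longrightarrow> primeideal (P i) (mpoly_ring A)" "I \<subseteq> P 0" "\<And>i. i < r \<Longrightarrow> P i \<subset> P (Suc i)"
    and bound: "\<And>n Q. (\<And>i. i \<le> n \<Longrightarrow> primeideal (Q i) (mpoly_ring A)) \<Longrightarrow> I \<subseteq> Q 0 \<Longrightarrow>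
      (\<And>i. i < n \<Longrightarrow> Q i \<subset> Q (Suc i)) \<Longrightarrow> n \<le> r"
  shows "krull_dim (mpoly_ring A Quot I) = enat r"
proof -
  let ?h = "(+>\<^bsub>mpoly_ring A\<^esub>) I"
  interpret I: ideal I "mpoly_ring A" by fact
  interpret H: ring_hom_ring "mpoly_ring A" "mpoly_ring A Quot I" "?h"
    by (rule I.rcos_ring_hom_ring)
  have IP: "I \<subseteq> P i" if "i \<le> r" for i
    using that
  proof (induction i)
    case (Suc i)
    then show ?case using P(3)[of i] by auto
  qed (rule P(2))
  have Pi: "ideal (P i) (mpoly_ring A)" if "i \<le> r" for i
    using P(1)[OF that] by (simp add: primeideal_def)
  have lower: "(\<forall>i\<le>r. primeideal (?h ` P i) (mpoly_ring A Quot I)) \<and> (\<forall>i<r. ?h ` P i \<subset> ?h ` P (Suc i))"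
  proof (intro conjI allI impI)
    fix i assume "i \<le> r"
    then show "primeideal (?h ` P i) (mpoly_ring A Quot I)"
      by (intro primeideal_quot_image I P(1) IP)
  next
    fix i assume i: "i < r"
    then obtain p where p: "p \<in> P (Suc i)" "p \<notin> P i" using P(3)[OF i] by blast
    have "p \<in> carrier (mpoly_ring A)"
      using ideal_mpoly_ring_closed(1)[OF Pi[of "Suc i"]] i p(1) by auto
    moreover have "i \<le> r" using i by simp
    ultimately have "?h p \<notin> ?h ` P i"
      using coset_mem_image_iff[OF I Pi IP] p(2) by blast
    then show "?h ` P i \<subset> ?h ` P (Suc i)"
      using P(3)[OF i] p(1) by blast
  qed
  have upper: "n \<le> r" if Q: "\<forall>i\<le>n. primeideal (Q i) (mpoly_ring A Quot I)" "\<forall>i<n. Q i \<subset> Q (Suc i)" for n Q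
  proof (rule bound)
    let ?Q = "\<lambda>i. {p \<in> carrier (mpoly_ring A). ?h p \<in> Q i}"
    show "primeideal (?Q i) (mpoly_ring A)" if "i \<le> n" for i
      using Q(1) that by (intro H.primeideal_vimage mpoly_ring_cring) auto
    have Q0: "ideal (Q 0) (mpoly_ring A Quot I)"
      using Q(1) by (simp add: primeideal_def)
    show "I \<subseteq> ?Q 0"
    proof
      fix p assume p: "p \<in> I"
      then have pc: "p \<in> carrier (mpoly_ring A)" using I.a_subset by blast
      have "?h p = \<zero>\<^bsub>mpoly_ring A Quot I\<^esub>"
        using I.a_rcos_const[OF p] by (simp add: FactRing_def)
      then have "?h p \<in> Q 0"
        using additive_subgroup.zero_closed[OF ideal.axioms(1)[OF Q0]] by simp
      with pc show "p \<in> ?Q 0" by simp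
    qed
    show "?Q i \<subset> ?Q (Suc i)" if "i < n" for i
    proof -
      have lt: "Q i \<subset> Q (Suc i)" using Q(2) that by blast
      then obtain a where a: "a \<in> Q (Suc i)" "a \<notin> Q i" by blast
      have "ideal (Q (Suc i)) (mpoly_ring A Quot I)"
        using Q(1) that by (simp add: primeideal_def)
      then have "a \<in> carrier (mpoly_ring A Quot I)"
        using ideal.axioms(1) additive_subgroup.a_Hcarr a(1) by metis
      then obtain p where "p \<in> carrier (mpoly_ring A)" "a = ?h p"
        by (auto simp: FactRing_def A_RCOSETS_def')
      then show ?thesis using a lt by blast
    qed
  qed
  have "krull_dim (mpoly_ring A Quot I) =
      Sup {enat n | n. \<exists>P. (\<forall>i\<le>n. primeideal (P i) (mpoly_ring A Quot I)) \<and> (\<forall>i<n. P i \<subset> P (Suc i))}"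
    by (simp only: krull_dim_def)
  also have "\<dots> = enat r"
  proof (rule Sup_eqI)
    fix y assume "y \<in> {enat n | n. \<exists>P. (\<forall>i\<le>n. primeideal (P i) (mpoly_ring A Quot I)) \<and> (\<forall>i<n. P i \<subset> P (Suc i))}"
    then obtain n Q where "y = enat n" "\<forall>i\<le>n. primeideal (Q i) (mpoly_ring A Quot I)" "\<forall>i<n. Q i \<subset> Q (Suc i)"
      by blast
    then show "y \<le> enat r" using upper[of n Q] by simp
  next
    fix y assume y: "\<And>z. z \<in> {enat n | n. \<exists>P. (\<forall>i\<le>n. primeideal (P i) (mpoly_ring A Quot I)) \<and> (\<forall>i<n. P i \<subset> P (Suc i))} \<Longrightarrow> z \<le> y"
    show "enat r \<le> y"
      by (rule y, rule CollectI, rule exI[of _ r], rule conjI[OF refl],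
          rule exI[of _ "\<lambda>i. ?h ` P i"], rule lower)
  qed
  finally show ?thesis .
qed

section \<open>Krull dimension: the lower bound\<close>

lemma mono_map_comp: "mono_map (\<lambda>m. g (N m)) p = mono_map g (mono_map N p)"
  unfolding mono_map_def[of N p] mono_map_sum mono_map_single by (simp add: mono_map_def)

section \<open>Rational functionals dual to an independent set of variables\<close>

lemma additive_weight_sum: "additive_weight N \<Longrightarrow> N (sum f M) = (\<Sum>i\<in>M. N (f i))"
  by (induction M rule: infinite_finite_induct) (auto simp: additive_weight_def)

lemma lookup_additive_weight_single:
  fixes N :: "'x monom \<Rightarrow> 'v monom"
  assumes "additive_weight N"
  shows "lookup (N (Poly_Mapping.single x n)) v = n * lookup (N (Poly_Mapping.single x 1)) v"
proof (induction n)
  case (Suc n)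
  have "Poly_Mapping.single x (Suc n) = Poly_Mapping.single x 1 + Poly_Mapping.single x n"
    by (simp flip: single_add)
  then have "lookup (N (Poly_Mapping.single x (Suc n))) v =
      lookup (N (Poly_Mapping.single x 1)) v + lookup (N (Poly_Mapping.single x n)) v"
    using assms by (simp add: additive_weight_def lookup_add)
  then show ?case using Suc by simp
qed (use assms in \<open>simp add: additive_weight_def\<close>)

lemma common_denominator:
  fixes c :: "'x \<Rightarrow> rat"
  assumes "finite B"
  shows "\<exists>d k. d > 0 \<and> (\<forall>x\<in>B. of_int d * c x = of_int (k x))"
  using assms
proof (induction B rule: finite_induct)
  case empty
  show ?case by (intro exI[of _ 1]) simp
next
  case (insert x B)
  then obtain d k where dk: "d > 0" "\<And>y. y \<in> B \<Longrightarrow> of_int d * c y = of_int (k y)" by blast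
  obtain a b where ab: "quotient_of (c x) = (a, b)" by fastforce
  then have b: "b > 0" "c x = of_int a / of_int b"
    using quotient_of_denom_pos quotient_of_div by blast+
  have "of_int (d * b) * c y = of_int (if y = x then d * a else b * k y)" if "y \<in> insert x B" for y
    using that dk(2)[of y] b insert.hyps(2) by (auto simp: mult_ac)
  then show ?case
    using dk(1) b(1) by (intro exI[of _ "d * b"] exI[of _ "\<lambda>y. if y = x then d * a else b * k y"]) simp
qed

text \<open>Clear denominators and move the negative coefficients to the other side: this gives two
  monomials in \<open>B\<close> of equal weight, which coincide by injectivity. An integer with
  equal positive and negative parts is 0.\<close>

lemma weight_rational_independent:
  fixes N :: "'x monom \<Rightarrow> 'v monom" and c :: "'x \<Rightarrow> rat"
  assumes N: "additive_weight N" and "finite B" and inj: "inj_on N (monoms B)"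
    and zero: "\<And>v. (\<Sum>x\<in>B. c x * of_nat (lookup (N (Poly_Mapping.single x 1)) v)) = 0"
    and "x \<in> B"
  shows "c x = 0"
proof -
  obtain d k where dk: "d > 0" "\<And>x. x \<in> B \<Longrightarrow> of_int d * c x = of_int (k x)"
    using common_denominator[OF \<open>finite B\<close>, of c] by blast
  \<comment> \<open>As \<open>nat\<close> cuts negative values to 0, \<open>mon k\<close> and
    \<open>mon (\<lambda>x. - k x)\<close> carry the positive and the negative part of
    \<open>k\<close>.\<close>
  define mon where "mon f = (\<Sum>x\<in>B. Poly_Mapping.single x (nat (f x)))" for f :: "'x \<Rightarrow> int"
  have lookup_mon: "lookup (mon f) y = nat (f y)" if "y \<in> B" for f y
    using that \<open>finite B\<close> by (simp add: mon_def lookup_sum lookup_single when_def)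
  have mon_in: "mon f \<in> monoms B" for f
    using \<open>finite B\<close> by (auto simp: monoms_def in_keys_iff mon_def lookup_sum lookup_single when_def split: if_splits)
  have lookup_N: "int (lookup (N (mon f)) v) = (\<Sum>x\<in>B. int (nat (f x)) * int (lookup (N (Poly_Mapping.single x 1)) v))" for f v
    unfolding mon_def additive_weight_sum[OF N] lookup_sum
    by (subst lookup_additive_weight_single[OF N]) simp
  have "N (mon k) = N (mon (\<lambda>x. - k x))"
  proof (rule poly_mapping_eqI)
    fix v
    have "int (lookup (N (mon k)) v) - int (lookup (N (mon (\<lambda>x. - k x))) v) =
        (\<Sum>x\<in>B. k x * int (lookup (N (Poly_Mapping.single x 1)) v))"
      unfolding lookup_N sum_subtractf[symmetric] left_diff_distrib[symmetric]
      by (intro sum.cong) auto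
    also have "of_int \<dots> = of_int d * (\<Sum>x\<in>B. c x * of_nat (lookup (N (Poly_Mapping.single x 1)) v))"
      using dk(2) by (simp add: sum_distrib_left mult.assoc[symmetric])
    finally have "of_int (int (lookup (N (mon k)) v) - int (lookup (N (mon (\<lambda>x. - k x))) v)) = (0 :: rat)"
      using zero by simp
    then show "lookup (N (mon k)) v = lookup (N (mon (\<lambda>x. - k x))) v"
      by simp
  qed
  then have "mon k = mon (\<lambda>x. - k x)"
    using inj mon_in by (simp add: inj_on_def)
  then have "nat (k x) = nat (- k x)"
    using lookup_mon[OF \<open>x \<in> B\<close>] by metis
  then have "of_int d * c x = 0"
    using dk(2)[OF \<open>x \<in> B\<close>] by simp
  then show ?thesis using dk(1) by simp
qed

text \<open>The weights of the variables in \<open>B\<close> are linearly independent over the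
  rationals, so a dual family of functionals extends to the whole space.\<close>

lemma dual_functionals:
  fixes N :: "'x monom \<Rightarrow> 'v monom"
  assumes N: "additive_weight N" and "finite B" and inj: "inj_on N (monoms B)"
  obtains L :: "'x \<Rightarrow> 'v monom \<Rightarrow> rat" where
    "\<And>x. additive_weight (L x)"
    "\<And>x y. x \<in> B \<Longrightarrow> y \<in> B \<Longrightarrow> L x (N (Poly_Mapping.single y 1)) = (if x = y then 1 else 0)"
proof -
  define scale :: "rat \<Rightarrow> ('v \<Rightarrow>\<^sub>0 rat) \<Rightarrow> ('v \<Rightarrow>\<^sub>0 rat)"
    where "scale c p = Poly_Mapping.map ((*) c) p" for c p
  have lookup_scale: "lookup (scale c p) v = c * lookup p v" for c p v
    by (simp add: scale_def Poly_Mapping.map.rep_eq when_def)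
  interpret vector_space scale
    by unfold_locales (auto intro!: poly_mapping_eqI simp: lookup_scale lookup_add algebra_simps)
  interpret rat: vector_space "(*) :: rat \<Rightarrow> rat \<Rightarrow> rat"
    by unfold_locales (auto simp: algebra_simps)
  interpret vector_space_pair scale "(*) :: rat \<Rightarrow> rat \<Rightarrow> rat" ..
  define emb :: "'v monom \<Rightarrow> ('v \<Rightarrow>\<^sub>0 rat)" where "emb m = Poly_Mapping.map of_nat m" for m
  have lookup_emb: "lookup (emb m) v = of_nat (lookup m v)" for m v
    by (simp add: emb_def Poly_Mapping.map.rep_eq when_def)
  define b where "b x = emb (N (Poly_Mapping.single x 1))" for x
  have indep: "c x = 0" if "(\<Sum>x\<in>B. scale (c x) (b x)) = 0" "x \<in> B" for c x
  proof (rule weight_rational_independent[OF N \<open>finite B\<close> inj _ that(2)])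
    fix v
    have "lookup (\<Sum>x\<in>B. scale (c x) (b x)) v = 0"
      using that(1) by simp
    then show "(\<Sum>x\<in>B. c x * of_nat (lookup (N (Poly_Mapping.single x 1)) v)) = 0"
      by (simp add: lookup_sum lookup_scale b_def lookup_emb)
  qed
  \<comment> \<open>\<open>independent\<close> speaks of a set of vectors, so the family
    \<open>b\<close> must first be shown to have no repetitions.\<close>
  have inj_b: "inj_on b B"
  proof (rule inj_onI, rule ccontr)
    fix x y assume xy: "x \<in> B" "y \<in> B" "b x = b y" "x \<noteq> y"
    define c :: "'x \<Rightarrow> rat" where "c z = (if z = x then 1 else if z = y then - 1 else 0)" for z
    have "(\<Sum>z\<in>B. scale (c z) (b z)) = (\<Sum>z\<in>{x, y}. scale (c z) (b z))"
      by (rule sum.mono_neutral_right) (use \<open>finite B\<close> xy in \<open>auto simp: c_def\<close>)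
    also have "\<dots> = 0"
      using xy by (simp add: c_def)
    finally have "c x = 0" using xy(1) by (rule indep)
    then show False by (simp add: c_def)
  qed
  have "independent (b ` B)"
  proof (rule independent_if_scalars_zero)
    fix f w assume "(\<Sum>w\<in>b ` B. scale (f w) w) = 0" "w \<in> b ` B"
    then show "f w = 0"
      using indep[of "\<lambda>x. f (b x)"] by (auto simp: sum.reindex[OF inj_b])
  qed (use \<open>finite B\<close> in simp)
  then have "\<exists>g. Vector_Spaces.linear scale (*) g \<and> (\<forall>w\<in>b ` B. g w = (if w = b x then 1 else 0))" for x
    by (rule linear_independent_extend)
  then obtain g where g: "\<And>x. Vector_Spaces.linear scale (*) (g x)"
    "\<And>x w. w \<in> b ` B \<Longrightarrow> g x w = (if w = b x then 1 else 0)" by metis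
  show thesis
  proof
    show "additive_weight (\<lambda>m. g x (emb m))" for x
    proof -
      interpret g: Vector_Spaces.linear scale "(*)" "g x" by (rule g(1))
      have "emb (m + n) = emb m + emb n" for m n
        by (rule poly_mapping_eqI) (simp add: lookup_add lookup_emb)
      moreover have "emb 0 = 0"
        by (rule poly_mapping_eqI) (simp add: lookup_emb)
      ultimately show ?thesis
        by (simp add: additive_weight_def g.zero g.add)
    qed
    show "g x (emb (N (Poly_Mapping.single y 1))) = (if x = y then 1 else 0)" if "x \<in> B" "y \<in> B" for x y
    proof -
      have "g x (b y) = (if b y = b x then 1 else 0)"
        using that(2) by (intro g(2)) simp
      moreover have "b y = b x \<longleftrightarrow> x = y"
        using inj_on_eq_iff[OF inj_b that(2) that(1)] by auto
      ultimately have "g x (b y) = (if x = y then 1 else 0)" by simp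
      then show ?thesis by (simp only: b_def)
    qed
  qed
qed

text \<open>The primes are the kernels of maps to a group algebra over \<open>nat \<Rightarrow>\<^sub>0 rat\<close>, which is an integral
  domain since the group is ordered; the \<open>k\<close>-th map forgets the first \<open>k\<close> coordinates dual to \<open>B\<close>.\<close>

lemma prime_chain_above_kernel_ideal:
  fixes N :: "'x monom \<Rightarrow> 'v monom"
  assumes N: "additive_weight N" and "finite A" "B \<subseteq> A" and inj: "inj_on N (monoms B)"
  obtains P :: "nat \<Rightarrow> ('x, 'k::idom) mpoly set" where
    "\<And>i. primeideal (P i) (mpoly_ring A)" "kernel_ideal A N \<subseteq> P 0" "\<And>i. i < card B \<Longrightarrow> P i \<subset> P (Suc i)"
proof -
  have "finite B" using assms(2,3) finite_subset by blast
  obtain L :: "'x \<Rightarrow> 'v monom \<Rightarrow> rat" where L: "\<And>x. additive_weight (L x)"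
    "\<And>x y. x \<in> B \<Longrightarrow> y \<in> B \<Longrightarrow> L x (N (Poly_Mapping.single y 1)) = (if x = y then 1 else 0)"
    using dual_functionals[OF N \<open>finite B\<close> inj] by blast
  obtain e where e: "bij_betw e {0..<card B} B"
    using ex_bij_betw_nat_finite[OF \<open>finite B\<close>] by blast
  define h :: "nat \<Rightarrow> 'v monom \<Rightarrow> (nat \<Rightarrow>\<^sub>0 rat)"
    where "h k w = (\<Sum>i\<in>{k..<card B}. Poly_Mapping.single i (L (e i) w))" for k w
  have h: "additive_weight (\<lambda>m. h k (N m))" for k
    using N L(1) by (simp add: additive_weight_def h_def single_add sum.distrib)
  define P :: "nat \<Rightarrow> ('x, 'k) mpoly set" where "P k = kernel_ideal A (\<lambda>m. h k (N m))" for k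
  show thesis
  proof
    show "primeideal (P k) (mpoly_ring A)" for k
      unfolding P_def by (rule primeideal_kernel_ideal[OF h])
    show "kernel_ideal A N \<subseteq> P 0"
      unfolding P_def kernel_ideal_def by (auto simp: mono_map_comp)
    fix k assume k: "k < card B"
    \<comment> \<open>\<open>h (Suc k)\<close> factors through \<open>h k\<close> by dropping
      coordinate \<open>k\<close>, so the kernels increase.\<close>
    define drop where "drop q = q - Poly_Mapping.single k (lookup q k)" for q :: "nat \<Rightarrow>\<^sub>0 rat"
    have h_Suc: "h k w = Poly_Mapping.single k (L (e k) w) + h (Suc k) w" for w
      unfolding h_def using k by (rule sum.atLeast_Suc_lessThan)
    have "lookup (h (Suc k) w) k = 0" for w
      by (simp add: h_def lookup_sum lookup_single when_def)
    then have "drop (h k w) = h (Suc k) w" for w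
      by (simp add: drop_def h_Suc lookup_add)
    then have "mono_map (\<lambda>m. h (Suc k) (N m)) p = mono_map drop (mono_map (\<lambda>m. h k (N m)) p)"
      for p :: "('x, 'k) mpoly"
      using mono_map_comp[of drop "\<lambda>m. h k (N m)" p] by simp
    then have sub: "P k \<subseteq> P (Suc k)"
      unfolding P_def kernel_ideal_def by auto
    \<comment> \<open>This witnesses strictness: the variable \<open>e k\<close> goes to the unit
      vector at \<open>k\<close> under \<open>h k\<close> and to 0, that is to the monomial 1, under
      \<open>h (Suc k)\<close>.\<close>
    define p :: "('x, 'k) mpoly" where "p = Poly_Mapping.single (Poly_Mapping.single (e k) 1) 1 - 1"
    have ek: "e k \<in> B" "\<And>i. i < card B \<Longrightarrow> e i \<in> B" "\<And>i. i < card B \<Longrightarrow> e i = e k \<longleftrightarrow> i = k"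
      using e k by (auto simp: bij_betw_def inj_on_def)
    have pc: "p \<in> carrier (mpoly_ring A)"
      unfolding p_def using ek(1) \<open>B \<subseteq> A\<close>
      by (intro carrier_mpoly_ring_closed) (auto simp: carrier_mpoly_ring single_in_monoms)
    have val: "L (e i) (N (Poly_Mapping.single (e k) 1)) = (if i = k then 1 else 0)" if "i < card B" for i
      using L(2)[of "e i" "e k"] ek that by simp
    have S: "h (Suc k) (N (Poly_Mapping.single (e k) 1)) = 0"
      unfolding h_def by (rule sum.neutral) (auto simp: val simp del: One_nat_def)
    have map_p: "mono_map (\<lambda>m. h j (N m)) p = Poly_Mapping.single (h j (N (Poly_Mapping.single (e k) 1))) 1 - 1" for j
      by (simp only: p_def mono_map_diff mono_map_one[OF h] mono_map_single)
    have "p \<in> P (Suc k)"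
      using pc by (simp add: P_def kernel_ideal_def map_p S del: One_nat_def)
    moreover have "p \<notin> P k"
    proof
      assume "p \<in> P k"
      then have "mono_map (\<lambda>m. h k (N m)) p = 0"
        by (simp only: P_def kernel_ideal_def mem_Collect_eq)
      moreover have hk: "h k (N (Poly_Mapping.single (e k) 1)) = Poly_Mapping.single k 1"
        unfolding h_Suc S val[OF k] by simp
      ultimately have "Poly_Mapping.single (Poly_Mapping.single k 1) 1 = (1 :: (nat \<Rightarrow>\<^sub>0 rat) \<Rightarrow>\<^sub>0 'k)"
        unfolding map_p hk by (simp only: right_minus_eq)
      then have "lookup (1 :: (nat \<Rightarrow>\<^sub>0 rat) \<Rightarrow>\<^sub>0 'k) (Poly_Mapping.single k 1) = 1"
        by (metis lookup_single_eq)
      moreover have "Poly_Mapping.single k (1 :: rat) \<noteq> 0"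
        by (metis lookup_single_eq lookup_zero zero_neq_one)
      ultimately show False
        by (simp add: lookup_one)
    qed
    ultimately show "P k \<subset> P (Suc k)"
      using sub by blast
  qed
qed

section \<open>Toric ideals of graphs\<close>

text \<open>The exponent vector of the image of \<open>m\<close> under the toric map, that is, the
  vertex degrees of the multigraph \<open>m\<close>.\<close>

definition edge_weight :: "'v set monom \<Rightarrow> 'v monom"
  where "edge_weight m = (\<Sum>e\<in>keys m. \<Sum>v\<in>e. Poly_Mapping.single v (lookup m e))"

lemma edge_weight_superset:
  assumes "finite X" "keys m \<subseteq> X"
  shows "edge_weight m = (\<Sum>e\<in>X. \<Sum>v\<in>e. Poly_Mapping.single v (lookup m e))"
  unfolding edge_weight_def
  by (rule sum.mono_neutral_left) (use assms in \<open>auto simp: in_keys_iff\<close>)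

lemma additive_edge_weight: "additive_weight (edge_weight :: 'v set monom \<Rightarrow> 'v monom)"
proof -
  have "edge_weight (m + n) = edge_weight m + edge_weight n" for m n :: "'v set monom"
  proof -
    have "keys (m + n) \<subseteq> keys m \<union> keys n"
      by (rule Poly_Mapping.keys_add)
    then show ?thesis
      by (simp add: edge_weight_superset[of "keys m \<union> keys n"] lookup_add single_add sum.distrib)
  qed
  moreover have "edge_weight (0 :: 'v set monom) = 0"
    by (simp add: edge_weight_def)
  ultimately show ?thesis
    by (simp add: additive_weight_def)
qed

lemma edge_weight_single: "edge_weight (Poly_Mapping.single e n) = (\<Sum>v\<in>e. Poly_Mapping.single v n)"
  by (simp add: edge_weight_superset[of "{e}"])

lemma prod_single_one:
  "(\<Prod>x\<in>X. Poly_Mapping.single (f x) 1) = (Poly_Mapping.single (\<Sum>x\<in>X. f x) 1 :: ('v, 'k::comm_ring_1) mpoly)"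
  by (induction X rule: infinite_finite_induct) (auto simp: mult_single)

lemma mpoly_subst_edges:
  "mpoly_subst (\<lambda>e. \<Prod>v\<in>e. Var v) p = mono_map edge_weight p" for p :: "('v set, 'k::comm_ring_1) mpoly"
proof -
  have edge: "(\<Prod>v\<in>e. Var v) ^ n = (Poly_Mapping.single (\<Sum>v\<in>e. Poly_Mapping.single v n) 1 :: ('v, 'k) mpoly)" for e n
  proof (induction n)
    case (Suc n)
    have "(\<Sum>v\<in>e. Poly_Mapping.single v (Suc n)) =
        (\<Sum>v\<in>e. Poly_Mapping.single v 1) + (\<Sum>v\<in>e. Poly_Mapping.single v n)"
      by (simp flip: single_add sum.distrib)
    then show ?case
      unfolding power_Suc Suc by (simp add: Var_def prod_single_one mult_single)
  qed simp
  show ?thesis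
    unfolding mpoly_subst_def mono_map_def edge prod_single_one edge_weight_def
    by (simp add: Const_def mult_single)
qed

lemma toric_ideal_eq: "toric_ideal V E = kernel_ideal E edge_weight"
  unfolding toric_ideal_def a_kernel_def kernel_def kernel_ideal_def
  by (simp add: mpoly_subst_edges)

lemma mdeg_sum: "mdeg (sum f X) = (\<Sum>x\<in>X. mdeg (f x))"
  by (induction X rule: infinite_finite_induct) (auto simp: mdeg_add)

lemma mdeg_edge_weight:
  assumes "\<And>e. e \<in> E \<Longrightarrow> card e = 2" "m \<in> monoms E"
  shows "mdeg (edge_weight m) = 2 * mdeg m"
proof -
  have "mdeg (edge_weight m) = (\<Sum>e\<in>keys m. card e * lookup m e)"
    by (simp add: edge_weight_def mdeg_sum)
  also have "\<dots> = (\<Sum>e\<in>keys m. 2 * lookup m e)"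
    using assms by (intro sum.cong) (auto simp: monoms_def)
  finally show ?thesis by (simp add: mdeg_def sum_distrib_left)
qed

text \<open>Every edge has two ends, so the weight has twice the degree of the monomial. This
  provides the grading hypothesis for standard monomials.\<close>

lemma edge_weight_graded:
  assumes "\<And>e. e \<in> E \<Longrightarrow> card e = 2" "m \<in> monoms E" "n \<in> monoms E" "edge_weight m = edge_weight n"
  shows "mdeg m = mdeg n"
  using mdeg_edge_weight[OF assms(1,2)] mdeg_edge_weight[OF assms(1,3)] assms(4) by simp

lemma finite_edges: "simple_graph V E \<Longrightarrow> finite E"
  unfolding simple_graph_def using finite_subset[of E "Pow V"] by auto

lemma quot_dim_toric_ideal:
  assumes "finite E" "B \<subseteq> E" "inj_on edge_weight (monoms B)"
    and h: "fps_of_poly h = hilbert_series E (toric_ideal V E :: ('v set, 'k::field) mpoly set) * (1 - fps_X) ^ card B"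
  shows "quot_dim E (toric_ideal V E :: ('v set, 'k) mpoly set) = card B"
proof -
  obtain P :: "nat \<Rightarrow> ('v set, 'k) mpoly set" where P: "\<And>i. primeideal (P i) (mpoly_ring E)"
      "kernel_ideal E edge_weight \<subseteq> P 0" "\<And>i. i < card B \<Longrightarrow> P i \<subset> P (Suc i)"
    using prime_chain_above_kernel_ideal[OF additive_edge_weight assms(1-3)] by metis
  have "krull_dim (mpoly_ring E Quot (kernel_ideal E edge_weight :: ('v set, 'k) mpoly set)) = enat (card B)"
  proof (rule krull_dim_quot_eq[OF ideal_kernel_ideal[OF additive_edge_weight]])
    show "primeideal (P i) (mpoly_ring E)" for i by (rule P(1))
    show "kernel_ideal E edge_weight \<subseteq> P 0" by (rule P(2))
    show "P i \<subset> P (Suc i)" if "i < card B" for i using that by (rule P(3))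
  qed (rule prime_chain_length_le[OF additive_edge_weight \<open>finite E\<close> h[unfolded toric_ideal_eq]])
  then show ?thesis
    by (simp add: quot_dim_def toric_ideal_eq)
qed

text \<open>Once \<open>card B\<close> is known to be the dimension, injectivity of
  \<open>fps_of_poly\<close> identifies \<open>h\<close> with \<open>h_poly\<close>.\<close>

lemma toric_invariants:
  assumes "finite E" "B \<subseteq> E" "inj_on edge_weight (monoms B)"
    and h: "fps_of_poly h = hilbert_series E (toric_ideal V E :: ('v set, 'k::field) mpoly set) * (1 - fps_X) ^ card B"
  shows "a_invariant E (toric_ideal V E :: ('v set, 'k) mpoly set) = int (Polynomial.degree h) - int (card B)"
    "hilbert_multiplicity E (toric_ideal V E :: ('v set, 'k) mpoly set) = poly h 1"
proof -
  note dim = quot_dim_toric_ideal[OF assms]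
  have "h_poly E (toric_ideal V E :: ('v set, 'k) mpoly set) = h"
    unfolding h_poly_def dim h[symmetric] by simp
  then show "a_invariant E (toric_ideal V E :: ('v set, 'k) mpoly set) = int (Polynomial.degree h) - int (card B)"
    "hilbert_multiplicity E (toric_ideal V E :: ('v set, 'k) mpoly set) = poly h 1"
    by (simp_all add: a_invariant_def hilbert_multiplicity_def dim)
qed

section \<open>Gluing a path\<close>

text \<open>The cycle is traversed from one end of \<open>f\<close> to the other without
  \<open>f\<close> itself, which falls on the edge \<open>e\<close> already present.\<close>

lemma edge_gluing_path:
  assumes glue: "cycle_gluing V E e n W F" and n: "n \<ge> 2" and e: "e \<in> E" "e \<subseteq> V"
  obtains i :: "'v \<Rightarrow> 'w" and w :: "nat \<Rightarrow> 'w" and a b where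
    "inj_on i V" "e = {a, b}" "a \<noteq> b" "w 0 = i a" "w (n - 1) = i b" "inj_on w {..<n}"
    "\<And>k. 0 < k \<Longrightarrow> k < n - 1 \<Longrightarrow> w k \<notin> i ` V"
    "F = (`) i ` E \<union> (\<lambda>k. {w k, w (Suc k)}) ` {..<n - 1}"
proof -
  obtain f where f: "f \<in> cycle_edges n" and "edge_gluing V E e (cycle_verts n) (cycle_edges n) f W F"
    using glue unfolding cycle_gluing_def by blast
  then obtain i :: "'v \<Rightarrow> 'w" and j :: "nat \<Rightarrow> 'w" and a b c d where
    ij: "e = {a, b}" "a \<noteq> b" "f = {c, d}" "c \<noteq> d" "inj_on i V" "inj_on j {..<n}"
    and meet: "\<And>u z. u \<in> V \<Longrightarrow> z < n \<Longrightarrow> i u = j z \<longleftrightarrow> (u = a \<and> z = c) \<or> (u = b \<and> z = d)"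
    and F: "F = (`) i ` E \<union> (`) j ` cycle_edges n"
    unfolding edge_gluing_def cycle_verts_def by (metis lessThan_iff)
  obtain t where t: "t < n" "f = {t, (t + 1) mod n}"
    using f unfolding cycle_edges_def by blast
  \<comment> \<open>Starting just after \<open>t\<close> and going once around ends at
    \<open>t\<close>, so \<open>f\<close> joins \<open>u (n - 1)\<close> to
    \<open>u 0\<close>.\<close>
  define u where "u k = (t + 1 + k) mod n" for k
  have u_lt: "u k < n" for k using n by (simp add: u_def)
  have u_last: "u (n - 1) = t" using n t(1) by (simp add: u_def)
  have u_0: "u 0 = (t + 1) mod n" by (simp add: u_def)
  have u_Suc: "u (Suc k) = (u k + 1) mod n" for k
    by (simp add: u_def mod_simps)
  have inj_u: "inj_on u {..<n}"
  proof (rule linorder_inj_onI)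
    fix k l assume kl: "k < l" "k \<in> {..<n}" "l \<in> {..<n}"
    show "u k \<noteq> u l"
    proof
      assume "u k = u l"
      then have "n dvd (t + 1 + l) - (t + 1 + k)"
        using mod_eq_dvd_iff_nat[of "t + 1 + k" "t + 1 + l" n] kl(1) by (simp add: u_def)
      then have "n dvd l - k" by simp
      then show False using kl by (auto dest: dvd_imp_le)
    qed
  qed auto
  have surj_u: "u ` {..<n} = {..<n}"
    by (rule endo_inj_surj) (use u_lt inj_u in auto)
  have path: "cycle_edges n = insert f ((\<lambda>k. {u k, u (Suc k)}) ` {..<n - 1})"
  proof (intro equalityI subsetI)
    fix g assume "g \<in> cycle_edges n"
    then obtain s where s: "s < n" "g = {s, (s + 1) mod n}" by (auto simp: cycle_edges_def)
    then have "s \<in> u ` {..<n}" using surj_u by simp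
    then obtain k where k: "k < n" "s = u k" by auto
    have g: "g = {u k, u (Suc k)}" using s k by (simp add: u_Suc)
    show "g \<in> insert f ((\<lambda>k. {u k, u (Suc k)}) ` {..<n - 1})"
    proof (cases "k = n - 1")
      case True
      then show ?thesis using s(2) k(2) u_last t(2) by simp
    next
      case False
      then show ?thesis using k(1) g by auto
    qed
  next
    fix g assume g: "g \<in> insert f ((\<lambda>k. {u k, u (Suc k)}) ` {..<n - 1})"
    then show "g \<in> cycle_edges n"
    proof
      assume "g \<in> (\<lambda>k. {u k, u (Suc k)}) ` {..<n - 1}"
      then obtain k where "g = {u k, (u k + 1) mod n}" by (auto simp: u_Suc)
      then show ?thesis using u_lt[of k] by (auto simp: cycle_edges_def)
    qed (use f in simp)
  qed
  have uends: "u k \<noteq> u 0" "u k \<noteq> u (n - 1)" if "0 < k" "k < n - 1" for k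
    using that inj_on_eq_iff[OF inj_u, of k 0] inj_on_eq_iff[OF inj_u, of k "n - 1"] by simp_all
  have fu: "{c, d} = {u 0, u (n - 1)}"
    using t(2) ij(3) u_0 u_last by auto
  define w where "w k = j (u k)" for k
  have inj_w: "inj_on w {..<n}"
  proof (rule inj_onI)
    fix k l assume kl: "k \<in> {..<n}" "l \<in> {..<n}" "w k = w l"
    then have "u k = u l" using inj_onD[OF ij(6), of "u k" "u l"] u_lt by (simp add: w_def)
    then show "k = l" using inj_onD[OF inj_u] kl by blast
  qed
  have interior: "w k \<notin> i ` V" if "0 < k" "k < n - 1" for k
  proof
    assume "w k \<in> i ` V"
    then obtain x where "x \<in> V" "i x = j (u k)" by (auto simp: w_def)
    then have "u k \<in> {c, d}" using meet[of x "u k"] u_lt by auto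
    then show False using uends[OF that] unfolding fu by simp
  qed
  have jf: "j ` f = {w 0, w (n - 1)}"
    unfolding ij(3) fu by (simp add: w_def)
  have cd: "c < n" "d < n" using fu u_lt by (metis doubleton_eq_iff)+
  have ac: "i a = j c" and bd: "i b = j d"
    using meet[of a c] meet[of b d] e(2) ij(1) cd by auto
  show thesis
  proof -
    have "(`) j ` cycle_edges n = insert (i ` e) ((\<lambda>k. {w k, w (Suc k)}) ` {..<n - 1})"
      unfolding path image_insert image_image ij(1) ij(3) by (simp add: w_def ac bd)
    moreover have "i ` e \<in> (`) i ` E" using e(1) by blast
    ultimately have F': "F = (`) i ` E \<union> (\<lambda>k. {w k, w (Suc k)}) ` {..<n - 1}"
      unfolding F by auto
    \<comment> \<open>The identification may run in either direction; in the second case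
      \<open>a\<close> and \<open>b\<close> change roles.\<close>
    from fu consider "c = u 0" "d = u (n - 1)" | "c = u (n - 1)" "d = u 0"
      by (metis doubleton_eq_iff)
    then show thesis
    proof cases
      case 1
      then show thesis
        using that[of i a b w] ij(1,2,5) inj_w interior F' ac bd by (simp add: w_def)
    next
      case 2
      then show thesis
        using that[of i b a w] ij(1,2,5) inj_w interior F' ac bd by (simp add: w_def insert_commute)
    qed
  qed
qed

locale path_gluing =
  fixes V :: "'v set" and E :: "'v set set" and i :: "'v \<Rightarrow> 'w" and w :: "nat \<Rightarrow> 'w"
    and a b :: 'v and d :: nat and F :: "'w set set"
  assumes graph: "simple_graph V E" and inj_i: "inj_on i V"
    and ab: "{a, b} \<in> E" "a \<noteq> b"
    and ends: "w 0 = i a" "w (2 * d - 1) = i b"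
    and inj_w: "inj_on w {..<2 * d}"
    and interior: "\<And>k. 0 < k \<Longrightarrow> k < 2 * d - 1 \<Longrightarrow> w k \<notin> i ` V"
    and d: "d \<ge> 2"
    and F: "F = (`) i ` E \<union> (\<lambda>k. {w k, w (Suc k)}) ` {..<2 * d - 1}"
begin

definition path_edge :: "nat \<Rightarrow> 'w set"
  where "path_edge k = {w k, w (Suc k)}"

lemma finite_E: "finite E"
  by (rule finite_edges[OF graph])

lemma edge_subset: "e \<in> E \<Longrightarrow> e \<subseteq> V"
  using graph by (simp add: simple_graph_def)

lemma edge_card: "e \<in> E \<Longrightarrow> card e = 2"
  using graph by (simp add: simple_graph_def)

lemma ab_V: "a \<in> V" "b \<in> V"
  using edge_subset[OF ab(1)] by auto

lemma w_eq_iff: "k < 2 * d \<Longrightarrow> l < 2 * d \<Longrightarrow> w k = w l \<longleftrightarrow> k = l"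
  using inj_w by (simp add: inj_on_eq_iff)

lemma i_eq_iff: "u \<in> V \<Longrightarrow> v \<in> V \<Longrightarrow> i u = i v \<longleftrightarrow> u = v"
  using inj_i by (simp add: inj_on_eq_iff)

lemma w_eq_i_iff:
  assumes "k < 2 * d" "v \<in> V"
  shows "w k = i v \<longleftrightarrow> (k = 0 \<and> v = a) \<or> (k = 2 * d - 1 \<and> v = b)"
proof -
  consider "k = 0" | "k = 2 * d - 1" | "0 < k" "k < 2 * d - 1"
    using assms(1) by linarith
  then show ?thesis
  proof cases
    case 1
    then show ?thesis using ends(1) i_eq_iff[OF ab_V(1) assms(2)] d by auto
  next
    case 2
    then show ?thesis using ends(2) i_eq_iff[OF ab_V(2) assms(2)] d by auto
  next
    case 3
    then show ?thesis using interior[OF 3] assms(2) by auto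
  qed
qed

lemma inj_image_E: "inj_on ((`) i) E"
  by (rule inj_on_subset[OF inj_on_image_Pow[OF inj_i]]) (use edge_subset in auto)

lemma inj_path_edge: "inj_on path_edge {..<2 * d - 1}"
proof (rule linorder_inj_onI)
  fix k l assume kl: "k < l" "k \<in> {..<2 * d - 1}" "l \<in> {..<2 * d - 1}"
  then have "w k \<noteq> w l" "w k \<noteq> w (Suc l)" by (simp_all add: w_eq_iff)
  then show "path_edge k \<noteq> path_edge l" by (auto simp: path_edge_def)
qed auto

text \<open>As \<open>d \<ge> 2\<close>, every path edge has an interior end, which is not a vertex
  of \<open>G\<close>.\<close>

lemma path_edge_notin: "k < 2 * d - 1 \<Longrightarrow> path_edge k \<notin> (`) i ` E"
proof
  assume k: "k < 2 * d - 1" and "path_edge k \<in> (`) i ` E"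
  then obtain g where "g \<in> E" "path_edge k = i ` g" by blast
  then have "path_edge k \<subseteq> i ` V"
    using edge_subset by blast
  then have "w k \<in> i ` V" "w (Suc k) \<in> i ` V"
    by (auto simp: path_edge_def)
  moreover have "Suc 0 < 2 * d - 1" using d by linarith
  ultimately show False
    using interior[of k] interior[of "Suc k"] k by (cases "k = 0") auto
qed

lemma F_eq: "F = (`) i ` E \<union> path_edge ` {..<2 * d - 1}"
  by (simp add: F path_edge_def)

lemma finite_F: "finite F"
  using finite_E by (simp add: F_eq)

lemma F_card: "e \<in> F \<Longrightarrow> card e = 2"
proof -
  assume "e \<in> F"
  then consider g where "g \<in> E" "e = i ` g" | k where "k < 2 * d - 1" "e = path_edge k"
    by (auto simp: F_eq)
  then show ?thesis
  proof cases
    case 1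
    then show ?thesis
      using edge_card card_image[OF inj_on_subset[OF inj_i edge_subset]] by simp
  next
    case 2
    then show ?thesis using w_eq_iff[of k "Suc k"] by (simp add: path_edge_def)
  qed
qed

text \<open>Codes monomials of \<open>H\<close> by pairs: \<open>m\<close> on the edges of
  \<open>G\<close>, and \<open>c\<close> on the positions along the path.\<close>

definition glue :: "'v set monom \<Rightarrow> nat monom \<Rightarrow> 'w set monom"
  where "glue m c = (\<Sum>e\<in>E. Poly_Mapping.single (i ` e) (lookup m e)) +
    (\<Sum>k<2 * d - 1. Poly_Mapping.single (path_edge k) (lookup c k))"

lemma glue_add: "glue (m + m') (c + c') = glue m c + glue m' c'"
  by (simp add: glue_def lookup_add single_add sum.distrib algebra_simps)

lemma lookup_glue_image:
  assumes "e \<in> E"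
  shows "lookup (glue m c) (i ` e) = lookup m e"
proof -
  have "lookup (\<Sum>g\<in>E. Poly_Mapping.single (i ` g) (lookup m g)) (i ` e) =
      (\<Sum>g\<in>E. if g = e then lookup m e else 0)"
    unfolding lookup_sum
    using assms inj_on_eq_iff[OF inj_image_E] by (intro sum.cong) (auto simp: lookup_single when_def)
  moreover have "lookup (\<Sum>k<2 * d - 1. Poly_Mapping.single (path_edge k) (lookup c k)) (i ` e) = 0"
    unfolding lookup_sum
    using path_edge_notin assms by (intro sum.neutral) (auto simp: lookup_single when_def)
  ultimately show ?thesis
    using assms finite_E by (simp add: glue_def lookup_add)
qed

lemma lookup_glue_path:
  assumes "k < 2 * d - 1"
  shows "lookup (glue m c) (path_edge k) = lookup c k"
proof -
  have "lookup (\<Sum>g\<in>E. Poly_Mapping.single (i ` g) (lookup m g)) (path_edge k) = 0"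
    unfolding lookup_sum
    using path_edge_notin[OF assms] by (intro sum.neutral) (auto simp: lookup_single when_def)
  moreover have "lookup (\<Sum>l<2 * d - 1. Poly_Mapping.single (path_edge l) (lookup c l)) (path_edge k) =
      (\<Sum>l<2 * d - 1. if l = k then lookup c k else 0)"
    unfolding lookup_sum
    using assms inj_on_eq_iff[OF inj_path_edge] by (intro sum.cong) (auto simp: lookup_single when_def)
  ultimately show ?thesis
    using assms by (simp add: glue_def lookup_add)
qed

lemma monoms_sum: "(\<And>x. x \<in> X \<Longrightarrow> f x \<in> monoms B) \<Longrightarrow> sum f X \<in> monoms B"
  by (induction X rule: infinite_finite_induct) (auto intro: monoms_add)

lemma glue_in_monoms: "glue m c \<in> monoms F"
  unfolding glue_def
  by (intro monoms_add monoms_sum single_in_monoms) (auto simp: F_eq)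

lemma glue_surj:
  assumes "n \<in> monoms F"
  obtains m c where "m \<in> monoms E" "c \<in> monoms {..<2 * d - 1}" "n = glue m c"
    "\<And>e. e \<in> E \<Longrightarrow> lookup m e = lookup n (i ` e)"
    "\<And>k. k < 2 * d - 1 \<Longrightarrow> lookup c k = lookup n (path_edge k)"
proof -
  define m where "m = (\<Sum>e\<in>E. Poly_Mapping.single e (lookup n (i ` e)))"
  define c where "c = (\<Sum>k<2 * d - 1. Poly_Mapping.single k (lookup n (path_edge k)))"
  have m: "lookup m e = lookup n (i ` e)" if "e \<in> E" for e
    using that finite_E by (simp add: m_def lookup_sum lookup_single when_def)
  have c: "lookup c k = lookup n (path_edge k)" if "k < 2 * d - 1" for k
    using that by (simp add: c_def lookup_sum lookup_single when_def)
  have "n = glue m c"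
  proof (rule poly_mapping_eqI)
    fix e
    show "lookup n e = lookup (glue m c) e"
    proof (cases "e \<in> F")
      case True
      then show ?thesis
        using m c by (auto simp: F_eq lookup_glue_image lookup_glue_path)
    next
      case False
      then have "e \<notin> keys n" "e \<notin> keys (glue m c)"
        using assms glue_in_monoms by (auto simp: monoms_def)
      then show ?thesis by (simp add: in_keys_iff)
    qed
  qed
  moreover have "m \<in> monoms E"
    unfolding m_def by (intro monoms_sum single_in_monoms)
  moreover have "c \<in> monoms {..<2 * d - 1}"
    unfolding c_def by (intro monoms_sum single_in_monoms)
  ultimately show thesis using m c that by blast
qed

lemma mdeg_glue:
  assumes "m \<in> monoms E" "c \<in> monoms {..<2 * d - 1}"
  shows "mdeg (glue m c) = mdeg m + mdeg c"
  using assms finite_E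
  by (simp add: glue_def mdeg_add mdeg_sum monoms_def mdeg_superset[of E m] mdeg_superset[of "{..<2 * d - 1}" c])

lemma edge_weight_glue:
  "edge_weight (glue m c) = (\<Sum>e\<in>E. \<Sum>v\<in>e. Poly_Mapping.single (i v) (lookup m e)) +
    (\<Sum>k<2 * d - 1. Poly_Mapping.single (w k) (lookup c k) + Poly_Mapping.single (w (Suc k)) (lookup c k))"
proof -
  have "edge_weight (Poly_Mapping.single (i ` e) n) = (\<Sum>v\<in>e. Poly_Mapping.single (i v) n)" if "e \<in> E" for e n
    using inj_on_subset[OF inj_i edge_subset[OF that]] by (simp add: edge_weight_single sum.reindex)
  moreover have "edge_weight (Poly_Mapping.single (path_edge k) n) =
      Poly_Mapping.single (w k) n + Poly_Mapping.single (w (Suc k)) n" if "k < 2 * d - 1" for k n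
    using that w_eq_iff[of k "Suc k"] by (simp add: path_edge_def edge_weight_single)
  ultimately show ?thesis
    by (simp add: glue_def additive_weight_add[OF additive_edge_weight] additive_weight_sum[OF additive_edge_weight])
qed

section \<open>Weights of glued monomials, vertex by vertex\<close>

lemma lookup_edge_weight:
  assumes "m \<in> monoms E"
  shows "lookup (edge_weight m) v = (\<Sum>e\<in>E. if v \<in> e then lookup m e else 0)"
proof -
  have fin: "finite e" if "e \<in> E" for e
    using edge_card[OF that] by (intro card_ge_0_finite) simp
  have "lookup (edge_weight m) v = (\<Sum>e\<in>E. \<Sum>u\<in>e. if u = v then lookup m e else 0)"
    using assms finite_E
    by (simp add: edge_weight_superset[of E] monoms_def lookup_sum lookup_single when_def)
  also have "\<dots> = (\<Sum>e\<in>E. if v \<in> e then lookup m e else 0)"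
    using fin by (intro sum.cong) auto
  finally show ?thesis .
qed

lemma lookup_edge_weight_outside:
  assumes "m \<in> monoms E" "v \<notin> V"
  shows "lookup (edge_weight m) v = 0"
  unfolding lookup_edge_weight[OF assms(1)]
  using assms(2) edge_subset by (intro sum.neutral) auto

lemma lookup_image_part:
  assumes "m \<in> monoms E"
  shows "v \<in> V \<Longrightarrow> lookup (\<Sum>e\<in>E. \<Sum>u\<in>e. Poly_Mapping.single (i u) (lookup m e)) (i v) = lookup (edge_weight m) v"
    and "z \<notin> i ` V \<Longrightarrow> lookup (\<Sum>e\<in>E. \<Sum>u\<in>e. Poly_Mapping.single (i u) (lookup m e)) z = 0"
proof -
  have fin: "finite e" if "e \<in> E" for e
    using edge_card[OF that] by (intro card_ge_0_finite) simp
  assume v: "v \<in> V"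
  have "lookup (\<Sum>e\<in>E. \<Sum>u\<in>e. Poly_Mapping.single (i u) (lookup m e)) (i v) =
      (\<Sum>e\<in>E. \<Sum>u\<in>e. if u = v then lookup m e else 0)"
    unfolding lookup_sum
    using edge_subset i_eq_iff[OF _ v] by (intro sum.cong) (auto simp: lookup_single when_def subset_iff)
  also have "\<dots> = (\<Sum>e\<in>E. if v \<in> e then lookup m e else 0)"
    using fin by (intro sum.cong) auto
  finally show "lookup (\<Sum>e\<in>E. \<Sum>u\<in>e. Poly_Mapping.single (i u) (lookup m e)) (i v) = lookup (edge_weight m) v"
    unfolding lookup_edge_weight[OF assms] .
next
  assume z: "z \<notin> i ` V"
  have "lookup (Poly_Mapping.single (i u) (lookup m e)) z = 0" if "e \<in> E" "u \<in> e" for e u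
    using edge_subset[OF that(1)] that(2) z by (auto simp: lookup_single when_def)
  then show "lookup (\<Sum>e\<in>E. \<Sum>u\<in>e. Poly_Mapping.single (i u) (lookup m e)) z = 0"
    by (simp add: lookup_sum)
qed

lemma lookup_path_part:
  "lookup (\<Sum>k<2 * d - 1. Poly_Mapping.single (w k) (lookup c k) + Poly_Mapping.single (w (Suc k)) (lookup c k)) z =
    (\<Sum>k<2 * d - 1. (if w k = z then lookup c k else 0) + (if w (Suc k) = z then lookup c k else 0))"
  by (simp add: lookup_sum lookup_add lookup_single when_def)

text \<open>The path meets \<open>G\<close> only in \<open>a\<close> and \<open>b\<close>, with its
  first edge 0 and its last edge \<open>2 * d - 2\<close>.\<close>

lemma lookup_glue_old:
  assumes "m \<in> monoms E" "v \<in> V"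
  shows "lookup (edge_weight (glue m c)) (i v) = lookup (edge_weight m) v +
    (if v = a then lookup c 0 else 0) + (if v = b then lookup c (2 * d - 2) else 0)"
proof -
  have "(\<Sum>k<2 * d - 1. (if w k = i v then lookup c k else 0) + (if w (Suc k) = i v then lookup c k else 0)) =
      (\<Sum>k<2 * d - 1. (if k = 0 then (if v = a then lookup c 0 else 0) else 0) +
        (if k = 2 * d - 2 then (if v = b then lookup c (2 * d - 2) else 0) else 0))"
  proof (rule sum.cong[OF refl])
    fix k assume "k \<in> {..<2 * d - 1}"
    then have "w k = i v \<longleftrightarrow> k = 0 \<and> v = a" "w (Suc k) = i v \<longleftrightarrow> k = 2 * d - 2 \<and> v = b"
      using w_eq_i_iff[of k v] w_eq_i_iff[of "Suc k" v] assms(2) by auto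
    then show "(if w k = i v then lookup c k else 0) + (if w (Suc k) = i v then lookup c k else 0) =
        (if k = 0 then (if v = a then lookup c 0 else 0) else 0) +
        (if k = 2 * d - 2 then (if v = b then lookup c (2 * d - 2) else 0) else 0)"
      by simp
  qed
  also have "\<dots> = (if v = a then lookup c 0 else 0) + (if v = b then lookup c (2 * d - 2) else 0)"
  proof -
    have "0 < 2 * d - 1" "2 * d - 2 < 2 * d - 1" using d by linarith+
    then show ?thesis unfolding sum.distrib by simp
  qed
  finally show ?thesis
    unfolding edge_weight_glue lookup_add lookup_image_part(1)[OF assms] lookup_path_part by simp
qed

lemma lookup_glue_new:
  assumes "m \<in> monoms E" "0 < k" "k < 2 * d - 1"
  shows "lookup (edge_weight (glue m c)) (w k) = lookup c (k - 1) + lookup c k"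
proof -
  have "(\<Sum>l<2 * d - 1. (if w l = w k then lookup c l else 0) + (if w (Suc l) = w k then lookup c l else 0)) =
      (\<Sum>l<2 * d - 1. (if l = k then lookup c k else 0) + (if l = k - 1 then lookup c (k - 1) else 0))"
  proof (rule sum.cong[OF refl])
    fix l assume "l \<in> {..<2 * d - 1}"
    then have "w l = w k \<longleftrightarrow> l = k" "w (Suc l) = w k \<longleftrightarrow> l = k - 1"
      using w_eq_iff[of l k] w_eq_iff[of "Suc l" k] assms(2,3) by auto
    then show "(if w l = w k then lookup c l else 0) + (if w (Suc l) = w k then lookup c l else 0) =
        (if l = k then lookup c k else 0) + (if l = k - 1 then lookup c (k - 1) else 0)"
      by simp
  qed
  also have "\<dots> = lookup c (k - 1) + lookup c k"
    using assms(2,3) unfolding sum.distrib by simp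
  finally show ?thesis
    unfolding edge_weight_glue lookup_add lookup_image_part(2)[OF assms(1) interior[OF assms(2,3)]] lookup_path_part
    by simp
qed

lemma lookup_glue_none:
  assumes "m \<in> monoms E" "z \<notin> i ` V" "z \<notin> w ` {..<2 * d}"
  shows "lookup (edge_weight (glue m c)) z = 0"
  unfolding edge_weight_glue lookup_add lookup_image_part(2)[OF assms(1,2)] lookup_path_part
  using assms(3) by (auto intro!: sum.neutral)

lemma edge_weight_glue_eqI:
  assumes "m \<in> monoms E" "m' \<in> monoms E"
    and old: "\<And>v. v \<in> V \<Longrightarrow> lookup (edge_weight m) v +
      (if v = a then lookup c 0 else 0) + (if v = b then lookup c (2 * d - 2) else 0) =
      lookup (edge_weight m') v +
      (if v = a then lookup c' 0 else 0) + (if v = b then lookup c' (2 * d - 2) else 0)"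
    and new: "\<And>k. 0 < k \<Longrightarrow> k < 2 * d - 1 \<Longrightarrow> lookup c (k - 1) + lookup c k = lookup c' (k - 1) + lookup c' k"
  shows "edge_weight (glue m c) = edge_weight (glue m' c')"
proof (rule poly_mapping_eqI)
  fix z
  consider v where "v \<in> V" "z = i v" | k where "0 < k" "k < 2 * d - 1" "z = w k"
    | "z \<notin> i ` V" "z \<notin> w ` {..<2 * d}"
  proof (cases "z \<in> i ` V")
    case False
    show thesis
    proof (cases "z \<in> w ` {..<2 * d}")
      case True
      then obtain k where k: "k < 2 * d" "z = w k" by auto
      have "k \<noteq> 0" "k \<noteq> 2 * d - 1"
        using False k(2) ends ab_V by auto
      then show thesis using k that(2)[of k] by simp
    qed (use False that in blast)
  qed (use that in blast)
  then show "lookup (edge_weight (glue m c)) z = lookup (edge_weight (glue m' c')) z"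
  proof cases
    case 1
    then show ?thesis using old assms(1,2) by (simp add: lookup_glue_old)
  next
    case 2
    then show ?thesis using new assms(1,2) by (simp add: lookup_glue_new)
  next
    case 3
    then show ?thesis using assms(1,2) by (simp add: lookup_glue_none)
  qed
qed

text \<open>The path sides of the cycle relation. Positions run from 0 to \<open>2 * d - 2\<close>,
  so \<open>d\<close> of them are even and \<open>d - 1\<close> odd; both ends of the path are
  covered by the even side.\<close>

definition even_part :: "nat monom" where "even_part = (\<Sum>j<d. Poly_Mapping.single (2 * j) 1)"
definition odd_part :: "nat monom" where "odd_part = (\<Sum>j<d - 1. Poly_Mapping.single (2 * j + 1) 1)"

lemma lookup_even_part: "lookup even_part k = (if even k \<and> k < 2 * d - 1 then 1 else 0)"
proof -
  have "lookup even_part k = (\<Sum>j<d. if j = k div 2 then (if even k then 1 else 0) else 0)"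
    unfolding even_part_def lookup_sum by (intro sum.cong) (auto simp: lookup_single when_def)
  then show ?thesis using d by (auto elim!: evenE)
qed

lemma lookup_odd_part: "lookup odd_part k = (if odd k \<and> k < 2 * d - 1 then 1 else 0)"
proof -
  have "lookup odd_part k = (\<Sum>j<d - 1. if j = k div 2 then (if odd k then 1 else 0) else 0)"
    unfolding odd_part_def lookup_sum by (intro sum.cong) (auto simp: lookup_single when_def elim!: oddE)
  then show ?thesis using d by (auto elim!: oddE)
qed

lemma parts_in_monoms: "even_part \<in> monoms {..<2 * d - 1}" "odd_part \<in> monoms {..<2 * d - 1}"
  by (auto simp: monoms_def in_keys_iff lookup_even_part lookup_odd_part split: if_splits)

lemma mdeg_even_part: "mdeg even_part = d"
  by (simp add: even_part_def mdeg_sum)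

text \<open>The relation contributed by the glued cycle: the path edges at even positions multiply to the
  same monomial as \<open>{a, b}\<close> and the path edges at odd positions.\<close>

lemma cycle_relation: "edge_weight (glue 0 even_part) = edge_weight (glue (Poly_Mapping.single {a, b} 1) odd_part)"
proof (rule edge_weight_glue_eqI)
  show "Poly_Mapping.single {a, b} 1 \<in> monoms E"
    by (rule single_in_monoms[OF ab(1)])
  fix v assume "v \<in> V"
  have "lookup (edge_weight (Poly_Mapping.single {a, b} 1)) v = (if v = a \<or> v = b then 1 else 0)"
    using ab(2) by (auto simp: edge_weight_single lookup_add lookup_single when_def)
  moreover have "edge_weight (0 :: 'v set monom) = 0"
    by (simp add: edge_weight_def)
  ultimately show "lookup (edge_weight 0) v +
      (if v = a then lookup even_part 0 else 0) + (if v = b then lookup even_part (2 * d - 2) else 0) =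
      lookup (edge_weight (Poly_Mapping.single {a, b} 1)) v +
      (if v = a then lookup odd_part 0 else 0) + (if v = b then lookup odd_part (2 * d - 2) else 0)"
    using ab(2) d by (auto simp: lookup_even_part lookup_odd_part)
next
  fix k assume "0 < k" "k < 2 * d - 1"
  then show "lookup even_part (k - 1) + lookup even_part k = lookup odd_part (k - 1) + lookup odd_part k"
    by (cases "even k") (auto simp: lookup_even_part lookup_odd_part)
qed simp

text \<open>The path monomials not divisible by \<open>even_part\<close>, the side of the cycle
  relation that is rewritten.\<close>

definition normal :: "nat monom set"
  where "normal = {c \<in> monoms {..<2 * d - 1}. \<exists>k<2 * d - 1. even k \<and> lookup c k = 0}"

lemma not_normal: "monoms {..<2 * d - 1} - normal = (+) even_part ` monoms {..<2 * d - 1}"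
proof (intro equalityI subsetI)
  fix c assume c: "c \<in> monoms {..<2 * d - 1} - normal"
  have "lookup even_part k \<le> lookup c k" for k
    using c by (auto simp: normal_def lookup_even_part)
  then have "c = even_part + (c - even_part)"
    by (intro poly_mapping_eqI) (simp add: lookup_add lookup_minus)
  then show "c \<in> (+) even_part ` monoms {..<2 * d - 1}"
    using c monoms_addD(2)[of even_part "c - even_part"] by auto
next
  fix c assume "c \<in> (+) even_part ` monoms {..<2 * d - 1}"
  then show "c \<in> monoms {..<2 * d - 1} - normal"
    using parts_in_monoms(1) by (auto simp: normal_def lookup_add lookup_even_part intro!: monoms_add)
qed

text \<open>Replacing \<open>even_part\<close> by \<open>odd_part\<close> and the edge
  \<open>{a, b}\<close> keeps the weight. Position 0 is even, so its exponent drops at each step,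
  which gives termination.\<close>

lemma normalize:
  assumes "m \<in> monoms E" "c \<in> monoms {..<2 * d - 1}"
  shows "\<exists>m'\<in>monoms E. \<exists>c'\<in>normal. edge_weight (glue m c) = edge_weight (glue m' c')"
  using assms
proof (induction "lookup c 0" arbitrary: m c rule: less_induct)
  case less
  show ?case
  proof (cases "c \<in> normal")
    case False
    then obtain c0 where c0: "c0 \<in> monoms {..<2 * d - 1}" "c = even_part + c0"
      using not_normal less.prems(2) by blast
    let ?m = "Poly_Mapping.single {a, b} 1 + m" and ?c = "odd_part + c0"
    have "edge_weight (glue m c) = edge_weight (glue 0 even_part) + edge_weight (glue m c0)"
      using glue_add[of 0 m even_part c0] by (simp add: c0(2) additive_weight_add[OF additive_edge_weight])
    also have "\<dots> = edge_weight (glue ?m ?c)"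
      unfolding cycle_relation by (simp add: glue_add additive_weight_add[OF additive_edge_weight])
    finally have eq: "edge_weight (glue m c) = edge_weight (glue ?m ?c)" .
    have "lookup ?c 0 < lookup c 0"
      using d by (simp add: c0(2) lookup_add lookup_even_part lookup_odd_part)
    moreover have "?m \<in> monoms E"
      by (intro monoms_add single_in_monoms ab(1) less.prems(1))
    moreover have "?c \<in> monoms {..<2 * d - 1}"
      by (intro monoms_add parts_in_monoms c0(1))
    ultimately show ?thesis
      unfolding eq by (rule less.hyps)
  qed (use less.prems in blast)
qed

lemma edge_weight_glue_cong:
  assumes "m \<in> monoms E" "m' \<in> monoms E" "edge_weight m = edge_weight m'"
  shows "edge_weight (glue m c) = edge_weight (glue m' c)"
  by (rule edge_weight_glue_eqI) (use assms in auto)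

text \<open>At an interior vertex the weight fixes the sum of two adjacent path exponents, so
  \<open>c\<close> and \<open>c'\<close> differ by an alternating \<open>\<delta>\<close>. Normality
  forces \<open>\<delta> = 0\<close>; then the path contributes equally at \<open>a\<close> and
  \<open>b\<close>, and the weights on \<open>G\<close> agree.\<close>

lemma glue_normal_unique:
  assumes m: "m \<in> monoms E" "m' \<in> monoms E" and c: "c \<in> normal" "c' \<in> normal"
    and eq: "edge_weight (glue m c) = edge_weight (glue m' c')"
  shows "edge_weight m = edge_weight m' \<and> c = c'"
proof -
  define \<delta> where "\<delta> = int (lookup c 0) - int (lookup c' 0)"
  have diff: "int (lookup c k) - int (lookup c' k) = (if even k then \<delta> else - \<delta>)" if "k < 2 * d - 1" for k
    using that
  proof (induction k)
    case (Suc k)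
    then have "lookup c k + lookup c (Suc k) = lookup c' k + lookup c' (Suc k)"
      using arg_cong[OF eq, of "\<lambda>p. lookup p (w (Suc k))"] m by (simp add: lookup_glue_new)
    then have "int (lookup c k) + int (lookup c (Suc k)) = int (lookup c' k) + int (lookup c' (Suc k))"
      by linarith
    then show ?case using Suc by (auto split: if_splits)
  qed (simp add: \<delta>_def)
  obtain k l where k: "k < 2 * d - 1" "even k" "lookup c k = 0" and l: "l < 2 * d - 1" "even l" "lookup c' l = 0"
    using c by (auto simp: normal_def)
  \<comment> \<open>The difference is \<open>\<delta>\<close> at both even positions; it is at most
    0 at \<open>k\<close> and at least 0 at \<open>l\<close>.\<close>
  have "\<delta> = 0"
    using diff[OF k(1)] diff[OF l(1)] k l by simp
  have "c = c'"
  proof (rule poly_mapping_eqI)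
    fix k
    show "lookup c k = lookup c' k"
    proof (cases "k < 2 * d - 1")
      case True
      then show ?thesis using diff[OF True] \<open>\<delta> = 0\<close> by (simp split: if_splits)
    next
      case False
      then have "k \<notin> keys c" "k \<notin> keys c'" using c by (auto simp: normal_def monoms_def)
      then show ?thesis by (simp add: in_keys_iff)
    qed
  qed
  moreover have "edge_weight m = edge_weight m'"
  proof (rule poly_mapping_eqI)
    fix v
    show "lookup (edge_weight m) v = lookup (edge_weight m') v"
    proof (cases "v \<in> V")
      case True
      then show ?thesis
        using arg_cong[OF eq, of "\<lambda>p. lookup p (i v)"] m \<open>c = c'\<close> by (simp add: lookup_glue_old)
    next
      case False
      then show ?thesis using m by (simp add: lookup_edge_weight_outside)
    qed
  qed
  ultimately show ?thesis by blast
qed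

end

lemma card_image_eq_of_fibres:
  assumes "\<And>x y. x \<in> M \<Longrightarrow> y \<in> M \<Longrightarrow> f x = f y \<longleftrightarrow> g x = g y"
  shows "card (f ` M) = card (g ` M)"
proof (rule bij_betw_same_card)
  show "bij_betw (\<lambda>z. g (inv_into M f z)) (f ` M) (g ` M)"
  proof (rule bij_betwI')
    have inv: "inv_into M f (f x) \<in> M" "f (inv_into M f (f x)) = f x" if "x \<in> M" for x
      using that by (auto intro: inv_into_into f_inv_into_f)
    then have g: "g (inv_into M f (f x)) = g x" if "x \<in> M" for x
      using assms that by blast
    show "g (inv_into M f z) = g (inv_into M f z') \<longleftrightarrow> z = z'" if zz: "z \<in> f ` M" "z' \<in> f ` M" for z z'
    proof -
      obtain x y where "x \<in> M" "y \<in> M" "z = f x" "z' = f y" using zz by blast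
      then show ?thesis using g assms by auto
    qed
    show "g (inv_into M f z) \<in> g ` M" if "z \<in> f ` M" for z
      using that by (intro imageI inv_into_into)
    show "\<exists>z\<in>f ` M. y = g (inv_into M f z)" if "y \<in> g ` M" for y
    proof -
      from that obtain x where "x \<in> M" "y = g x" by blast
      then show ?thesis using g by (intro bexI[of _ "f x"]) auto
    qed
  qed
qed

section \<open>Hilbert series of the glued graph\<close>

context path_gluing
begin

lemma edge_weight_graded_E:
  "m \<in> monoms E \<Longrightarrow> n \<in> monoms E \<Longrightarrow> edge_weight m = edge_weight n \<Longrightarrow> mdeg m = mdeg n"
  by (rule edge_weight_graded[OF edge_card])

lemma edge_weight_graded_F:
  "m \<in> monoms F \<Longrightarrow> n \<in> monoms F \<Longrightarrow> edge_weight m = edge_weight n \<Longrightarrow> mdeg m = mdeg n"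
  by (rule edge_weight_graded[OF F_card])

lemma normal_subset: "normal \<subseteq> monoms {..<2 * d - 1}"
  by (auto simp: normal_def)

text \<open>Normal forms exist and are unique up to the weight of their part on \<open>G\<close>. So
  a weight of \<open>H\<close> amounts to a weight of \<open>G\<close> and a normal path monomial
  with degrees adding up, which is a convolution.\<close>

lemma card_weights_F:
  "card (edge_weight ` {n \<in> monoms F. mdeg n = k}) =
    (\<Sum>j\<le>k. card (edge_weight ` {m \<in> monoms E. mdeg m = j}) * card {c \<in> normal. mdeg c = k - j})"
proof -
  define M where "M = {(m, c). m \<in> monoms E \<and> c \<in> normal \<and> mdeg m + mdeg c = k}"
  define f where "f = (\<lambda>(m, c). edge_weight (glue m c))"
  define g :: "'v set monom \<times> nat monom \<Rightarrow> 'v monom \<times> nat monom" where "g = (\<lambda>(m, c). (edge_weight m, c))"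
  have "edge_weight ` {n \<in> monoms F. mdeg n = k} = f ` M"
  proof (intro equalityI subsetI)
    fix z assume "z \<in> edge_weight ` {n \<in> monoms F. mdeg n = k}"
    then obtain n where n: "n \<in> monoms F" "mdeg n = k" "z = edge_weight n" by blast
    obtain m c where mc: "m \<in> monoms E" "c \<in> monoms {..<2 * d - 1}" "n = glue m c"
      by (rule glue_surj[OF n(1)])
    obtain m' c' where mc': "m' \<in> monoms E" "c' \<in> normal" "edge_weight (glue m c) = edge_weight (glue m' c')"
      using normalize[OF mc(1,2)] by blast
    have "mdeg (glue m' c') = k"
      using edge_weight_graded_F[OF glue_in_monoms glue_in_monoms mc'(3)] n(2) mc(3) by simp
    then have "mdeg m' + mdeg c' = k"
      using mdeg_glue[OF mc'(1)] mc'(2) normal_subset by auto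
    then have "(m', c') \<in> M" using mc' by (simp add: M_def)
    moreover have "z = f (m', c')" using mc' n(3) mc(3) by (simp add: f_def)
    ultimately show "z \<in> f ` M" by blast
  next
    fix z assume "z \<in> f ` M"
    then obtain m c where mc: "m \<in> monoms E" "c \<in> normal" "mdeg m + mdeg c = k" "z = edge_weight (glue m c)"
      by (auto simp: M_def f_def)
    then have "mdeg (glue m c) = k"
      using mdeg_glue[of m c] normal_subset by auto
    then show "z \<in> edge_weight ` {n \<in> monoms F. mdeg n = k}"
      using mc(4) glue_in_monoms by blast
  qed
  \<comment> \<open>By uniqueness of normal forms \<open>f\<close> and \<open>g\<close> identify the
    same pairs, so weights of \<open>H\<close> can be counted as pairs.\<close>
  also have "card (f ` M) = card (g ` M)"
  proof (rule card_image_eq_of_fibres)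
    fix x y assume "x \<in> M" "y \<in> M"
    then obtain m c m' c' where "x = (m, c)" "y = (m', c')" "m \<in> monoms E" "m' \<in> monoms E" "c \<in> normal" "c' \<in> normal"
      by (auto simp: M_def)
    then show "f x = f y \<longleftrightarrow> g x = g y"
      using glue_normal_unique[of m m' c c'] edge_weight_glue_cong[of m m' c]
      by (auto simp: f_def g_def)
  qed
  also have "g ` M = (\<Union>j\<in>{..k}. edge_weight ` {m \<in> monoms E. mdeg m = j} \<times> {c \<in> normal. mdeg c = k - j})"
  proof (intro equalityI subsetI)
    fix z assume "z \<in> g ` M"
    then obtain m c where "m \<in> monoms E" "c \<in> normal" "mdeg m + mdeg c = k" "z = (edge_weight m, c)"
      by (auto simp: M_def g_def)
    then show "z \<in> (\<Union>j\<in>{..k}. edge_weight ` {m \<in> monoms E. mdeg m = j} \<times> {c \<in> normal. mdeg c = k - j})"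
      by (intro UN_I[of "mdeg m"]) auto
  next
    fix z assume "z \<in> (\<Union>j\<in>{..k}. edge_weight ` {m \<in> monoms E. mdeg m = j} \<times> {c \<in> normal. mdeg c = k - j})"
    then obtain m c where "m \<in> monoms E" "c \<in> normal" "mdeg m + mdeg c = k" "z = (edge_weight m, c)"
      by auto
    then show "z \<in> g ` M"
      by (intro image_eqI[of _ _ "(m, c)"]) (auto simp: M_def g_def)
  qed
  also have "card \<dots> = (\<Sum>j\<le>k. card (edge_weight ` {m \<in> monoms E. mdeg m = j} \<times> {c \<in> normal. mdeg c = k - j}))"
  \<comment> \<open>The degree of \<open>c\<close> determines \<open>j\<close>, so the union is
    disjoint.\<close>
  proof (rule card_UN_disjoint)
    have "finite (edge_weight ` {m \<in> monoms E. mdeg m = j})" for j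
      by (intro finite_imageI finite_monoms_mdeg finite_E)
    moreover have "finite {c \<in> normal. mdeg c = j}" for j
      by (rule finite_mdeg_subset[OF _ normal_subset]) simp
    ultimately show "\<forall>j\<in>{..k}. finite (edge_weight ` {m \<in> monoms E. mdeg m = j} \<times> {c \<in> normal. mdeg c = k - j})"
      by blast
  qed (auto simp: disjoint_iff)
  finally show ?thesis
    by (simp add: card_cartesian_product)
qed

text \<open>The convolution splits off the series of \<open>normal\<close>. The other path monomials
  are multiples of \<open>even_part\<close>, of degree \<open>d\<close>, which yields the factor
  \<open>1 - fps_X ^ d\<close>; the exponent \<open>2 * d - 1\<close> is the number of new
  edges.\<close>

lemma hilbert_series_F:
  "hilbert_series F (toric_ideal W F :: ('w set, 'k::field) mpoly set) * (1 - fps_X) ^ (2 * d - 1) =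
    hilbert_series E (toric_ideal V E :: ('v set, 'k) mpoly set) * (1 - fps_X ^ d)"
proof -
  let ?HE = "hilbert_series E (toric_ideal V E :: ('v set, 'k) mpoly set)"
  let ?HF = "hilbert_series F (toric_ideal W F :: ('w set, 'k) mpoly set)"
  let ?L = "{..<2 * d - 1} :: nat set"
  have conv: "?HF = ?HE * count_series normal"
  proof (rule fps_ext)
    fix k
    show "fps_nth ?HF k = fps_nth (?HE * count_series normal) k"
      by (simp add: hilbert_series_def toric_ideal_eq fps_mult_nth count_series_def atLeast0AtMost
          hilbert_fun_kernel_ideal[OF additive_edge_weight finite_F]
          hilbert_fun_kernel_ideal[OF additive_edge_weight finite_E] card_weights_F)
  qed
  have "count_series (normal \<union> (monoms ?L - normal)) = count_series normal + count_series (monoms ?L - normal)"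
    by (rule count_series_Un[of ?L]) (use normal_subset in auto)
  moreover have "normal \<union> (monoms ?L - normal) = monoms ?L"
    using normal_subset by blast
  ultimately have "count_series (monoms ?L) = count_series normal + fps_X ^ d * count_series (monoms ?L)"
    unfolding not_normal count_series_shift mdeg_even_part by simp
  then have "count_series normal = count_series (monoms ?L) * (1 - fps_X ^ d)"
    by (simp add: algebra_simps)
  then have "?HF * (1 - fps_X) ^ (2 * d - 1) =
      ?HE * (1 - fps_X ^ d) * (count_series (monoms ?L) * (1 - fps_X) ^ (2 * d - 1))"
    unfolding conv by (simp only: mult_ac)
  then show ?thesis
    using count_series_monoms[of ?L] by simp
qed

definition glued_basis :: "'v set set \<Rightarrow> 'w set set"
  where "glued_basis B = (`) i ` B \<union> path_edge ` {..<2 * d - 2}"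

text \<open>The omitted last edge stands at the even position \<open>2 * d - 2\<close>, so monomials
  in \<open>glued_basis B\<close> automatically have a normal path part, and uniqueness of normal
  forms reduces injectivity to that for \<open>B\<close>.\<close>

lemma glued_basis:
  assumes "B \<subseteq> E" "inj_on edge_weight (monoms B)"
  shows "glued_basis B \<subseteq> F" "card (glued_basis B) = card B + (2 * d - 2)"
    "inj_on edge_weight (monoms (glued_basis B))"
proof -
  have lt: "{..<2 * d - 2} \<subseteq> {..<2 * d - 1}" by auto
  show sub: "glued_basis B \<subseteq> F"
    unfolding glued_basis_def F_eq by (intro Un_mono image_mono assms(1) lt)
  have disj: "path_edge k \<notin> (`) i ` E" if "k < 2 * d - 2" for k
    using that by (intro path_edge_notin) simp
  have "(`) i ` B \<inter> path_edge ` {..<2 * d - 2} = {}"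
  proof (rule equals0I)
    fix z assume z: "z \<in> (`) i ` B \<inter> path_edge ` {..<2 * d - 2}"
    from IntD2[OF z] obtain k where "k < 2 * d - 2" "z = path_edge k"
      by (elim imageE) simp
    moreover have "z \<in> (`) i ` E"
      using IntD1[OF z] image_mono[OF assms(1)] by (rule rev_subsetD)
    ultimately show False
      using disj by simp
  qed
  moreover have "card ((`) i ` B) = card B"
    by (rule card_image[OF inj_on_subset[OF inj_image_E assms(1)]])
  moreover have "card (path_edge ` {..<2 * d - 2}) = 2 * d - 2"
    using card_image[OF inj_on_subset[OF inj_path_edge lt]] by simp
  ultimately show "card (glued_basis B) = card B + (2 * d - 2)"
    using finite_subset[OF assms(1) finite_E] by (simp add: glued_basis_def card_Un_disjoint)
  have last: "2 * d - 2 < 2 * d - 1" using d by linarith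
  have last_notin: "path_edge (2 * d - 2) \<notin> glued_basis B"
  proof
    assume "path_edge (2 * d - 2) \<in> glued_basis B"
    then consider "path_edge (2 * d - 2) \<in> (`) i ` B" | "path_edge (2 * d - 2) \<in> path_edge ` {..<2 * d - 2}"
      unfolding glued_basis_def by (elim UnE)
    then show False
    proof cases
      case 1
      then show False
        using path_edge_notin[OF last] image_mono[OF assms(1)] by (metis subsetD)
    next
      case 2
      then obtain k where "k < 2 * d - 2" "path_edge (2 * d - 2) = path_edge k" by (elim imageE) simp
      then show False
        using inj_onD[OF inj_path_edge, of "2 * d - 2" k] last by simp
    qed
  qed
  have decomp: "\<exists>m\<in>monoms B. \<exists>c\<in>normal. n = glue m c" if n: "n \<in> monoms (glued_basis B)" for n
  proof -
    have nF: "n \<in> monoms F" using n monoms_mono[OF sub] by blast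
    obtain m c where mc: "m \<in> monoms E" "c \<in> monoms {..<2 * d - 1}" "n = glue m c"
      "\<And>e. e \<in> E \<Longrightarrow> lookup m e = lookup n (i ` e)"
      "\<And>k. k < 2 * d - 1 \<Longrightarrow> lookup c k = lookup n (path_edge k)"
      by (rule glue_surj[OF nF], rule that)
    have "lookup c (2 * d - 2) = 0"
      using mc(5)[OF last] n last_notin by (auto simp: monoms_def in_keys_iff)
    then have "c \<in> normal"
      using mc(2) last by (auto simp: normal_def intro!: exI[of _ "2 * d - 2"])
    moreover have "m \<in> monoms B"
      unfolding monoms_def
    proof clarify
      fix e assume e: "e \<in> keys m"
      then have eE: "e \<in> E" using mc(1) by (auto simp: monoms_def)
      then have "i ` e \<in> keys n" using e mc(4) by (simp add: in_keys_iff)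
      then have "i ` e \<in> glued_basis B" using n by (auto simp: monoms_def)
      moreover have "i ` e \<notin> path_edge ` {..<2 * d - 2}"
      proof
        assume "i ` e \<in> path_edge ` {..<2 * d - 2}"
        then obtain k where "k < 2 * d - 2" "i ` e = path_edge k" by (elim imageE) simp
        then show False using disj[of k] imageI[OF eE, of "(`) i"] by simp
      qed
      ultimately obtain g where "g \<in> B" "i ` e = i ` g" by (auto simp: glued_basis_def)
      then show "e \<in> B"
        using inj_onD[OF inj_image_E _ eE, of g] assms(1) by auto
    qed
    ultimately show ?thesis using mc(3) by blast
  qed
  show "inj_on edge_weight (monoms (glued_basis B))"
  proof (rule inj_onI)
    fix n n' assume n: "n \<in> monoms (glued_basis B)" "n' \<in> monoms (glued_basis B)" and eq: "edge_weight n = edge_weight n'"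
    obtain m c where mc: "m \<in> monoms B" "c \<in> normal" "n = glue m c" using decomp[OF n(1)] by blast
    obtain m' c' where mc': "m' \<in> monoms B" "c' \<in> normal" "n' = glue m' c'" using decomp[OF n(2)] by blast
    have "edge_weight m = edge_weight m' \<and> c = c'"
      using mc mc' eq monoms_mono[OF assms(1)] by (intro glue_normal_unique) auto
    then show "n = n'"
      using inj_onD[OF assms(2), of m m'] mc mc' by simp
  qed
qed

end

section \<open>The geometric sum and the comparison of the invariants\<close>

definition geometric_poly :: "nat \<Rightarrow> int poly"
  where "geometric_poly d = (\<Sum>k<d. monom 1 k)"

lemma coeff_geometric_poly: "coeff (geometric_poly d) k = (if k < d then 1 else 0)"
  by (simp add: geometric_poly_def coeff_sum)

lemma degree_geometric_poly: "d > 0 \<Longrightarrow> Polynomial.degree (geometric_poly d) = d - 1"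
  by (intro antisym degree_le le_degree) (auto simp: coeff_geometric_poly)

lemma poly_geometric_poly_1: "poly (geometric_poly d) 1 = int d"
  by (simp add: geometric_poly_def poly_sum poly_monom)

lemma fps_of_geometric_poly: "fps_of_poly (geometric_poly d) * (1 - fps_X) = 1 - fps_X ^ d"
proof -
  have "fps_of_poly (geometric_poly d) = (\<Sum>k<d. fps_X ^ k)"
    by (simp add: geometric_poly_def fps_of_poly_sum fps_of_poly_monom)
  then show ?thesis
    using one_diff_power_eq[of "fps_X :: int fps" d] by (simp only: mult.commute)
qed

theorem corollary6p10:
  fixes V :: "'v set" and E :: "'v set set"
    and W :: "'w set" and F :: "'w set set"
    and e :: "'v set" and d :: nat
  assumes "simple_graph V E"
    and "gvd E (toric_ideal V E :: ('v set, 'k::{alg_closed_field, field_char_0}) mpoly set)"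
    and "e \<in> E"
    and "d \<ge> 2"
    and "cycle_gluing V E e (2 * d) W F"
  shows "a_invariant F (toric_ideal W F :: ('w set, 'k) mpoly set) =
      a_invariant E (toric_ideal V E :: ('v set, 'k) mpoly set) - (int d - 1) \<and>
    hilbert_multiplicity F (toric_ideal W F :: ('w set, 'k) mpoly set) =
      int d * hilbert_multiplicity E (toric_ideal V E :: ('v set, 'k) mpoly set)"
proof -
  have n: "2 * d \<ge> 2" using assms(4) by simp
  have eV: "e \<subseteq> V" using assms(1,3) by (simp add: simple_graph_def)
  obtain i :: "'v \<Rightarrow> 'w" and w :: "nat \<Rightarrow> 'w" and a b where path:
    "inj_on i V" "e = {a, b}" "a \<noteq> b" "w 0 = i a" "w (2 * d - 1) = i b" "inj_on w {..<2 * d}"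
    "\<And>k. 0 < k \<Longrightarrow> k < 2 * d - 1 \<Longrightarrow> w k \<notin> i ` V"
    "F = (`) i ` E \<union> (\<lambda>k. {w k, w (Suc k)}) ` {..<2 * d - 1}"
    by (rule edge_gluing_path[OF assms(5) n assms(3) eV], rule that)
  interpret path_gluing V E i w a b d F
    by unfold_locales (use assms(1,3,4) path in auto)
  let ?HE = "hilbert_series E (toric_ideal V E :: ('v set, 'k) mpoly set)"
  let ?HF = "hilbert_series F (toric_ideal W F :: ('w set, 'k) mpoly set)"
  obtain B h where B: "B \<subseteq> E" "inj_on edge_weight (monoms B)"
    and "fps_of_poly h = hilbert_series E (kernel_ideal E edge_weight :: ('v set, 'k) mpoly set) * (1 - fps_X) ^ card B"
  proof (rule hilbert_series_kernel_ideal[where N = edge_weight and A = E and 'k = 'k])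
    show "additive_weight (edge_weight :: 'v set monom \<Rightarrow> 'v monom)" by (rule additive_edge_weight)
    show "finite E" by (rule finite_E)
    show "mdeg m = mdeg n" if "m \<in> monoms E" "n \<in> monoms E" "edge_weight m = edge_weight n" for m n
      using that by (rule edge_weight_graded_E)
  qed (rule that)
  then have h: "fps_of_poly h = ?HE * (1 - fps_X) ^ card B"
    by (simp only: toric_ideal_eq)
  \<comment> \<open>The constant term of \<open>h\<close> counts the weights in degree 0, of which
    there is one; so \<open>h\<close> is nonzero, as the degree formula for a product
    requires.\<close>
  have "{m \<in> monoms E. mdeg m = 0} = {0}"
  proof -
    have "m = 0" if "mdeg m = 0" for m :: "'v set monom"
      using that lookup_le_mdeg[of m] by (intro poly_mapping_eqI) simp
    then show ?thesis by auto
  qed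
  then have "fps_nth (fps_of_poly h) 0 = 1"
    unfolding h by (simp add: hilbert_series_def toric_ideal_eq hilbert_fun_kernel_ideal[OF additive_edge_weight finite_E]
        fps_power_zeroth)
  then have "h \<noteq> 0" by auto
  let ?h = "h * geometric_poly d"
  have card: "card (glued_basis B) = card B + (2 * d - 2)"
    by (rule glued_basis(2)[OF B])
  \<comment> \<open>The \<open>2 * d - 1\<close> new variables give one factor
    \<open>1 - fps_X\<close> more than the dimension does; it is kept apart and cancelled against
    \<open>1 - fps_X ^ d\<close>, leaving the geometric sum.\<close>
  have "?HF * (1 - fps_X) ^ (card B + (2 * d - 2)) * (1 - fps_X) =
      (?HF * (1 - fps_X) ^ (2 * d - 1)) * (1 - fps_X) ^ card B"
  proof -
    have "2 * d - 1 = Suc (2 * d - 2)" using assms(4) by simp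
    then show ?thesis by (simp only: power_add power_Suc mult_ac)
  qed
  also have "\<dots> = (?HE * (1 - fps_X) ^ card B) * (1 - fps_X ^ d)"
    unfolding hilbert_series_F by (simp only: mult_ac)
  also have "\<dots> = fps_of_poly ?h * (1 - fps_X)"
    unfolding h[symmetric] fps_of_geometric_poly[symmetric] fps_of_poly_mult by (simp only: mult_ac)
  finally have "fps_of_poly ?h = ?HF * (1 - fps_X) ^ card (glued_basis B)"
  proof -
    have "(1 - fps_X :: int fps) \<noteq> 0"
      by (metis fps_X_neq_one right_minus_eq)
    then show "?HF * (1 - fps_X) ^ (card B + (2 * d - 2)) * (1 - fps_X) = fps_of_poly ?h * (1 - fps_X) \<Longrightarrow> ?thesis"
      unfolding card by simp
  qed
  note invF = toric_invariants[OF finite_F glued_basis(1,3)[OF B] this]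
  note invE = toric_invariants[OF finite_E B h]
  have "geometric_poly d \<noteq> 0"
    using poly_geometric_poly_1[of d] assms(4) by auto
  then have "Polynomial.degree ?h = Polynomial.degree h + (d - 1)"
    using \<open>h \<noteq> 0\<close> assms(4) by (simp add: degree_mult_eq degree_geometric_poly)
  then show ?thesis
    unfolding invF invE card using assms(4) by (simp add: poly_geometric_poly_1 of_nat_diff)
qed

end
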